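(* Up to arithmetic equivalence there are exactly $11$ types of $7$-dimensional Delaunay simplices. Representatives are the simplices in $\mathbb{Z}^7$ with vertex set $S_i=\{e_0,e_1,\dots,e_6,w_i\}$, $1\le i\le 11$, where $e_1,\dots,e_7$ is the standard basis of $\mathbb{Z}^7$, $e_0=0$, and $$\begin{array}{l} w_1=e_7=(0,0,0,0,0,0,1),\\ w_2=(1,1,1,1,1,1,2),\\ w_3=(0,0,1,1,1,1,2),\\ w_4=(1,2,2,2,2,2,3),\\ w_5=(1,1,1,2,2,2,3),\\ w_6=(0,1,1,2,2,2,3),\\ w_7=(1,1,1,1,1,3,4),\\ w_8=(1,1,1,1,2,2,4),\\ w_9=(1,1,1,2,2,3,4),\\ w_{10}=(1,1,3,3,3,4,5),\\ w_{11}=(1,1,1,1,2,3,5). \end{array}$$ That is, each $S_i$ is the vertex set of a Delaunay simplex, the $S_i$ are pairwise arithmetically inequivalent, and every $7$-dimensional Delaunay simplex is arithmetically equivalent to one of them.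
   Context: A $7$-dimensional Delaunay simplex (in integral coordinates) is given by a set $S\subset\mathbb{Z}^7$ of $8$ affinely independent points for which there is a real polynomial function $f$ of degree at most $2$ on $\mathbb{R}^7$ with positive definite quadratic part such that $f(x)\ge 0$ for all $x\in\mathbb{Z}^7$ and $\{x\in\mathbb{Z}^7: f(x)=0\}=S$. Equivalently, $S$ is the vertex set of a Delaunay polytope of $\mathbb{Z}^7$ for the Euclidean structure given by some positive definite quadratic form (a full-dimensional polytope whose vertex set is the set of lattice points on a sphere having no lattice point in its interior). Two such sets are arithmetically equivalent if one is mapped to the other by an element of $\mathrm{AGL}_7(\mathbb{Z})$, the group of maps $x\mapsto Ax+b$ with $A\in\mathrm{GL}_7(\mathbb{Z})$, $b\in\mathbb{Z}^7$. *)

theory Defs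
  imports "HOL-Analysis.Analysis"
begin

definition real_vec :: "int ^ 'n \<Rightarrow> real ^ 'n" where
  "real_vec x = (\<chi> i. real_of_int (x $ i))"

definition posdef_quadratic :: "(real ^ 'n \<Rightarrow> real) \<Rightarrow> bool" where
  "posdef_quadratic f \<longleftrightarrow>
     (\<exists>(Q :: real ^ 'n ^ 'n) b c.
        transpose Q = Q \<and> (\<forall>x. x \<noteq> 0 \<longrightarrow> x \<bullet> (Q *v x) > 0) \<and>
        f = (\<lambda>x. x \<bullet> (Q *v x) + b \<bullet> x + c))"

definition delaunay_simplex :: "(int ^ 'n) set \<Rightarrow> bool" where
  "delaunay_simplex S \<longleftrightarrow>
     card S = CARD('n) + 1 \<and> \<not> affine_dependent (real_vec ` S) \<and>
     (\<exists>f. posdef_quadratic f \<and> (\<forall>x. f (real_vec x) \<ge> 0) \<and> {x. f (real_vec x) = 0} = S)"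

text \<open>Invertibility of \<open>A\<close> is over the integers, i.e. \<open>A \<in> GL\<^sub>n(\<int>)\<close>.\<close>

definition arith_equivalent :: "(int ^ 'n) set \<Rightarrow> (int ^ 'n) set \<Rightarrow> bool" where
  "arith_equivalent S T \<longleftrightarrow>
     (\<exists>(A :: int ^ 'n ^ 'n) b. invertible A \<and> (\<lambda>x. A *v x + b) ` S = T)"

definition apex :: "nat \<Rightarrow> int ^ 7" where
  "apex i =
     [vector [0,0,0,0,0,0,1],
      vector [1,1,1,1,1,1,2],
      vector [0,0,1,1,1,1,2],
      vector [1,2,2,2,2,2,3],
      vector [1,1,1,2,2,2,3],
      vector [0,1,1,2,2,2,3],
      vector [1,1,1,1,1,3,4],
      vector [1,1,1,1,2,2,4],
      vector [1,1,1,2,2,3,4],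
      vector [1,1,3,3,3,4,5],
      vector [1,1,1,1,2,3,5]] ! (i - 1)"

definition rep_simplex :: "nat \<Rightarrow> (int ^ 7) set" where
  "rep_simplex i =
     {0, axis 1 1, axis 2 1, axis 3 1, axis 4 1, axis 5 1, axis 6 1, apex i}"

text \<open>In the index type \<open>7\<close> the numeral \<open>7\<close> denotes the same element as \<open>0\<close>; the
  indices \<open>1, \<dots>, 7\<close> are nevertheless pairwise distinct and exhaust the type, and \<open>vector\<close>
  lists the coordinates in this order.\<close>

lemma UNIV_7: "(UNIV :: 7 set) = {1, 2, 3, 4, 5, 6, 7}"
proof (rule sym, rule card_subset_eq)
  show "card {1, 2, 3, 4, 5, 6, 7 :: 7} = card (UNIV :: 7 set)"
    by simp
qed auto

lemma vector_7 [simp]: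
  fixes a1 a2 a3 a4 a5 a6 a7 :: "'a :: zero"
  defines "v \<equiv> vector [a1, a2, a3, a4, a5, a6, a7] :: 'a ^ 7"
  shows "v $ 1 = a1" "v $ 2 = a2" "v $ 3 = a3" "v $ 4 = a4"
    "v $ 5 = a5" "v $ 6 = a6" "v $ 7 = a7"
  unfolding v_def vector_def by simp_all

lemma forall_7: "(\<forall>i :: 7. P i) \<longleftrightarrow> P 1 \<and> P 2 \<and> P 3 \<and> P 4 \<and> P 5 \<and> P 6 \<and> P 7"
  using UNIV_7 by (metis UNIV_I empty_iff insert_iff)

lemma apex_1: "apex 1 = axis 7 1"
  unfolding vec_eq_iff forall_7 by (simp add: apex_def axis_def)

end

theory Submission
  imports Defs "HOL-Combinatorics.Permutations" "HOL-Number_Theory.Cong"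
    "HOL-Computational_Algebra.Primes" "HOL-Computational_Algebra.Polynomial"
    "HOL-Library.Countable_Set"
begin

text \<open>A lattice point has barycentric coordinates \<open>a\<close> with respect to a Delaunay simplex, and these
  form an overlattice of the integer vectors of index \<open>m = |det|\<close>. If \<open>d\<^sub>i\<^sub>j\<close> is the squared distance of
  two vertices, emptiness of the sphere says \<open>\<Sum> d\<^sub>i\<^sub>j a\<^sub>i a\<^sub>j < 0\<close> for every lattice point that is not
  a vertex. Since all \<open>d\<^sub>i\<^sub>j\<close> are positive, a positive combination of the matrices \<open>a a\<^sup>T\<close> whose
  off-diagonal entries are nonnegative is impossible. This bounds the heights of the residue classes of
  \<open>a\<close> from below and leaves a finite enumeration.

  To show \<open>m \<le> 5\<close>, deform the quadratic form along a generic segment to a form all of whose Delaunay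
  simplices are unimodular. At the last parameter with a simplex of index at least \<open>6\<close> there is exactly
  one further lattice point \<open>x\<close> on its sphere, and exchanging \<open>x\<close> for a vertex with a positive
  coordinate gives a Delaunay simplex of index at most \<open>5\<close>. Hence \<open>m a\<^sub>i \<le> 5\<close> for the coordinates of
  \<open>x\<close>, and the enumeration excludes this.

  For \<open>m \<le> 5\<close> the quotient is cyclic with a generator that has residue \<open>1\<close> at some vertex, so the
  simplex has the stated shape with an apex read off from the residues. The representatives are Delaunay
  for quadratic forms that are diagonal in barycentric coordinates, and the residues modulo \<open>m\<close>
  distinguish them.\<close>


section \<open>Heights of glue classes\<close>

text \<open>The enumeration treats one order \<open>q\<close> at a time and so gives no bound on the
  index by itself. The bound comes from the flip: each negative coordinate of the extra lattice
  point raises the height of its residue class, so all but a few residues are at most 5, and the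
  difference body inequality then forces an order below 25. Only the orders 6 to 10 and 15 have to
  be excluded without this information. The quotient is not known to be cyclic in advance. Instead
  of invoking a structure theorem, columns of the vertex matrix are replaced by lattice points,
  which divides out one cyclic subgroup at a time, and a count of integral coordinates forbids two
  independent classes of order 2 or 3. Genericity means that no sphere acquires two extra points at
  once. The endpoint of the segment is a positive combination of the squares of \<open>x_i\<close>
  and \<open>x_i - x_j\<close>. Its Delaunay simplices are unimodular for all positive weights, so
  the weights can be taken as powers of a number outside a countable set of roots.\<close>

text \<open>\<open>G\<close> is meant to contain all integral combinations of barycentric coordinate
  vectors of lattice points, not only those of sum 1. This makes it a group above the integer
  vectors, in which residue classes can be multiplied. Apart from positivity of the distances,
  \<open>negative_type\<close> and \<open>empty\<close> are what is kept of the quadratic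
  form.\<close>

locale glue =
  fixes N :: nat and G :: "(nat \<Rightarrow> real) set" and d :: "nat \<Rightarrow> nat \<Rightarrow> real"
  assumes add: "a \<in> G \<Longrightarrow> b \<in> G \<Longrightarrow> (\<lambda>i. a i + b i) \<in> G"
    and uminus: "a \<in> G \<Longrightarrow> (\<lambda>i. - a i) \<in> G"
    and int: "(\<And>i. i < N \<Longrightarrow> a i \<in> \<int>) \<Longrightarrow> a \<in> G"
    and sum_Ints: "a \<in> G \<Longrightarrow> (\<Sum>i<N. a i) \<in> \<int>"
    and d_sym: "i < N \<Longrightarrow> j < N \<Longrightarrow> d i j = d j i"
    and d_diag: "i < N \<Longrightarrow> d i i = 0"
    and d_pos: "i < N \<Longrightarrow> j < N \<Longrightarrow> i \<noteq> j \<Longrightarrow> d i j > 0"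
    and negative_type: "(\<Sum>i<N. a i) = 0 \<Longrightarrow> (\<Sum>i<N. \<Sum>j<N. d i j * a i * a j) \<le> 0"
    and empty: "a \<in> G \<Longrightarrow> (\<Sum>i<N. a i) = 1 \<Longrightarrow> i < N \<Longrightarrow> a i \<notin> \<int> \<Longrightarrow>
      (\<Sum>i<N. \<Sum>j<N. d i j * a i * a j) < 0"
begin

definition quad :: "(nat \<Rightarrow> real) \<Rightarrow> real" where
  "quad a = (\<Sum>i<N. \<Sum>j<N. d i j * a i * a j)"

lemma diff: "a \<in> G \<Longrightarrow> b \<in> G \<Longrightarrow> (\<lambda>i. a i - b i) \<in> G"
  using add[of a "\<lambda>i. - b i"] uminus[of b] by simp

lemma shift: "a \<in> G \<Longrightarrow> (\<And>i. i < N \<Longrightarrow> b i - a i \<in> \<int>) \<Longrightarrow> b \<in> G"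
  using add[of a "\<lambda>i. b i - a i"] int[of "\<lambda>i. b i - a i"] by simp

lemma multiple: "a \<in> G \<Longrightarrow> (\<lambda>i. of_int k * a i) \<in> G"
proof (induction k rule: int_induct[where k = 0])
  case base
  show ?case by (rule int) simp
next
  case (step1 i)
  then show ?case using add[of "\<lambda>j. of_int i * a j" a] by (simp add: algebra_simps)
next
  case (step2 i)
  then show ?case using diff[of "\<lambda>j. of_int i * a j" a] by (simp add: algebra_simps)
qed

text \<open>The diagonal of \<open>d\<close> vanishes, so no term in \<open>s * s\<close> survives
  and the form changes linearly along a unit vector. This is why the weighted sums below collapse to
  multiples of \<open>quad a\<close>.\<close>

lemma quad_add_unit:
  assumes "i < N"
  shows "quad (\<lambda>j. a j + s * of_bool (j = i)) = quad a + 2 * s * (\<Sum>j<N. d i j * a j)"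
proof -
  have "quad (\<lambda>j. a j + s * of_bool (j = i)) =
      (\<Sum>k<N. \<Sum>j<N. d k j * a k * a j + s * (of_bool (j = i) * (d k j * a k))
         + s * (of_bool (k = i) * (d k j * a j))
         + s * s * (of_bool (k = i) * (of_bool (j = i) * d k j)))"
    unfolding quad_def by (intro sum.cong refl) (simp add: algebra_simps)
  also have "\<dots> = quad a + s * (\<Sum>k<N. d k i * a k) + s * (\<Sum>j<N. d i j * a j) + s * s * d i i"
    using assms
    by (simp add: sum.distrib quad_def flip: sum_distrib_left)
  also have "(\<Sum>k<N. d k i * a k) = (\<Sum>k<N. d i k * a k)"
    using assms d_sym by (intro sum.cong) auto
  finally show ?thesis using d_diag[OF assms] by simp
qed

lemma quad_uminus: "quad (\<lambda>i. - a i) = quad a"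
  by (simp add: quad_def)

lemma quad_weighted: "(\<Sum>i<N. a i * (\<Sum>j<N. d i j * a j)) = quad a"
  by (simp add: quad_def sum_distrib_left algebra_simps)

text \<open>Nonnegative coordinates make every summand of \<open>quad\<close> nonnegative.
  Geometrically, such a point would lie inside the simplex.\<close>

lemma height_one:
  assumes "a \<in> G" "\<And>i. i < N \<Longrightarrow> a i \<ge> 0" "i < N" "a i \<notin> \<int>"
  shows "(\<Sum>i<N. a i) \<noteq> 1"
proof
  assume "(\<Sum>i<N. a i) = 1"
  then have "quad a < 0" using empty assms unfolding quad_def by blast
  moreover have "quad a \<ge> 0" unfolding quad_def
    using assms(2) d_pos d_diag
    by (intro sum_nonneg mult_nonneg_nonneg) (metis lessThan_iff less_imp_le order_refl)+
  ultimately show False by simp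
qed

text \<open>The points \<open>a - e\<^sub>i\<close>, taken with weights \<open>a\<^sub>i\<close>, cancel.\<close>

lemma height_two:
  assumes "a \<in> G" "\<And>i. i < N \<Longrightarrow> a i \<ge> 0" "k < N" "a k \<notin> \<int>"
  shows "(\<Sum>i<N. a i) \<noteq> 2"
proof
  assume s: "(\<Sum>i<N. a i) = 2"
  define b where "b i = (\<lambda>j. a j + (- 1) * of_bool (j = i))" for i
  have neg: "quad (b i) < 0" if "i < N" for i
  proof -
    have "b i \<in> G" unfolding b_def by (rule shift[OF assms(1)]) simp
    moreover have "(\<Sum>j<N. b i j) = 1"
      using that s by (simp add: b_def sum_subtractf)
    moreover have "b i k \<notin> \<int>"
    proof
      assume "b i k \<in> \<int>"
      then have "b i k + of_bool (k = i) \<in> \<int>" by (intro Ints_add) auto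
      then show False using assms(4) by (simp add: b_def)
    qed
    ultimately show ?thesis using empty assms(3) unfolding quad_def by blast
  qed
  have "a k > 0" using assms(2)[OF assms(3)] assms(4) by (cases "a k = 0") auto
  have "(\<Sum>i<N. a i * quad (b i)) = (\<Sum>i<N. a i) * quad a - 2 * quad a"
  proof -
    have "(\<Sum>i<N. a i * quad (b i)) = (\<Sum>i<N. a i * quad a - 2 * (a i * (\<Sum>j<N. d i j * a j)))"
      unfolding b_def by (intro sum.cong refl) (simp only: quad_add_unit lessThan_iff, simp add: algebra_simps)
    then show ?thesis
      by (simp add: sum_subtractf quad_weighted flip: sum_distrib_left sum_distrib_right)
  qed
  also have "\<dots> = 0" using s by simp
  finally have "(\<Sum>i<N. a i * quad (b i)) = 0" .
  moreover have "(\<Sum>i<N. a i * quad (b i)) < 0"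
  proof -
    have "(\<Sum>i<N. a i * quad (b i)) < (\<Sum>i<N. 0)"
    proof (rule sum_strict_mono_ex1)
      show "\<forall>i\<in>{..<N}. a i * quad (b i) \<le> 0"
        using neg assms(2) by (auto simp: mult_le_0_iff less_imp_le)
      show "\<exists>i\<in>{..<N}. a i * quad (b i) < 0"
        using neg[OF assms(3)] \<open>a k > 0\<close> assms(3) by (auto intro!: bexI[of _ k] simp: mult_less_0_iff)
    qed simp
    then show ?thesis by simp
  qed
  ultimately show False by simp
qed

text \<open>The points \<open>e + e\<^sub>i\<close> and \<open>e\<^sub>i - e\<close>, weighted by the negative and the positive part of
  \<open>e\<close>, have total \<open>2 (s - 1) e e\<^sup>T\<close>, where \<open>s\<close> is the sum of the positive part.\<close>

lemma difference_body:
  assumes "e \<in> G" "(\<Sum>i<N. e i) = 0" "k < N" "e k \<notin> \<int>"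
  shows "(\<Sum>i<N. max 0 (e i)) > 1"
proof (rule ccontr)
  define p where "p i = max 0 (e i)" for i
  define m where "m i = max 0 (- e i)" for i
  define s where "s = (\<Sum>i<N. p i)"
  assume "\<not> ?thesis"
  then have s1: "s \<le> 1" by (simp add: s_def p_def)
  have pm: "e i = p i - m i" for i by (simp add: p_def m_def)
  have sm: "(\<Sum>i<N. m i) = s"
    using assms(2) by (simp add: pm sum_subtractf s_def)
  have neg: "quad (\<lambda>j. c * e j + 1 * of_bool (j = i)) < 0" if "i < N" "c = 1 \<or> c = -1" for i c
  proof -
    have cG: "(\<lambda>j. c * e j) \<in> G" using that(2) assms(1) uminus[of e] by auto
    have "(\<lambda>j. c * e j + 1 * of_bool (j = i)) \<in> G" by (rule shift[OF cG]) simp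
    moreover have "(\<Sum>j<N. c * e j + 1 * of_bool (j = i)) = 1"
      using that assms(2) by (simp add: sum.distrib flip: sum_distrib_left)
    moreover have "c * e k + 1 * of_bool (k = i) \<notin> \<int>"
    proof
      assume "c * e k + 1 * of_bool (k = i) \<in> \<int>"
      then have "c * e k + 1 * of_bool (k = i) - of_bool (k = i) \<in> \<int>"
        by (intro Ints_diff) auto
      then show False using assms(4) that(2) by auto
    qed
    ultimately show ?thesis using empty assms(3) unfolding quad_def by blast
  qed
  have q1: "quad (\<lambda>j. c * e j + 1 * of_bool (j = i)) = quad e + 2 * c * (\<Sum>j<N. d i j * e j)"
    if "i < N" "c = 1 \<or> c = -1" for i c
    unfolding quad_add_unit[OF that(1)] using that(2) quad_uminus[of e]
    by (auto simp: sum_negf)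
  let ?T = "\<lambda>i. m i * quad (\<lambda>j. 1 * e j + 1 * of_bool (j = i))
      + p i * quad (\<lambda>j. -1 * e j + 1 * of_bool (j = i))"
  have "(\<Sum>i<N. ?T i) = (\<Sum>i<N. (m i + p i) * quad e - 2 * (e i * (\<Sum>j<N. d i j * e j)))"
    by (intro sum.cong refl, subst q1, simp, simp, subst q1) (auto simp: pm algebra_simps)
  also have "\<dots> = (\<Sum>i<N. m i + p i) * quad e - 2 * quad e"
    by (simp only: sum_subtractf quad_weighted sum_distrib_left[symmetric] sum_distrib_right[symmetric])
  also have "\<dots> = 2 * (s - 1) * quad e"
    by (simp add: sum.distrib sm s_def[symmetric] algebra_simps)
  finally have eq: "(\<Sum>i<N. ?T i) = 2 * (s - 1) * quad e" .
  have "quad e \<le> 0" using negative_type[OF assms(2)] by (simp add: quad_def)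
  then have "(\<Sum>i<N. ?T i) \<ge> 0" using s1 eq by (simp add: mult_nonpos_nonpos)
  moreover have "(\<Sum>i<N. ?T i) < (\<Sum>i<N. 0)"
  proof (rule sum_strict_mono_ex1)
    have le: "m i * quad (\<lambda>j. 1 * e j + 1 * of_bool (j = i)) \<le> 0"
      "p i * quad (\<lambda>j. -1 * e j + 1 * of_bool (j = i)) \<le> 0" if "i < N" for i
      using neg[OF that, of 1] neg[OF that, of "-1"]
      by (auto simp: mult_le_0_iff p_def m_def)
    then show "\<forall>i\<in>{..<N}. ?T i \<le> 0" by (auto intro: add_nonpos_nonpos)
    have "e k \<noteq> 0" using assms(4) by auto
    then have "?T k < 0"
      using neg[OF assms(3), of 1] neg[OF assms(3), of "-1"]
      by (cases "e k > 0") (auto simp: p_def m_def mult_less_0_iff zero_less_mult_iff)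
    then show "\<exists>i\<in>{..<N}. ?T i < 0" using assms(3) by auto
  qed simp
  ultimately show False by simp
qed

text \<open>A Farkas argument in the unknown distances. It is reserved for the few classes that pass
  the height and difference body tests.\<close>

lemma certificate:
  assumes "finite I" "I \<noteq> {}"
    and "\<And>r. r \<in> I \<Longrightarrow> c r > 0 \<and> a r \<in> G \<and> (\<Sum>i<N. a r i) = 1 \<and> (\<exists>i<N. a r i \<notin> \<int>)"
    and "\<And>i j. i < j \<Longrightarrow> j < N \<Longrightarrow> (\<Sum>r\<in>I. c r * (a r i * a r j)) \<ge> 0"
  shows False
proof -
  have "(\<Sum>r\<in>I. c r * quad (a r)) < (\<Sum>r\<in>I. 0)"
    using assms(1,2)
  proof (rule sum_strict_mono)
    fix r assume "r \<in> I"
    then show "c r * quad (a r) < 0"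
      using assms(3)[of r] empty unfolding quad_def by (auto simp: mult_less_0_iff)
  qed
  moreover have "(\<Sum>r\<in>I. c r * quad (a r)) = (\<Sum>i<N. \<Sum>j<N. d i j * (\<Sum>r\<in>I. c r * (a r i * a r j)))"
    unfolding quad_def sum_distrib_left sum_distrib_right
    by (subst sum.swap, intro sum.cong refl, subst sum.swap, intro sum.cong refl)
       (simp add: algebra_simps)
  moreover have "\<dots> \<ge> 0"
  proof (intro sum_nonneg)
    fix i j assume "i \<in> {..<N}" "j \<in> {..<N}"
    then have ij: "i < N" "j < N" by simp_all
    have "(\<Sum>r\<in>I. c r * (a r i * a r j)) \<ge> 0" if "i \<noteq> j"
    proof (cases "i < j")
      case True
      then show ?thesis using assms(4) ij by blast
    next
      case False
      then have "(\<Sum>r\<in>I. c r * (a r j * a r i)) \<ge> 0" using assms(4) ij that by simp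
      then show ?thesis by (simp add: mult.commute)
    qed
    then show "d i j * (\<Sum>r\<in>I. c r * (a r i * a r j)) \<ge> 0"
      using d_pos[OF ij] d_diag[OF ij(1)] by (cases "i = j") auto
  qed
  ultimately show False by simp
qed

end

text \<open>Relabelling the vertices lets residue lists be sorted before they are enumerated.
  Membership is stated through the entries below \<open>N\<close> because values of a function on
  \<open>nat\<close> beyond \<open>N\<close> are unconstrained.\<close>

lemma glue_permute:
  assumes "glue N G d" and p: "bij_betw p {..<N} {..<N}"
  shows "glue N {a. \<exists>b\<in>G. \<forall>i<N. a i = b (p i)} (\<lambda>i j. d (p i) (p j))"
proof -
  interpret glue N G d by fact
  let ?G = "{a. \<exists>b\<in>G. \<forall>i<N. a i = b (p i)}"
  have pN: "p i < N" if "i < N" for i using p that by (auto simp: bij_betw_def)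
  have pinj: "p i = p j \<longleftrightarrow> i = j" if "i < N" "j < N" for i j
    using p that by (auto simp: bij_betw_def inj_on_def)
  have re: "(\<Sum>i<N. f (p i)) = (\<Sum>i<N. f i)" for f :: "nat \<Rightarrow> real"
    using sum.reindex_bij_betw[OF p] .
  have re2: "(\<Sum>i<N. \<Sum>j<N. d (p i) (p j) * b (p i) * b (p j)) = quad b" for b
  proof -
    have "(\<Sum>i<N. \<Sum>j<N. d (p i) (p j) * b (p i) * b (p j)) =
        (\<Sum>i<N. \<Sum>j<N. d i (p j) * b i * b (p j))"
      using re[of "\<lambda>i. \<Sum>j<N. d i (p j) * b i * b (p j)"] .
    also have "\<dots> = quad b"
      unfolding quad_def by (rule sum.cong[OF refl], rule re)
    finally show ?thesis .
  qed
  define q where "q = inv_into {..<N} p"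
  have q: "q i < N" "p (q i) = i" if "i < N" for i
    using p that unfolding q_def
    by (metis bij_betw_def inv_into_into lessThan_iff, metis bij_betw_inv_into_right lessThan_iff)
  have qp: "q (p i) = i" if "i < N" for i
    using p that unfolding q_def by (simp add: bij_betw_inv_into_left)
  show ?thesis
  proof
    fix a b assume "a \<in> ?G" "b \<in> ?G"
    then obtain a' b' where "a' \<in> G" "b' \<in> G" "\<forall>i<N. a i = a' (p i)" "\<forall>i<N. b i = b' (p i)" by auto
    then show "(\<lambda>i. a i + b i) \<in> ?G" using add[of a' b'] by auto
  next
    fix a assume "a \<in> ?G"
    then obtain a' where "a' \<in> G" "\<forall>i<N. a i = a' (p i)" by auto
    then show "(\<lambda>i. - a i) \<in> ?G" "(\<Sum>i<N. a i) \<in> \<int>"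
      using uminus[of a'] sum_Ints[of a'] re[of a'] by auto
  next
    fix a :: "nat \<Rightarrow> real" assume "\<And>i. i < N \<Longrightarrow> a i \<in> \<int>"
    then have "(\<lambda>i. a (q i)) \<in> G" using q by (intro int) auto
    then show "a \<in> ?G" using qp by (intro CollectI bexI[of _ "\<lambda>i. a (q i)"]) simp_all
  next
    fix i j assume "i < N" "j < N"
    then show "d (p i) (p j) = d (p j) (p i)" using d_sym pN by blast
  next
    fix i assume "i < N"
    then show "d (p i) (p i) = 0" using d_diag pN by blast
  next
    fix i j assume "i < N" "j < N" "i \<noteq> j"
    then show "d (p i) (p j) > 0" using d_pos pN pinj by blast
  next
    fix a :: "nat \<Rightarrow> real" assume s: "(\<Sum>i<N. a i) = 0"
    define b where "b = (\<lambda>i. a (q i))"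
    have ab: "a i = b (p i)" if "i < N" for i using qp that by (simp add: b_def)
    have "(\<Sum>i<N. b i) = 0" using re[of b] s ab by simp
    then have "quad b \<le> 0" using negative_type by (simp add: quad_def)
    then show "(\<Sum>i<N. \<Sum>j<N. d (p i) (p j) * a i * a j) \<le> 0"
      using re2[of b] ab by simp
  next
    fix a i assume "a \<in> ?G" and s: "(\<Sum>i<N. a i) = 1" and i: "i < N" "a i \<notin> \<int>"
    then obtain b where b: "b \<in> G" "\<forall>i<N. a i = b (p i)" by auto
    have "(\<Sum>i<N. b i) = 1" using re[of b] s b by simp
    then have "quad b < 0"
      using empty[OF b(1) _ pN[OF i(1)]] b i by (simp add: quad_def)
    then show "(\<Sum>i<N. \<Sum>j<N. d (p i) (p j) * a i * a j) < 0"
      using re2[of b] b by simp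
  qed
qed

section \<open>Admissible residue lists\<close>

text \<open>The heights of a class and of its negative add up to 8 minus the number of zeros, and
  both are at least 3. Hence at height 3, 4, 5 there are at most 2, 1, 0 zeros. Subtracting
  \<open>q\<close> from the top 3, 4 or 5 residues gives a vector of sum 0 whose positive part is
  the sum of the others; the difference body inequality requires that sum to exceed
  \<open>q\<close>.\<close>

fun admissible_sorted :: "int \<Rightarrow> int list \<Rightarrow> bool" where
  "admissible_sorted q [a, b, c, d, e, f, g, h] =
    (let s = a + b + c + d + e + f + g + h in
     if s = 3 * q then c > 0 \<and> a + b + c + d + e > q
     else if s = 4 * q then b > 0 \<and> a + b + c + d > q
     else if s = 5 * q then a > 0 \<and> a + b + c > q
     else False)"
| "admissible_sorted q _ = False"

definition admissible :: "int \<Rightarrow> int list \<Rightarrow> bool" where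
  "admissible q v = admissible_sorted q (sort v)"

lemma admissible_code [code]: "admissible q v = admissible_sorted q (foldr insort v [])"
  by (simp add: admissible_def sort_key_def)

definition fracs :: "int \<Rightarrow> int list \<Rightarrow> nat \<Rightarrow> real" where
  "fracs q v i = of_int (v ! i) / of_int q"

lemma sum_fracs: "length v = N \<Longrightarrow> (\<Sum>i<N. fracs q v i) = of_int (sum_list v) / of_int q"
  by (simp add: fracs_def sum_list_sum_nth atLeast0LessThan flip: sum_divide_distrib)

lemma fracs_Ints_iff: "q > 0 \<Longrightarrow> fracs q v i \<in> \<int> \<longleftrightarrow> q dvd v ! i"
proof
  assume "q > 0" "fracs q v i \<in> \<int>"
  then obtain k where "of_int (v ! i) / of_int q = (of_int k :: real)"
    by (auto simp: fracs_def elim: Ints_cases)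
  then have "(of_int (v ! i) :: real) = of_int (k * q)" using \<open>q > 0\<close> by (simp add: field_simps)
  then show "q dvd v ! i" by (metis dvd_triv_right of_int_eq_iff)
qed (auto simp: fracs_def dvd_def)

lemma (in glue) sum_list_dvd:
  assumes "length v = N" "q > 0" "fracs q v \<in> G"
  shows "q dvd sum_list v"
proof -
  have "fracs q [sum_list v] 0 \<in> \<int>"
    using sum_Ints[OF assms(3)] sum_fracs[OF assms(1), of q] by (simp add: fracs_def)
  then show ?thesis using fracs_Ints_iff[OF assms(2)] by fastforce
qed

text \<open>The height is an integer by \<open>sum_list_dvd\<close>, it is positive because some
  residue is, and the values 1 and 2 are ruled out by \<open>height_one\<close> and
  \<open>height_two\<close>.\<close>

lemma (in glue) three_le_height:
  assumes "length v = N" "q > 0" "fracs q v \<in> G" "\<And>x. x \<in> set v \<Longrightarrow> 0 \<le> x \<and> x < q"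
    "i < N" "v ! i \<noteq> 0"
  shows "3 * q \<le> sum_list v"
proof -
  obtain h where h: "sum_list v = q * h" using sum_list_dvd assms(1-3) by blast
  have v: "0 \<le> v ! j" "v ! j < q" if "j < N" for j
    using assms(4)[of "v ! j"] that assms(1) by auto
  have ni: "fracs q v i \<notin> \<int>"
    using fracs_Ints_iff[OF assms(2)] v[OF assms(5)] assms(6) by (metis zdvd_not_zless order_le_less)
  have nn: "fracs q v j \<ge> 0" if "j < N" for j using v[OF that] assms(2) by (simp add: fracs_def)
  have "(\<Sum>i<N. fracs q v i) = of_int h"
    using sum_fracs[OF assms(1), of q] h assms(2) by simp
  then have "h \<noteq> 1" "h \<noteq> 2"
    using height_one[OF assms(3) nn assms(5) ni] height_two[OF assms(3) nn assms(5) ni] by auto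
  moreover have "sum_list v > 0"
  proof -
    have "0 < v ! i" using v[OF assms(5)] assms(6) by simp
    also have "v ! i \<le> (\<Sum>j<N. v ! j)"
      using v assms(5) by (intro member_le_sum) auto
    finally show ?thesis using assms(1) by (simp add: sum_list_sum_nth atLeast0LessThan)
  qed
  ultimately have "h \<ge> 3" using h assms(2) by (simp add: zero_less_mult_iff)
  then show ?thesis using h assms(2) by (simp add: mult.commute)
qed

definition negate :: "int \<Rightarrow> int list \<Rightarrow> int list" where
  "negate q v = map (\<lambda>x. if x = 0 then 0 else q - x) v"

lemma (in glue) fracs_cong:
  assumes "fracs q v \<in> G" "q > 0" "\<And>i. i < N \<Longrightarrow> q dvd w ! i - v ! i"
  shows "fracs q w \<in> G"
proof (rule shift[OF assms(1)])
  fix i assume "i < N"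
  then obtain k where "w ! i - v ! i = q * k" using assms(3) by blast
  then have "fracs q w i - fracs q v i = of_int k"
    using assms(2) by (simp add: fracs_def diff_divide_distrib[symmetric] flip: of_int_diff)
  then show "fracs q w i - fracs q v i \<in> \<int>" by simp
qed

lemma (in glue) fracs_multiple:
  assumes "fracs q v \<in> G" "q > 0" "\<And>i. i < N \<Longrightarrow> q dvd w ! i - k * v ! i"
  shows "fracs q w \<in> G"
proof (rule shift[OF multiple[OF assms(1), of k]])
  fix i assume "i < N"
  then obtain l where "w ! i - k * v ! i = q * l" using assms(3) by blast
  then have "fracs q w i - of_int k * fracs q v i = of_int l"
    using assms(2) by (simp add: fracs_def diff_divide_distrib[symmetric] flip: of_int_diff of_int_mult)
      (simp add: field_simps)
  then show "fracs q w i - of_int k * fracs q v i \<in> \<int>" by simp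
qed

lemma (in glue) difference_body_list:
  assumes "length v = N" "q > 0" "fracs q v \<in> G" "sum_list v = 0" "i < N" "\<not> q dvd v ! i"
  shows "sum_list (map (max 0) v) > q"
proof -
  have "(\<Sum>i<N. max 0 (fracs q v i)) > 1"
    using assms sum_fracs[OF assms(1), of q] fracs_Ints_iff[OF assms(2)]
    by (intro difference_body[OF assms(3) _ assms(5)]) auto
  moreover have "(\<Sum>i<N. max 0 (fracs q v i)) = (\<Sum>i<N. fracs q (map (max 0) v) i)"
    using assms(1,2) by (intro sum.cong refl) (auto simp: fracs_def max_def divide_le_0_iff zero_le_divide_iff)
  ultimately show ?thesis
    using sum_fracs[of "map (max 0) v" N q] assms(1,2) by simp
qed

lemma glue_permute_list:
  assumes "glue N G d" "length v = N" "fracs q v \<in> G" "mset w = mset v"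
  shows "\<exists>G' d'. glue N G' d' \<and> fracs q w \<in> G'"
proof -
  obtain p where p: "p permutes {..<length v}" "permute_list p v = w"
    using mset_eq_permutation[OF assms(4)] .
  have "bij_betw p {..<N} {..<N}" using permutes_imp_bij[OF p(1)] assms(2) by simp
  moreover have "\<forall>i<N. fracs q w i = fracs q v (p i)"
    using p assms(2) permute_list_nth[OF p(1)] by (auto simp: fracs_def)
  ultimately show ?thesis using glue_permute[OF assms(1)] assms(3) by blast
qed

lemma all_less_8: "(\<forall>i<8. P i) \<longleftrightarrow> P 0 \<and> P 1 \<and> P 2 \<and> P 3 \<and> P 4 \<and> P 5 \<and> P 6 \<and> P 7" for P :: "nat \<Rightarrow> bool"
proof -
  have "{..<8 :: nat} = {0, 1, 2, 3, 4, 5, 6, 7}" by (simp add: lessThan_nat_numeral lessThan_Suc insert_commute)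
  then have "(\<forall>i<8. P i) \<longleftrightarrow> (\<forall>i\<in>{0, 1, 2, 3, 4, 5, 6, 7}. P i)" by (metis lessThan_iff)
  then show ?thesis by simp
qed

lemma list_8:
  assumes "length xs = 8"
  obtains a b c d e f g h where "xs = [a, b, c, d, e, f, g, h]"
proof -
  have "length xs = Suc (Suc (Suc (Suc (Suc (Suc (Suc (Suc 0)))))))" using assms by simp
  then show ?thesis using that by (simp only: length_Suc_conv length_0_conv) blast
qed

lemma admissible:
  assumes "glue 8 G d" "length v = 8" "q > 0" "fracs q v \<in> G"
    and "\<And>x. x \<in> set v \<Longrightarrow> 0 \<le> x \<and> x < q" "\<exists>x\<in>set v. x \<noteq> 0"
  shows "admissible q v"
proof -
  obtain G' d' where g: "glue 8 G' d'" "fracs q (sort v) \<in> G'"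
    using glue_permute_list[OF assms(1,2,4), of "sort v"] by auto
  interpret glue 8 G' d' by fact
  obtain a b c d e f g h where w: "sort v = [a, b, c, d, e, f, g, h]"
    by (rule list_8[of "sort v"]) (simp add: assms(2))
  have sorted: "a \<le> b" "b \<le> c" "c \<le> d" "d \<le> e" "e \<le> f" "f \<le> g" "g \<le> h"
    using sorted_sort[of v] unfolding w by auto
  have set: "set (sort v) = set v" by simp
  then have rng: "0 \<le> x \<and> x < q" if "x \<in> {a,b,c,d,e,f,g,h}" for x
    using assms(5) that unfolding w by auto
  have h0: "h \<noteq> 0"
  proof
    assume "h = 0"
    moreover have "0 \<le> a" using rng by simp
    ultimately have "a = 0" "b = 0" "c = 0" "d = 0" "e = 0" "f = 0" "g = 0" using sorted by linarith+
    with \<open>h = 0\<close> have "set (sort v) = {0}" by (simp add: w)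
    then show False using assms(6) set by auto
  qed
  let ?s = "a + b + c + d + e + f + g + h"
  have "3 * q \<le> sum_list (sort v)"
    using assms(2) h0 by (intro three_le_height[OF _ assms(3) g(2) _, of 7] assms(5)) (simp_all add: w[symmetric] set, simp add: w)
  then have lo: "3 * q \<le> ?s" by (simp add: w)
  have negG: "fracs q (negate q (sort v)) \<in> G'"
  proof (rule fracs_multiple[OF g(2) assms(3)])
    fix i :: nat assume "i < 8"
    then show "q dvd negate q (sort v) ! i - (- 1) * sort v ! i"
      using assms(2) by (auto simp: negate_def)
  qed
  have hi: "3 * q \<le> sum_list (negate q (sort v))"
  proof (rule three_le_height[OF _ assms(3) negG, of 7])
    show "negate q (sort v) ! 7 \<noteq> 0" using h0 rng[of h] by (simp add: w negate_def)
    fix x assume "x \<in> set (negate q (sort v))"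
    then obtain y where y: "y \<in> set v" "x = (if y = 0 then 0 else q - y)"
      using set by (auto simp: negate_def)
    then show "0 \<le> x \<and> x < q" using assms(3) assms(5)[OF y(1)] by auto
  qed (use assms(2) in \<open>auto simp: negate_def\<close>)
  define n where "n x = (if x = 0 then 0 else q - x)" for x
  have "sum_list (negate q (sort v)) = n a + n b + n c + n d + n e + n f + n g + n h"
    by (simp add: w negate_def n_def)
  with hi have hi': "3 * q \<le> n a + n b + n c + n d + n e + n f + n g + n h" by simp
  have le: "n x \<le> q - x" for x using assms(3) by (simp add: n_def)
  have n0: "n 0 = 0" by (simp add: n_def)
  note les = le[of a] le[of b] le[of c] le[of d] le[of e] le[of f] le[of g] le[of h]
  \<comment> \<open>In the negated list a nonzero residue \<open>x\<close> becomes
    \<open>q - x\<close> while a zero stays zero, so each known zero lowers the upper bound for the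
    sum by \<open>q\<close>.\<close>
  have s5: "?s \<le> 5 * q" using hi' les by linarith
  have s4: "?s \<le> 4 * q" if "a = 0" using hi' les n0 unfolding that by linarith
  have s3: "?s \<le> 3 * q" if "a = 0" "b = 0" using hi' les n0 unfolding that by linarith
  have s2: "?s \<le> 2 * q" if "a = 0" "b = 0" "c = 0" using hi' les n0 unfolding that by linarith
  have "q dvd ?s" using sum_list_dvd[OF _ assms(3) g(2)] assms(2) unfolding w by (auto simp: algebra_simps)
  then obtain k where k: "?s = q * k" by blast
  then have "3 \<le> k" "k \<le> 5" using lo s5 assms(3) by auto
  have "\<not> q dvd h" using rng[of h] h0 zdvd_not_zless[of h q] by auto
  then have ndvd: "\<not> q dvd h - q" using dvd_add[of q "h - q" q] by auto
  \<comment> \<open>The largest residue is nonzero and is among the lowered entries at every height,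
    so position 7 always witnesses that the vector is not integral.\<close>
  have body: "sum_list (map (max 0) u) > q"
    if "length u = 8" "\<And>i. i < 8 \<Longrightarrow> q dvd u ! i - sort v ! i" "sum_list u = 0" "u ! 7 = h - q" for u
    using that ndvd fracs_cong[OF g(2) assms(3) that(2)]
    by (intro difference_body_list[of u q 7] assms(3)) auto
  have rs: "0 \<le> a" "0 \<le> b" "0 \<le> c" "0 \<le> d" "0 \<le> e" "0 \<le> f" "0 \<le> g" "0 \<le> h"
    "a < q" "b < q" "c < q" "d < q" "e < q" "f < q" "g < q" "h < q"
    using rng by simp_all
  consider "k = 3" | "k = 4" | "k = 5" using \<open>3 \<le> k\<close> \<open>k \<le> 5\<close> by fastforce
  then have "admissible_sorted q [a, b, c, d, e, f, g, h]"
  proof cases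
    case 1
    have "\<forall>i<8. q dvd [a,b,c,d,e,f-q,g-q,h-q] ! i - sort v ! i" unfolding all_less_8 w by simp
    then have "q < sum_list (map (max 0) [a,b,c,d,e,f-q,g-q,h-q])"
      using k 1 by (intro body) auto
    then have "a + b + c + d + e > q" using rs by (simp add: max_def)
    moreover have "c > 0" using s2 rng[of a] rng[of b] rng[of c] sorted k 1 assms(3) by force
    ultimately show ?thesis using k 1 by simp
  next
    case 2
    have "\<forall>i<8. q dvd [a,b,c,d,e-q,f-q,g-q,h-q] ! i - sort v ! i" unfolding all_less_8 w by simp
    then have "q < sum_list (map (max 0) [a,b,c,d,e-q,f-q,g-q,h-q])"
      using k 2 by (intro body) auto
    then have "a + b + c + d > q" using rs by (simp add: max_def)
    moreover have "b > 0" using s3 rng[of a] rng[of b] sorted k 2 assms(3) by force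
    ultimately show ?thesis using k 2 assms(3) by simp
  next
    case 3
    have "\<forall>i<8. q dvd [a,b,c,d-q,e-q,f-q,g-q,h-q] ! i - sort v ! i" unfolding all_less_8 w by simp
    then have "q < sum_list (map (max 0) [a,b,c,d-q,e-q,f-q,g-q,h-q])"
      using k 3 by (intro body) auto
    then have "a + b + c > q" using rs by (simp add: max_def)
    moreover have "a > 0" using s4 rng[of a] k 3 assms(3) by force
    ultimately show ?thesis using k 3 assms(3) by simp
  qed
  then show ?thesis by (simp add: admissible_def w)
qed

section \<open>Exhaustive search over residue lists\<close>

text \<open>A single conditional subtraction reduces the sum, since the entries of both lists lie
  between 0 and \<open>q - 1\<close> in all uses.\<close>

fun add_mod :: "int \<Rightarrow> int list \<Rightarrow> int list \<Rightarrow> int list" where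
  "add_mod q (x # xs) (y # ys) = (let s = x + y in (if s < q then s else s - q) # add_mod q xs ys)"
| "add_mod q _ _ = []"

text \<open>\<open>excluded (q - 1) q v v\<close> runs through the multiples \<open>w = v, 2 v, 3 v, \<dots>\<close> modulo \<open>q\<close>.\<close>

primrec excluded :: "nat \<Rightarrow> int \<Rightarrow> int list \<Rightarrow> int list \<Rightarrow> bool" where
  "excluded 0 q v w = False"
| "excluded (Suc n) q v w =
    (list_all (\<lambda>x. x = 0) w \<or> \<not> admissible q w \<or> excluded n q v (add_mod q v w))"

primrec has_multiple_in :: "int list list \<Rightarrow> nat \<Rightarrow> int \<Rightarrow> int list \<Rightarrow> int list \<Rightarrow> bool" where
  "has_multiple_in C 0 q v w = False"
| "has_multiple_in C (Suc n) q v w = (sort w \<in> set C \<or> has_multiple_in C n q v (add_mod q v w))"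

text \<open>Backtracking over nondecreasing lists of sum \<open>s\<close> with entrywise upper
  bounds. The lower end \<open>s - sum_list cs\<close> discards entries for which the rest cannot
  make up the sum; the first disjunct discards entries that are too large, because all later ones
  are at least \<open>x\<close>. The accumulator is reversed, so \<open>P\<close> receives
  nonincreasing lists, whence \<open>rev (sort v)\<close> below.\<close>

primrec all_sorted :: "int list \<Rightarrow> int \<Rightarrow> int \<Rightarrow> int list \<Rightarrow> (int list \<Rightarrow> bool) \<Rightarrow> bool" where
  "all_sorted [] lo s acc P = (s = 0 \<longrightarrow> P acc)"
| "all_sorted (c # cs) lo s acc P =
    list_all (\<lambda>x. s < x + sum_list (map (\<lambda>_. x) cs) \<or> all_sorted cs x (s - x) (x # acc) P)
      [max lo (s - sum_list cs)..c]"

definition all_classes :: "int \<Rightarrow> (int list \<Rightarrow> bool) \<Rightarrow> bool" where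
  "all_classes q P = (let r = q - 1; C = [r, r, r, r, r, r, r, r] in
    all_sorted C 0 (3 * q) [] P \<and> all_sorted C 0 (4 * q) [] P \<and> all_sorted C 0 (5 * q) [] P)"

text \<open>At height \<open>h\<close> only the top \<open>h - 1\<close> residues may exceed 5. The
  number 5 is one less than 6, the smallest index to be excluded.\<close>

definition all_flip_classes :: "int \<Rightarrow> (int list \<Rightarrow> bool) \<Rightarrow> bool" where
  "all_flip_classes q P = (let r = q - 1 in
    all_sorted [5, 5, 5, 5, 5, 5, r, r] 0 (3 * q) [] P \<and>
    all_sorted [5, 5, 5, 5, 5, r, r, r] 0 (4 * q) [] P \<and>
    all_sorted [5, 5, 5, 5, r, r, r, r] 0 (5 * q) [] P)"

lemma all_sortedD:
  "all_sorted cs lo s acc P \<Longrightarrow> sorted xs \<Longrightarrow> \<forall>x\<in>set xs. lo \<le> x \<Longrightarrow> list_all2 (\<le>) xs cs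
    \<Longrightarrow> sum_list xs = s \<Longrightarrow> P (rev xs @ acc)"
proof (induction cs arbitrary: xs lo s acc)
  case (Cons c cs)
  then obtain y ys where xs: "xs = y # ys" "y \<le> c" "list_all2 (\<le>) ys cs"
    by (auto simp: list_all2_Cons2)
  have ys: "\<forall>x\<in>set ys. y \<le> x" "sorted ys" using Cons.prems(2) xs(1) by auto
  have 1: "sum_list ys \<le> sum_list cs"
    using xs(3) by (induction rule: list_all2_induct) auto
  have 2: "sum_list (map (\<lambda>_. y) cs) \<le> sum_list ys"
    using xs(3) ys(1) by (induction rule: list_all2_induct) auto
  have s: "s = y + sum_list ys" using Cons.prems(5) xs(1) by simp
  have "y \<in> set [max lo (s - sum_list cs)..c]"
    using xs(1,2) 1 s Cons.prems(3) by auto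
  with Cons.prems(1) have "s < y + sum_list (map (\<lambda>_. y) cs) \<or> all_sorted cs y (s - y) (y # acc) P"
    by (simp only: all_sorted.simps list_all_iff)
  then have "all_sorted cs y (s - y) (y # acc) P" using 2 s by auto
  from Cons.IH[OF this ys(2,1) xs(3)] show ?case using s xs(1) by simp
qed simp

definition multiples :: "int \<Rightarrow> int list \<Rightarrow> int \<Rightarrow> int list" where
  "multiples q v k = map (\<lambda>x. k * x mod q) v"

lemma add_mod_multiples:
  assumes "\<And>x. x \<in> set v \<Longrightarrow> 0 \<le> x \<and> x < q"
  shows "add_mod q v (multiples q v k) = multiples q v (k + 1)"
  using assms
proof (induction v)
  case (Cons x v)
  have x: "0 \<le> x" "x < q" using Cons.prems by auto
  then have y: "0 \<le> k * x mod q" "k * x mod q < q" by auto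
  have "(if x + k * x mod q < q then x + k * x mod q else x + k * x mod q - q) = (x + k * x mod q) mod q"
  proof (cases "x + k * x mod q < q")
    case False
    have "(x + k * x mod q) mod q = (x + k * x mod q - q) mod q" by (simp only: minus_mod_self2)
    also have "\<dots> = x + k * x mod q - q" using False x y by (intro mod_pos_pos_trivial) auto
    finally show ?thesis using False by simp
  qed (use x y in simp)
  also have "\<dots> = (k + 1) * x mod q" by (simp add: mod_add_right_eq distrib_right add.commute)
  finally show ?case using Cons by (simp add: multiples_def Let_def)
qed (simp add: multiples_def)

text \<open>The last condition makes \<open>q\<close> the exact order of the class modulo integer
  vectors: no smaller positive multiple vanishes.\<close>

definition glue_class :: "(nat \<Rightarrow> real) set \<Rightarrow> int \<Rightarrow> int list \<Rightarrow> bool" where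
  "glue_class G q v \<longleftrightarrow> length v = 8 \<and> q > 0 \<and> (\<forall>x\<in>set v. 0 \<le> x \<and> x < q) \<and> fracs q v \<in> G \<and>
     (\<forall>j. 1 \<le> j \<longrightarrow> j < q \<longrightarrow> (\<exists>x\<in>set v. \<not> q dvd j * x))"

lemma glue_class_multiple:
  assumes "glue 8 G d" "glue_class G q v"
  shows "fracs q (multiples q v k) \<in> G"
proof -
  interpret glue 8 G d by fact
  have v: "length v = 8" "q > 0" "fracs q v \<in> G" using assms(2) by (auto simp: glue_class_def)
  show ?thesis
  proof (rule fracs_multiple[OF v(3,2)])
    fix i :: nat assume "i < 8"
    then have "multiples q v k ! i = k * v ! i mod q" using v(1) by (simp add: multiples_def)
    then show "q dvd multiples q v k ! i - k * v ! i"
      by (metis mod_eq_dvd_iff mod_mod_trivial)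
  qed
qed

lemma glue_class_permute:
  assumes "glue 8 G d" "glue_class G q v" "mset w = mset v"
  shows "\<exists>G' d'. glue 8 G' d' \<and> glue_class G' q w"
proof -
  have "set w = set v" "length w = length v" using assms(3) by (metis set_mset_mset, metis size_mset)
  then show ?thesis
    using glue_permute_list[OF assms(1) _ _ assms(3), of q] assms(2)
    unfolding glue_class_def by fastforce
qed

text \<open>For a class of exact order \<open>q\<close>, the multiples by \<open>1\<close> to
  \<open>q - 1\<close> are nonzero classes and hence admissible, so the search for a vanishing or
  inadmissible one must fail.\<close>

lemma excludedD:
  assumes "glue 8 G d" "glue_class G q v"
  shows "excluded n q v (multiples q v k) \<Longrightarrow> 1 \<le> k \<Longrightarrow> k + int n \<le> q \<Longrightarrow> False"
proof (induction n arbitrary: k)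
  case (Suc n)
  let ?w = "multiples q v k"
  have v: "length v = 8" "q > 0" "\<And>x. x \<in> set v \<Longrightarrow> 0 \<le> x \<and> x < q"
    using assms(2) by (auto simp: glue_class_def)
  obtain x where x: "x \<in> set v" "\<not> q dvd k * x"
    using assms(2) Suc.prems by (auto simp: glue_class_def)
  then have nz: "\<exists>x\<in>set ?w. x \<noteq> 0" by (auto simp: multiples_def mod_eq_0_iff_dvd)
  have "admissible q ?w"
    using v nz by (intro admissible[OF assms(1) _ _ glue_class_multiple[OF assms]]) (auto simp: multiples_def)
  moreover have "\<not> list_all (\<lambda>x. x = 0) ?w" using nz by (auto simp: list_all_iff)
  ultimately have "excluded n q v (multiples q v (k + 1))"
    using Suc.prems(1) add_mod_multiples[OF v(3)] by simp
  then show ?case using Suc.IH[of "k + 1"] Suc.prems by simp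
qed simp

lemma has_multiple_inD:
  assumes "glue_class G q v"
  shows "has_multiple_in C n q v (multiples q v k) \<Longrightarrow>
    \<exists>j. k \<le> j \<and> j < k + int n \<and> sort (multiples q v j) \<in> set C"
proof (induction n arbitrary: k)
  case (Suc n)
  have "add_mod q v (multiples q v k) = multiples q v (k + 1)"
    using assms by (intro add_mod_multiples) (auto simp: glue_class_def)
  with Suc.prems consider "sort (multiples q v k) \<in> set C" | "has_multiple_in C n q v (multiples q v (k + 1))"
    by auto
  then show ?case
  proof cases
    case 1
    then show ?thesis by (intro exI[of _ k]) simp
  next
    case 2
    then obtain j where "k + 1 \<le> j" "j < k + 1 + int n" "sort (multiples q v j) \<in> set C"
      using Suc.IH by blast
    then show ?thesis by (intro exI[of _ j]) simp
  qed
qed simp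

lemma multiples_1: "glue_class G q v \<Longrightarrow> multiples q v 1 = v"
  by (auto simp: glue_class_def multiples_def intro: map_idI)

lemma class_heights:
  assumes "glue 8 G d" "glue_class G q v" "q > 1"
  shows "sum_list v \<in> {3 * q, 4 * q, 5 * q}"
proof -
  have "admissible q v"
    using assms unfolding glue_class_def
    by (intro admissible[OF assms(1)]) (auto, metis dvd_0_right mult_zero_right order_refl)
  moreover have "sum_list (sort v) = sum_list v" by (metis mset_sort sum_mset_sum_list)
  moreover have "length (sort v) = 8" using assms(2) by (simp add: glue_class_def)
  ultimately show ?thesis unfolding admissible_def
    by (rule_tac list_8[of "sort v"]) (auto simp: Let_def split: if_splits)
qed

lemma all_classesD:
  assumes "glue 8 G d" "glue_class G q v" "q > 1"
    and "all_classes q P"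
  shows "P (rev (sort v))"
proof -
  have "length (sort v) = 8" "\<forall>x\<in>set (sort v). 0 \<le> x \<and> x \<le> q - 1"
    using assms(2) by (auto simp: glue_class_def)
  then have "list_all2 (\<le>) (sort v) [q - 1, q - 1, q - 1, q - 1, q - 1, q - 1, q - 1, q - 1]"
    by (rule_tac list_8[of "sort v"]) auto
  moreover have "sum_list (sort v) = sum_list v" by (metis mset_sort sum_mset_sum_list)
  moreover have "\<forall>x\<in>set (sort v). 0 \<le> x" using assms(2) by (auto simp: glue_class_def)
  moreover have "all_sorted [q - 1, q - 1, q - 1, q - 1, q - 1, q - 1, q - 1, q - 1] 0 (sum_list v) [] P"
    using assms(4) class_heights[OF assms(1-3)] unfolding all_classes_def Let_def by auto
  ultimately have "P (rev (sort v) @ [])"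
    by (intro all_sortedD[where P = P and lo = 0 and s = "sum_list v"]) simp_all
  then show ?thesis by simp
qed

text \<open>The search runs over sorted lists only, so the class is first moved by a permutation of
  the vertices; sorting the resulting multiple removes the permutation again.\<close>

lemma class_canonical:
  assumes "glue 8 G d" "glue_class G q v" "q > 1"
    and "all_classes q (\<lambda>v. excluded (nat q - 1) q v v \<or> has_multiple_in C (nat q - 1) q v v)"
  shows "\<exists>j. 1 \<le> j \<and> j < q \<and> sort (multiples q v j) \<in> set C"
proof -
  let ?v = "rev (sort v)"
  obtain G' d' where g: "glue 8 G' d'" "glue_class G' q ?v"
    using glue_class_permute[OF assms(1,2), of ?v] by auto
  note v1 = multiples_1[OF g(2)]
  have "excluded (nat q - 1) q ?v ?v \<or> has_multiple_in C (nat q - 1) q ?v ?v"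
    using all_classesD[OF assms] .
  moreover have "\<not> excluded (nat q - 1) q ?v ?v"
    using excludedD[OF g, of "nat q - 1" 1] v1 assms(3) by (auto simp: of_nat_diff)
  ultimately obtain j where j: "1 \<le> j" "j < 1 + int (nat q - 1)" "sort (multiples q ?v j) \<in> set C"
    using has_multiple_inD[OF g(2), of C "nat q - 1" 1] v1 by auto
  moreover have "sort (multiples q ?v j) = sort (multiples q v j)"
    by (intro properties_for_sort) (simp_all add: multiples_def)
  ultimately show ?thesis using assms(3) by (auto simp: of_nat_diff)
qed

text \<open>An entry \<open>(c, k, u)\<close> of a certificate is a lattice point \<open>u / q\<close> in the class \<open>k v / q\<close>
  with weight \<open>c\<close>.\<close>

definition is_certificate :: "int \<Rightarrow> int list \<Rightarrow> (int \<times> int \<times> int list) list \<Rightarrow> bool" where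
  "is_certificate q v L \<longleftrightarrow> L \<noteq> [] \<and>
    list_all (\<lambda>(c, k, u). 0 < c \<and> length u = 8 \<and> sum_list u = q \<and>
      list_all2 (\<lambda>x y. (y - k * x) mod q = 0) v u \<and> \<not> list_all (\<lambda>x. x mod q = 0) u) L \<and>
    list_all (\<lambda>j. list_all (\<lambda>i. 0 \<le> (\<Sum>(c, k, u)\<leftarrow>L. c * (u ! i * u ! j))) [0..<j]) [0..<8]"

lemma is_certificateD:
  assumes "glue 8 G d" "length v = 8" "q > 0" "fracs q v \<in> G" and cert: "is_certificate q v L"
  shows False
proof -
  interpret glue 8 G d by fact
  define c :: "nat \<Rightarrow> real" where "c r = of_int (fst (L ! r))" for r
  define u where "u r = snd (snd (L ! r))" for r
  show False
  proof (rule certificate[of "{..<length L}" c "\<lambda>r. fracs q (u r)"])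
    fix r assume "r \<in> {..<length L}"
    then have "L ! r \<in> set L" by simp
    moreover obtain k where Lr: "L ! r = (fst (L ! r), k, u r)" unfolding u_def by (metis prod.collapse)
    ultimately have 1: "0 < fst (L ! r)" "length (u r) = 8" "sum_list (u r) = q"
      "list_all2 (\<lambda>x y. (y - k * x) mod q = 0) v (u r)" "\<not> list_all (\<lambda>x. x mod q = 0) (u r)"
      using cert unfolding is_certificate_def list_all_iff by (fastforce)+
    have "fracs q (u r) \<in> G"
      using 1(4) assms(2) by (intro fracs_multiple[OF assms(4,3), of _ k]) (auto simp: list_all2_conv_all_nth mod_eq_0_iff_dvd)
    moreover obtain i where "i < 8" "\<not> q dvd u r ! i"
      using 1(2,5) by (auto simp: list_all_length mod_eq_0_iff_dvd)
    moreover have "(\<Sum>i<8. fracs q (u r) i) = 1"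
      using sum_fracs[OF 1(2), of q] 1(3) assms(3) by simp
    ultimately show "0 < c r \<and> fracs q (u r) \<in> G \<and> (\<Sum>i<8. fracs q (u r) i) = 1 \<and> (\<exists>i<8. fracs q (u r) i \<notin> \<int>)"
      using 1(1) fracs_Ints_iff[OF assms(3)] by (auto simp: c_def)
  next
    fix i j :: nat assume ij: "i < j" "j < 8"
    then have "0 \<le> (\<Sum>(c, k, u)\<leftarrow>L. c * (u ! i * u ! j))"
      using cert by (auto simp: is_certificate_def list_all_iff)
    also have "\<dots> = (\<Sum>r<length L. fst (L ! r) * (u r ! i * u r ! j))"
      by (simp add: sum_list_sum_nth atLeast0LessThan u_def case_prod_beta)
    finally have "(0 :: real) \<le> of_int (\<Sum>r<length L. fst (L ! r) * (u r ! i * u r ! j))"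
      by (simp only: of_int_0_le_iff)
    then have "0 \<le> (of_int (\<Sum>r<length L. fst (L ! r) * (u r ! i * u r ! j)) :: real) / (of_int q * of_int q)"
      by (rule divide_nonneg_nonneg) simp
    also have "\<dots> = (\<Sum>r\<in>{..<length L}. c r * (fracs q (u r) i * fracs q (u r) j))"
      by (simp add: c_def fracs_def sum_divide_distrib)
    finally show "0 \<le> (\<Sum>r\<in>{..<length L}. c r * (fracs q (u r) i * fracs q (u r) j))" .
  qed (use cert in \<open>auto simp: is_certificate_def\<close>)
qed

section \<open>Enumeration of residue classes\<close>

text \<open>The classes of order 5 and 7 treated here are admissible together with all their nonzero
  multiples, so a combination of several lattice points is needed to refute them.\<close>

lemma no_class_5a: "is_certificate 5 [1, 1, 1, 1, 2, 3, 3, 3]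
    [(1, 1, [1, 1, 1, 1, 2, -2, -2, 3]),
     (1, 4, [-1, -1, -1, -1, 3, 2, 2, 2]),
     (1, 2, [2, -3, 2, 2, -1, 1, 1, 1]),
     (1, 2, [-3, 2, 2, 2, -1, 1, 1, 1]),
     (1, 2, [2, 2, -3, 2, -1, 1, 1, 1]),
     (1, 1, [1, 1, 1, 1, 2, -2, 3, -2]),
     (1, 1, [1, 1, 1, 1, 2, 3, -2, -2]),
     (1, 2, [2, 2, 2, -3, -1, 1, 1, 1])]"
  by code_simp

lemma no_class_5b: "is_certificate 5 [1, 1, 2, 2, 3, 3, 4, 4]
    [(1, 1, [1, 1, 2, 2, 3, -2, -1, -1]),
     (1, 2, [2, 2, -1, -1, 1, 1, -2, 3]),
     (1, 4, [-1, -1, 3, -2, 2, 2, 1, 1]),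
     (1, 1, [1, 1, 2, 2, -2, 3, -1, -1]),
     (1, 3, [-2, 3, 1, 1, -1, -1, 2, 2]),
     (1, 2, [2, 2, -1, -1, 1, 1, 3, -2]),
     (1, 4, [-1, -1, -2, 3, 2, 2, 1, 1]),
     (1, 3, [3, -2, 1, 1, -1, -1, 2, 2])]"
  by code_simp

lemma no_class_7a: "is_certificate 7 [1, 1, 1, 2, 3, 3, 5, 5]
    [(1, 3, [3, 3, 3, -1, -5, 2, 1, 1]),
     (2, 3, [-4, 3, 3, -1, 2, 2, 1, 1]),
     (2, 1, [1, 1, 1, 2, 3, 3, -2, -2]),
     (1, 5, [-2, -2, -2, 3, 1, 1, 4, 4]),
     (1, 1, [1, 1, 1, 2, -4, 3, -2, 5]),
     (1, 2, [2, 2, 2, 4, -1, -1, 3, -4]),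
     (2, 3, [3, -4, 3, -1, 2, 2, 1, 1]),
     (2, 3, [3, 3, -4, -1, 2, 2, 1, 1]),
     (1, 3, [3, 3, 3, -1, 2, -5, 1, 1]),
     (1, 1, [1, 1, 1, 2, 3, -4, -2, 5])]"
  by code_simp

lemma no_class_7b: "is_certificate 7 [1, 1, 1, 2, 3, 4, 4, 5]
    [(1, 1, [1, 1, 1, 2, 3, 4, -3, -2]),
     (3, 2, [2, 2, 2, -3, -1, 1, 1, 3]),
     (1, 2, [2, 2, -5, 4, -1, 1, 1, 3]),
     (1, 3, [3, 3, 3, -1, 2, -2, -2, 1]),
     (1, 5, [-2, 5, -2, 3, 1, -1, -1, 4]),
     (1, 2, [-5, 2, 2, 4, -1, 1, 1, 3]),
     (2, 2, [2, 2, 2, 4, -1, 1, 1, -4]),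
     (1, 1, [1, 1, 1, 2, 3, -3, 4, -2]),
     (1, 2, [2, -5, 2, 4, -1, 1, 1, 3]),
     (1, 6, [-1, -1, -1, -2, 4, 3, 3, 2]),
     (1, 5, [-2, -2, 5, 3, 1, -1, -1, 4]),
     (1, 5, [5, -2, -2, 3, 1, -1, -1, 4])]"
  by code_simp

lemma no_class_7c: "is_certificate 7 [1, 1, 2, 2, 3, 3, 4, 5]
    [(2, 5, [-2, -2, 3, 3, 1, 1, -1, 4]),
     (2, 3, [3, 3, -1, -1, 2, 2, -2, 1]),
     (1, 1, [1, 1, 2, 2, -4, 3, 4, -2]),
     (1, 4, [-3, 4, 1, 1, 5, -2, 2, -1]),
     (1, 6, [-1, -1, -2, -2, 4, 4, 3, 2]),
     (2, 2, [2, 2, -3, 4, -1, -1, 1, 3]),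
     (1, 4, [4, -3, 1, 1, 5, -2, 2, -1]),
     (1, 5, [5, -2, 3, 3, 1, 1, -1, -3]),
     (2, 2, [2, 2, 4, -3, -1, -1, 1, 3]),
     (1, 5, [-2, 5, 3, 3, 1, 1, -1, -3])]"
  by code_simp

text \<open>For the orders 2 to 5 the surviving lists, apart from the two of order 5 refuted above,
  are the sorted residues of the representatives of that index.\<close>

lemma classes_2: "all_classes 2 (\<lambda>v. excluded (nat 2 - 1) 2 v v \<or>
    has_multiple_in [[1,1,1,1,1,1,1,1], [0,0,1,1,1,1,1,1]] (nat 2 - 1) 2 v v)"
  by code_simp

lemma classes_3: "all_classes 3 (\<lambda>v. excluded (nat 3 - 1) 3 v v \<or>
    has_multiple_in [[1,1,1,1,1,1,1,2], [1,1,1,1,2,2,2,2], [0,1,1,1,1,1,2,2]] (nat 3 - 1) 3 v v)"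
  by code_simp

lemma classes_4: "all_classes 4 (\<lambda>v. excluded (nat 4 - 1) 4 v v \<or>
    has_multiple_in [[1,1,3,3,3,3,3,3], [1,2,2,3,3,3,3,3], [1,1,1,2,2,3,3,3]] (nat 4 - 1) 4 v v)"
  by code_simp

lemma classes_5: "all_classes 5 (\<lambda>v. excluded (nat 5 - 1) 5 v v \<or>
    has_multiple_in [[1,1,2,2,2,4,4,4], [1,2,3,3,4,4,4,4], [1,1,1,1,2,3,3,3], [1,1,2,2,3,3,4,4]]
      (nat 5 - 1) 5 v v)"
  by code_simp

lemma classes_7: "all_classes 7 (\<lambda>v. excluded (nat 7 - 1) 7 v v \<or>
    has_multiple_in [[1,1,1,2,3,3,5,5], [1,1,1,2,3,4,4,5], [1,1,2,2,3,3,4,5]] (nat 7 - 1) 7 v v)"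
  by code_simp

lemma classes_6: "all_classes 6 (\<lambda>v. excluded (nat 6 - 1) 6 v v)"
  by code_simp

lemma classes_8: "all_classes 8 (\<lambda>v. excluded (nat 8 - 1) 8 v v)"
  by code_simp

lemma classes_9: "all_classes 9 (\<lambda>v. excluded (nat 9 - 1) 9 v v)"
  by code_simp

lemma classes_10: "all_classes 10 (\<lambda>v. excluded (nat 10 - 1) 10 v v)"
  by code_simp

text \<open>A flip forces an order below 25, and complete enumerations cover the orders up to 10,
  which leaves 11 to 24 for the restricted enumeration.\<close>

lemma flip_classes_11: "all_flip_classes 11 (\<lambda>v. excluded (nat 11 - 1) 11 v v)"
  by code_simp

lemma flip_classes_12: "all_flip_classes 12 (\<lambda>v. excluded (nat 12 - 1) 12 v v)"
  by code_simp

lemma flip_classes_13: "all_flip_classes 13 (\<lambda>v. excluded (nat 13 - 1) 13 v v)"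
  by code_simp

lemma flip_classes_14: "all_flip_classes 14 (\<lambda>v. excluded (nat 14 - 1) 14 v v)"
  by code_simp

lemma flip_classes_15: "all_flip_classes 15 (\<lambda>v. excluded (nat 15 - 1) 15 v v)"
  by code_simp

lemma flip_classes_16: "all_flip_classes 16 (\<lambda>v. excluded (nat 16 - 1) 16 v v)"
  by code_simp

lemma flip_classes_17: "all_flip_classes 17 (\<lambda>v. excluded (nat 17 - 1) 17 v v)"
  by code_simp

lemma flip_classes_18: "all_flip_classes 18 (\<lambda>v. excluded (nat 18 - 1) 18 v v)"
  by code_simp

lemma flip_classes_19: "all_flip_classes 19 (\<lambda>v. excluded (nat 19 - 1) 19 v v)"
  by code_simp

lemma flip_classes_20: "all_flip_classes 20 (\<lambda>v. excluded (nat 20 - 1) 20 v v)"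
  by code_simp

lemma flip_classes_21: "all_flip_classes 21 (\<lambda>v. excluded (nat 21 - 1) 21 v v)"
  by code_simp

lemma flip_classes_22: "all_flip_classes 22 (\<lambda>v. excluded (nat 22 - 1) 22 v v)"
  by code_simp

lemma flip_classes_23: "all_flip_classes 23 (\<lambda>v. excluded (nat 23 - 1) 23 v v)"
  by code_simp

lemma flip_classes_24: "all_flip_classes 24 (\<lambda>v. excluded (nat 24 - 1) 24 v v)"
  by code_simp

text \<open>Each entry is given by its lift divisible by \<open>3\<close> and its two other lifts; at most one
  lift divisible by \<open>3\<close> may be chosen.\<close>

primrec all_lifts :: "(int \<times> int \<times> int) list \<Rightarrow> bool \<Rightarrow> int \<Rightarrow> int list \<Rightarrow> (int list \<Rightarrow> bool) \<Rightarrow> bool" where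
  "all_lifts [] b s acc P = (s = 45 \<or> s = 60 \<or> s = 75 \<longrightarrow> P acc)"
| "all_lifts (c # cs) b s acc P = (case c of (x, y, z) \<Rightarrow>
    (b \<or> all_lifts cs True (s + x) (x # acc) P) \<and>
    all_lifts cs b (s + y) (y # acc) P \<and> all_lifts cs b (s + z) (z # acc) P)"

definition lift_15 :: "int \<Rightarrow> int \<times> int \<times> int" where
  "lift_15 c = (if c = 1 then (6, 1, 11) else if c = 2 then (12, 2, 7)
     else if c = 3 then (3, 8, 13) else (9, 4, 14))"

text \<open>A class of order 15 in a simplex of index 15 need not be the class of the point met at
  the flip, so the restricted enumeration does not apply to it. Modulo 5 it is, up to a unit, one of
  the two canonical classes, and every residue modulo 5 has three lifts modulo 15.\<close>

lemma lifts_15: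
  "all_lifts (map lift_15 [1,1,2,2,2,4,4,4]) False 0 [] (\<lambda>v. excluded (nat 15 - 1) 15 v v)"
  "all_lifts (map lift_15 [1,2,3,3,4,4,4,4]) False 0 [] (\<lambda>v. excluded (nat 15 - 1) 15 v v)"
  by code_simp+

section \<open>Integer matrices and their glue groups\<close>

definition integral_vec :: "real ^ 'k \<Rightarrow> bool" where
  "integral_vec a \<longleftrightarrow> (\<forall>i. a $ i \<in> \<int>)"

definition real_mat :: "int ^ 'k ^ 'k \<Rightarrow> real ^ 'k ^ 'k" where
  "real_mat W = (\<chi> i j. real_of_int (W $ i $ j))"

text \<open>With the vertices as columns of \<open>W\<close>, this is the lattice written in
  barycentric coordinates. For nonsingular \<open>W\<close> its quotient by the integer vectors has
  order \<open>\<bar>det W\<bar>\<close>.\<close>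

definition glue_group :: "int ^ 'k ^ 'k \<Rightarrow> (real ^ 'k::finite) set" where
  "glue_group W = {a. integral_vec (real_mat W *v a)}"

lemma integral_vec_add: "integral_vec a \<Longrightarrow> integral_vec b \<Longrightarrow> integral_vec (a + b)"
  and integral_vec_diff: "integral_vec a \<Longrightarrow> integral_vec b \<Longrightarrow> integral_vec (a - b)"
  and integral_vec_scaleR: "x \<in> \<int> \<Longrightarrow> integral_vec a \<Longrightarrow> integral_vec (x *\<^sub>R a)"
  and integral_vec_axis: "integral_vec (axis i 1)"
  by (auto simp: integral_vec_def axis_def)

lemma integral_vec_combination:
  assumes "integral_vec a" "integral_vec b"
  shows "integral_vec (of_int x *\<^sub>R a + of_int y *\<^sub>R b)" "integral_vec (of_int x *\<^sub>R a - of_int y *\<^sub>R b)"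
  by (intro integral_vec_add integral_vec_diff integral_vec_scaleR Ints_of_int assms)+

lemma integral_vec_real_vec: "integral_vec (real_vec x)"
  by (simp add: integral_vec_def real_vec_def)

lemma integral_vecE:
  assumes "integral_vec a"
  obtains x where "a = real_vec x"
proof
  show "a = real_vec (\<chi> i. \<lfloor>a $ i\<rfloor>)"
    using assms by (auto simp: integral_vec_def real_vec_def vec_eq_iff elim: Ints_cases)
qed

lemma det_real_mat: "det (real_mat W) = of_int (det W)"
  by (simp add: det_def real_mat_def)

lemma integral_vec_mult: "integral_vec a \<Longrightarrow> integral_vec (real_mat W *v a)"
  by (auto simp: integral_vec_def real_mat_def matrix_vector_mult_def intro!: Ints_sum Ints_mult)

lemma glue_group_integral: "integral_vec a \<Longrightarrow> a \<in> glue_group W"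
  by (simp add: glue_group_def integral_vec_mult)

lemma glue_group_add: "a \<in> glue_group W \<Longrightarrow> b \<in> glue_group W \<Longrightarrow> a + b \<in> glue_group W"
  and glue_group_diff: "a \<in> glue_group W \<Longrightarrow> b \<in> glue_group W \<Longrightarrow> a - b \<in> glue_group W"
  by (simp_all add: glue_group_def integral_vec_add integral_vec_diff
      matrix_vector_right_distrib matrix_vector_mult_diff_distrib)

lemma glue_group_scaleR: "x \<in> \<int> \<Longrightarrow> a \<in> glue_group W \<Longrightarrow> x *\<^sub>R a \<in> glue_group W"
  by (simp add: glue_group_def integral_vec_scaleR matrix_vector_mult_scaleR)

text \<open>The columns of the inverse matrix lie in the glue group. If they are integral, two
  integer determinants have product 1. Read contrapositively, an index above 1 yields a nonintegral
  class.\<close>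

lemma glue_group_trivial:
  assumes "det W \<noteq> 0" "\<And>a. a \<in> glue_group W \<Longrightarrow> integral_vec a"
  shows "\<bar>det W\<bar> = 1"
proof -
  have "invertible (real_mat W)"
    using assms(1) by (simp add: invertible_det_nz det_real_mat)
  then obtain B where WB: "real_mat W ** B = mat 1" by (auto simp: invertible_def)
  have "integral_vec (B *v axis j 1)" for j
    by (rule assms(2)) (simp add: glue_group_def matrix_vector_mul_assoc WB integral_vec_axis)
  then have B: "B $ i $ j \<in> \<int>" for i j
    by (simp add: integral_vec_def matrix_vector_mult_basis column_def)
  have "det B \<in> \<int>"
    using B by (auto simp: det_def intro!: Ints_sum Ints_mult Ints_prod)
  then obtain b where b: "det B = of_int b" by (elim Ints_cases)
  have "of_int (det W * b) = (1 :: real)"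
    using WB det_mul[of "real_mat W" B] by (simp add: det_real_mat b det_I)
  then have "det W * b = 1" by linarith
  then show ?thesis by (auto simp: zmult_eq_1_iff)
qed

definition replace_column :: "'a ^ 'k ^ 'k \<Rightarrow> 'k \<Rightarrow> 'a ^ 'k \<Rightarrow> 'a ^ 'k ^ 'k" where
  "replace_column W i w = (\<chi> r c. if c = i then w $ r else W $ r $ c)"

lemma real_mat_replace_column:
  "real_mat (replace_column W i w) = replace_column (real_mat W) i (real_vec w)"
  by (simp add: real_mat_def replace_column_def real_vec_def vec_eq_iff)

lemma det_replace_column:
  assumes "real_vec w = real_mat W *v a"
  shows "of_int (det (replace_column W i w)) = a $ i * of_int (det W)"
proof -
  have "of_int (det (replace_column W i w)) = det (replace_column (real_mat W) i (real_mat W *v a))"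
    by (simp only: assms det_real_mat[symmetric] real_mat_replace_column)
  also have "\<dots> = a $ i * det (real_mat W)"
    unfolding replace_column_def by (rule cramer_lemma)
  finally show ?thesis by (simp add: det_real_mat)
qed

lemma replace_column_mult:
  fixes W :: "real ^ 'k ^ 'k"
  shows "replace_column W i (W *v a) *v b = W *v (b + b $ i *\<^sub>R (a - axis i 1))"
proof -
  have "(\<Sum>c\<in>UNIV. (if c = i then (W *v a) $ r else W $ r $ c) * b $ c) =
      (\<Sum>c\<in>UNIV. W $ r $ c * b $ c + (if c = i then b $ i * ((W *v a) $ r - W $ r $ i) else 0))" for r
    by (intro sum.cong) (auto simp: algebra_simps)
  then have "(replace_column W i (W *v a) *v b) $ r = (W *v b + b $ i *\<^sub>R (W *v a - column i W)) $ r" for r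
    by (simp add: replace_column_def matrix_vector_mult_def[of _ b] sum.distrib column_def)
  then have "replace_column W i (W *v a) *v b = W *v b + b $ i *\<^sub>R (W *v a - column i W)"
    by (simp add: vec_eq_iff)
  also have "\<dots> = W *v (b + b $ i *\<^sub>R (a - axis i 1))"
    by (simp add: matrix_vector_right_distrib matrix_vector_mult_diff_distrib
        matrix_vector_mult_scaleR matrix_vector_mult_basis)
  finally show ?thesis .
qed

text \<open>Replacing a column multiplies \<open>W\<close> on the right by the matrix of the map
  that sends \<open>b\<close> to \<open>b + b_i (a - e_i)\<close>. This map carries classes found
  after the replacement back to classes of \<open>W\<close>.\<close>

lemma glue_group_replace_column:
  assumes "real_vec w = real_mat W *v a"
  shows "b \<in> glue_group (replace_column W i w) \<longleftrightarrow> b + b $ i *\<^sub>R (a - axis i 1) \<in> glue_group W"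
  unfolding glue_group_def mem_Collect_eq real_mat_replace_column assms replace_column_mult ..

section \<open>Orders of glue classes\<close>

definition has_order :: "real ^ 'k \<Rightarrow> int \<Rightarrow> bool" where
  "has_order a q \<longleftrightarrow> q > 0 \<and> integral_vec (of_int q *\<^sub>R a) \<and>
     (\<forall>l. integral_vec (of_int l *\<^sub>R a) \<longrightarrow> q dvd l)"

lemma integral_multiple_gcd:
  assumes "integral_vec (of_int k *\<^sub>R a)" "integral_vec (of_int l *\<^sub>R a)"
  shows "integral_vec (of_int (gcd k l) *\<^sub>R a)"
proof -
  obtain u v where "u * k + v * l = gcd k l" using bezout_int by blast
  then have "of_int (gcd k l) *\<^sub>R a = of_int u *\<^sub>R (of_int k *\<^sub>R a) + of_int v *\<^sub>R (of_int l *\<^sub>R a)"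
    by (simp add: scaleR_add_left[symmetric] flip: of_int_mult of_int_add)
  with integral_vec_combination(1)[OF assms] show ?thesis by (simp only:)
qed

lemma has_orderI_prime_power:
  assumes "prime r" "integral_vec (of_int (r ^ Suc s) *\<^sub>R a)" "\<not> integral_vec (of_int (r ^ s) *\<^sub>R a)"
  shows "has_order a (r ^ Suc s)"
  unfolding has_order_def
proof (intro conjI allI impI)
  have "r > 1" using assms(1) by (simp add: prime_gt_1_int)
  then show "r ^ Suc s > 0" by simp
  fix l assume "integral_vec (of_int l *\<^sub>R a)"
  then have g: "integral_vec (of_int (gcd (r ^ Suc s) l) *\<^sub>R a)"
    using integral_multiple_gcd assms(2) by blast
  have "gcd (r ^ Suc s) l dvd r ^ Suc s" by simp
  then obtain i where i: "i \<le> Suc s" "gcd (r ^ Suc s) l = r ^ i"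
    using divides_primepow[OF assms(1), of "gcd (r ^ Suc s) l" "Suc s"] by auto
  have "i = Suc s"
  proof (rule ccontr)
    assume "i \<noteq> Suc s"
    then have "r ^ s = r ^ (s - i) * r ^ i" using i by (simp add: power_add[symmetric])
    then have "of_int (r ^ s) *\<^sub>R a = of_int (r ^ (s - i)) *\<^sub>R (of_int (gcd (r ^ Suc s) l) *\<^sub>R a)"
      using i by (simp flip: of_int_mult of_int_power)
    then show False using assms(3) g integral_vec_scaleR[OF Ints_of_int] by metis
  qed
  then show "r ^ Suc s dvd l" using i by (metis gcd_dvd2)
qed (fact assms)

lemma has_orderI_prime:
  assumes "prime r" "integral_vec (of_int r *\<^sub>R a)" "\<not> integral_vec a"
  shows "has_order a r"
  using has_orderI_prime_power[of r 0 a] assms by simp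

lemma has_order_add:
  assumes "has_order a q" "has_order b q'" "coprime q q'"
  shows "has_order (a + b) (q * q')"
  unfolding has_order_def
proof (intro conjI allI impI)
  show "q * q' > 0" using assms by (simp add: has_order_def)
  have "of_int (q * q') *\<^sub>R (a + b) = of_int q' *\<^sub>R (of_int q *\<^sub>R a) + of_int q *\<^sub>R (of_int q' *\<^sub>R b)"
    by (simp add: algebra_simps)
  then show "integral_vec (of_int (q * q') *\<^sub>R (a + b))"
    using assms integral_vec_combination(1)[of "of_int q *\<^sub>R a" "of_int q' *\<^sub>R b" q' q]
    by (simp only: has_order_def)
  fix l assume l: "integral_vec (of_int l *\<^sub>R (a + b))"
  have eq: "of_int (q' * l) *\<^sub>R a = of_int q' *\<^sub>R (of_int l *\<^sub>R (a + b)) - of_int l *\<^sub>R (of_int q' *\<^sub>R b)"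
    "of_int (q * l) *\<^sub>R b = of_int q *\<^sub>R (of_int l *\<^sub>R (a + b)) - of_int l *\<^sub>R (of_int q *\<^sub>R a)"
    by (simp_all add: algebra_simps)
  have "integral_vec (of_int (q' * l) *\<^sub>R a)" "integral_vec (of_int (q * l) *\<^sub>R b)"
    unfolding eq using assms l by (auto simp only: has_order_def intro: integral_vec_combination(2))
  then have "q dvd q' * l" "q' dvd q * l" using assms by (auto simp: has_order_def)
  then show "q * q' dvd l"
    using assms(3) by (metis coprime_commute coprime_dvd_mult_right_iff divides_mult)
qed

text \<open>By Cramer's rule the entries of \<open>det W\<close> times \<open>a\<close> are
  determinants of integer matrices, so \<open>det W\<close> annihilates the class; the order is the
  least positive annihilator.\<close>

lemma exists_order:
  assumes "det W \<noteq> 0" "a \<in> glue_group W"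
  shows "\<exists>q. has_order a q \<and> q dvd det W"
proof -
  have int: "integral_vec (of_int (det W) *\<^sub>R a)"
    unfolding integral_vec_def
  proof
    fix i
    obtain w where "real_mat W *v a = real_vec w"
      using assms(2) by (auto simp: glue_group_def elim: integral_vecE)
    then have "(of_int (det W) *\<^sub>R a) $ i = of_int (det (replace_column W i w))"
      by (subst det_replace_column[of w W a]) simp_all
    then show "(of_int (det W) *\<^sub>R a) $ i \<in> \<int>" by simp
  qed
  define q where "q = (LEAST n. n > 0 \<and> integral_vec (of_int (int n) *\<^sub>R a))"
  have "integral_vec (of_int (int (nat \<bar>det W\<bar>)) *\<^sub>R a)"
    using int integral_vec_scaleR[of "-1" "of_int (det W) *\<^sub>R a"] by (cases "det W \<ge> 0") auto
  then have ex: "\<exists>n. n > 0 \<and> integral_vec (of_int (int n) *\<^sub>R a)"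
    using assms(1) by (intro exI[of _ "nat \<bar>det W\<bar>"]) simp
  have q: "q > 0" "integral_vec (of_int (int q) *\<^sub>R a)"
    using LeastI_ex[OF ex] unfolding q_def by auto
  have "int q dvd l" if "integral_vec (of_int l *\<^sub>R a)" for l
  proof -
    have "integral_vec (of_int (gcd l (int q)) *\<^sub>R a)"
      using integral_multiple_gcd[OF that q(2)] .
    then have "q \<le> nat (gcd l (int q))"
      unfolding q_def by (intro Least_le) (use q(1) in \<open>simp add: q_def\<close>)
    then have "int q \<le> int (nat (gcd l (int q)))" by (simp only: of_nat_le_iff)
    also have "\<dots> = gcd l (int q)" by simp
    finally have "gcd l (int q) = int q" using q(1) gcd_le2_int[of "int q" l] by linarith
    then show ?thesis by (metis gcd_dvd1)
  qed
  then show ?thesis using q int by (intro exI[of _ "int q"]) (auto simp: has_order_def)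
qed

text \<open>Multiplying by an inverse of \<open>s\<close> modulo \<open>n\<close> and adding an
  integer turns the coordinate into exactly \<open>1 / n\<close>. Exchanging that column then
  divides the determinant by \<open>n\<close>, as \<open>next_order\<close> requires.\<close>

lemma unit_coordinate:
  assumes "a \<in> glue_group W" "n > 0" "integral_vec (of_int n *\<^sub>R a)" "of_int n * a $ i = of_int s" "coprime s n"
  shows "\<exists>u b. b \<in> glue_group W \<and> b $ i = 1 / of_int n \<and> integral_vec (b - of_int u *\<^sub>R a) \<and> coprime u n"
proof -
  obtain u v where uv: "u * s + v * n = 1"
    using bezout_int[of s n] assms(5) by (metis coprime_imp_gcd_eq_1)
  define b where "b = of_int u *\<^sub>R a + axis i (of_int v)"
  have int: "integral_vec (axis i (of_int v :: real))" by (simp add: integral_vec_def axis_def)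
  have "of_int n * b $ i = of_int u * (of_int n * a $ i) + of_int v * of_int n"
    by (simp add: b_def axis_def algebra_simps)
  also have "\<dots> = of_int (u * s + v * n)" unfolding assms(4) by simp
  finally have "of_int n * b $ i = 1" unfolding uv by simp
  then have "b $ i = 1 / of_int n" using assms(2) by (simp add: field_simps)
  moreover have "b \<in> glue_group W"
    unfolding b_def by (intro glue_group_add glue_group_scaleR glue_group_integral assms int) simp
  moreover have "integral_vec (b - of_int u *\<^sub>R a)" using int by (simp add: b_def)
  moreover have "coprime u n"
    using uv by (metis coprimeI dvd_add dvd_mult dvd_mult2)
  ultimately show ?thesis by blast
qed

lemma unit_coordinate_prime:
  assumes "a \<in> glue_group W" "prime n" "integral_vec (of_int n *\<^sub>R a)" "\<not> integral_vec a"
  shows "\<exists>i u b. b \<in> glue_group W \<and> b $ i = 1 / of_int n \<and> integral_vec (b - of_int u *\<^sub>R a) \<and> coprime u n"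
proof -
  obtain i where i: "a $ i \<notin> \<int>" using assms(4) by (auto simp: integral_vec_def)
  obtain s where s: "of_int n * a $ i = of_int s"
    using assms(3) by (auto simp: integral_vec_def elim: Ints_cases)
  have "\<not> n dvd s"
  proof
    assume "n dvd s"
    then obtain t where "s = n * t" by blast
    then have "a $ i = of_int t" using s assms(2) by auto
    then show False using i by simp
  qed
  then have "coprime s n" using assms(2) by (metis coprime_commute prime_imp_coprime)
  then show ?thesis using unit_coordinate[OF assms(1) _ assms(3) s] assms(2) prime_gt_0_int by blast
qed

text \<open>Replacing a column by \<open>W y\<close> divides the determinant by \<open>n\<close> and the glue group by the
  subgroup generated by \<open>y\<close>.\<close>

lemma next_order:
  assumes "det W \<noteq> 0" "y \<in> glue_group W" "n > 0" "integral_vec (of_int n *\<^sub>R y)" "y $ i = 1 / of_int n"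
    and "\<bar>det W\<bar> \<noteq> n"
  shows "\<exists>r c k. prime r \<and> r * n dvd det W \<and> c \<in> glue_group W \<and>
    integral_vec (of_int r *\<^sub>R c - of_int k *\<^sub>R y) \<and> (\<forall>l. \<not> integral_vec (c - of_int l *\<^sub>R y))"
proof -
  obtain w where w: "real_vec w = real_mat W *v y"
    using assms(2) by (metis glue_group_def integral_vecE mem_Collect_eq)
  define V where "V = replace_column W i w"
  have "of_int (n * det V) = (of_int (det W) :: real)"
    using det_replace_column[OF w, of i] assms(3,5) by (simp add: V_def)
  then have detV: "det W = n * det V" by linarith
  have V0: "det V \<noteq> 0" and "\<bar>det V\<bar> \<noteq> 1"
    using detV assms(1,3,6) by (auto simp: abs_mult)
  then obtain b0 where b0: "b0 \<in> glue_group V" "\<not> integral_vec b0"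
    using glue_group_trivial by blast
  obtain t where t: "has_order b0 t" "t dvd det V" using exists_order[OF V0 b0(1)] by blast
  have "t \<noteq> 1" using t(1) b0(2) by (auto simp: has_order_def)
  then obtain r where r: "prime r" "r dvd t"
    using t(1) prime_divisor_exists[of t] by (auto simp: has_order_def)
  then obtain s where s: "t = r * s" by blast
  \<comment> \<open>The multiple of \<open>b0\<close> of prime order \<open>r\<close>, since the
    order of \<open>b0\<close> is \<open>r * s\<close>.\<close>
  define b where "b = of_int s *\<^sub>R b0"
  have bV: "b \<in> glue_group V" unfolding b_def by (intro glue_group_scaleR b0) simp
  have rb: "integral_vec (of_int r *\<^sub>R b)" using t(1) s by (simp add: b_def has_order_def)
  have b: "\<not> integral_vec b"
  proof
    assume "integral_vec b"
    then have "t dvd s" using t(1) by (simp add: b_def has_order_def)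
    moreover have "s > 0" using s t(1) prime_gt_0_int[OF r(1)] by (simp add: has_order_def zero_less_mult_iff)
    ultimately have "t \<le> s" by (simp add: zdvd_imp_le)
    then show False using s prime_gt_1_int[OF r(1)] \<open>s > 0\<close> by auto
  qed
  have "r * n dvd det W" using detV r(2) t(2) by (metis dvd_trans mult.commute mult_dvd_mono dvd_refl)
  \<comment> \<open>The class of \<open>W\<close> that corresponds to \<open>b\<close>. As
    \<open>r b\<close> is integral, \<open>r c\<close> agrees modulo integers with the multiple of
    \<open>y\<close> by \<open>k = r b_i\<close>.\<close>
  define c where "c = b + b $ i *\<^sub>R (y - axis i 1)"
  have c: "c \<in> glue_group W" using bV glue_group_replace_column[OF w] unfolding V_def c_def by blast
  obtain k where k: "of_int r * b $ i = of_int k"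
    using rb by (auto simp: integral_vec_def elim: Ints_cases)
  have "of_int r *\<^sub>R c - of_int k *\<^sub>R y = of_int r *\<^sub>R b - of_int k *\<^sub>R axis i 1"
    by (simp add: c_def algebra_simps flip: k)
  then have "integral_vec (of_int r *\<^sub>R c - of_int k *\<^sub>R y)"
    using rb by (simp add: integral_vec_diff integral_vec_scaleR integral_vec_axis)
  moreover have "\<not> integral_vec (c - of_int l *\<^sub>R y)" for l
  proof
    assume z: "integral_vec (c - of_int l *\<^sub>R y)"
    have "(c - of_int l *\<^sub>R y) $ i = (b $ i - of_int l) / of_int n"
      using assms(3,5) by (simp add: c_def axis_def field_simps)
    moreover obtain zi where "(c - of_int l *\<^sub>R y) $ i = of_int zi"
      using z by (auto simp: integral_vec_def elim: Ints_cases)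
    ultimately have bi: "b $ i = of_int l + of_int zi * of_int n"
      using assms(3) by (simp add: field_simps)
    \<comment> \<open>Solves the definition of \<open>c\<close> for \<open>b\<close>: each of the
      three pieces is integral if \<open>c\<close> is congruent to a multiple of
      \<open>y\<close>.\<close>
    have "b = (of_int 1 *\<^sub>R (c - of_int l *\<^sub>R y) - of_int zi *\<^sub>R (of_int n *\<^sub>R y))
        + of_int (l + zi * n) *\<^sub>R axis i 1"
      by (simp add: c_def bi algebra_simps)
    moreover have "integral_vec \<dots>"
      by (rule integral_vec_add[OF integral_vec_combination(2)[OF z assms(4)]
            integral_vec_scaleR[OF Ints_of_int integral_vec_axis]])
    ultimately show False using b by simp
  qed
  ultimately show ?thesis using r(1) \<open>r * n dvd det W\<close> c by blast
qed

text \<open>Cauchy's theorem for the quotient, obtained from \<open>next_order\<close> by dividing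
  out the trivial subgroup: \<open>y\<close> is a unit vector and \<open>n = 1\<close>.\<close>

lemma first_order:
  assumes "det W \<noteq> 0" "\<bar>det W\<bar> \<noteq> 1"
  shows "\<exists>r a. prime r \<and> r dvd det W \<and> a \<in> glue_group W \<and> integral_vec (of_int r *\<^sub>R a) \<and> \<not> integral_vec a"
proof -
  fix i :: 'a
  have y: "integral_vec (axis i 1 :: real ^ 'a)" by (rule integral_vec_axis)
  obtain r c k where "prime r" "r * 1 dvd det W" "c \<in> glue_group W"
    "integral_vec (of_int r *\<^sub>R c - of_int k *\<^sub>R axis i 1)" "\<forall>l. \<not> integral_vec (c - of_int l *\<^sub>R axis i 1)"
    using next_order[OF assms(1) glue_group_integral[OF y], of 1 i] y assms(2) by (auto simp: axis_def)
  moreover from this have "integral_vec (of_int r *\<^sub>R c)"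
    using integral_vec_add[of "of_int r *\<^sub>R c - of_int k *\<^sub>R axis i 1" "of_int k *\<^sub>R axis i 1"] y
    by (simp add: integral_vec_scaleR)
  moreover from calculation have "\<not> integral_vec c" by (metis diff_zero of_int_0 scaleR_zero_left)
  ultimately show ?thesis by auto
qed

section \<open>Orders excluded by the enumeration\<close>

lemma sum_list_sort: "sum_list (sort v) = sum_list (v :: int list)"
  by (metis mset_sort sum_mset_sum_list)

lemma length_filter_sort: "length (filter P (sort v)) = length (filter P v)"
  by (metis mset_filter mset_sort size_mset)

lemma glue_class_admissible:
  assumes "glue 8 G d" "glue_class G q v" "q > 1"
  shows "admissible q v"
  using assms unfolding glue_class_def
  by (intro admissible[OF assms(1)]) (auto, metis dvd_0_right mult_zero_right order_refl)

lemma admissible_zeros: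
  assumes "admissible q v" "length v = 8" "\<And>x. x \<in> set v \<Longrightarrow> 0 \<le> x"
  shows "length (filter (\<lambda>x. x = 0) v) \<le> 2"
proof -
  obtain a b c d e f g h where w: "sort v = [a, b, c, d, e, f, g, h]"
    by (rule list_8[of "sort v"]) (simp add: assms(2))
  have sorted: "a \<le> b" "b \<le> c" "c \<le> d" "d \<le> e" "e \<le> f" "f \<le> g" "g \<le> h"
    using sorted_sort[of v] unfolding w by auto
  have "admissible_sorted q [a, b, c, d, e, f, g, h]" using assms(1) by (simp add: admissible_def w)
  then have "c > 0 \<or> b > 0 \<or> a > 0" by (simp add: Let_def split: if_splits)
  then have "0 < c" using sorted(1,2) by auto
  then have "0 < d" "0 < e" "0 < f" "0 < g" "0 < h" using sorted by linarith+
  with \<open>0 < c\<close> show ?thesis unfolding length_filter_sort[symmetric, of _ v] w by simp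
qed

text \<open>Two zeros leave only height 3, with \<open>c + d + e \<ge> 4\<close>. Then
  \<open>e \<ge> 2\<close>, the top three residues add at least 6, and the total 9 is exceeded. The
  general bound of 2 zeros would be too weak for order 3: four classes with two integral coordinates
  each could still cover all eight coordinates.\<close>

lemma admissible_zeros_3:
  assumes "admissible 3 v" "length v = 8" "\<And>x. x \<in> set v \<Longrightarrow> 0 \<le> x"
  shows "length (filter (\<lambda>x. x = 0) v) \<le> 1"
proof -
  obtain a b c d e f g h where w: "sort v = [a, b, c, d, e, f, g, h]"
    by (rule list_8[of "sort v"]) (simp add: assms(2))
  have sorted: "a \<le> b" "b \<le> c" "c \<le> d" "d \<le> e" "e \<le> f" "f \<le> g" "g \<le> h"
    using sorted_sort[of v] unfolding w by auto
  have "0 \<le> a" using assms(3) set_sort[of "\<lambda>x. x" v] unfolding w by auto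
  have "admissible_sorted 3 [a, b, c, d, e, f, g, h]" using assms(1) by (simp add: admissible_def w)
  then consider "a + b + c + d + e + f + g + h = 9" "a + b + c + d + e > 3" | "b > 0" | "a > 0"
    by (simp add: Let_def split: if_splits)
  then have "0 < b"
  proof cases
    case 1
    show ?thesis
    proof (rule ccontr)
      assume "\<not> 0 < b"
      then have "a = 0" "b = 0" using sorted(1) \<open>0 \<le> a\<close> by linarith+
      then have "c + d + e \<ge> 4" using 1(2) by simp
      then have "e \<ge> 2" using sorted by linarith
      then show False using \<open>c + d + e \<ge> 4\<close> 1(1) sorted \<open>a = 0\<close> \<open>b = 0\<close> by linarith
    qed
  qed (use sorted(1) in simp_all)
  then have "0 < c" "0 < d" "0 < e" "0 < f" "0 < g" "0 < h" using sorted by linarith+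
  with \<open>0 < b\<close> show ?thesis unfolding length_filter_sort[symmetric, of _ v] w by simp
qed

lemma not_has_multiple_in_Nil [simp]: "\<not> has_multiple_in [] n q v w"
  by (induction n arbitrary: w) auto

lemma no_order_6_to_10:
  assumes "glue 8 G d" "glue_class G q v"
  shows "q \<notin> {6, 7, 8, 9, 10}"
proof
  assume q: "q \<in> {6, 7, 8, 9, 10}"
  have none: False if "all_classes q (\<lambda>v. excluded (nat q - 1) q v v)"
    using class_canonical[OF assms, of "[]"] that q by auto
  moreover have False if "q = 7"
  proof -
    let ?C = "[[1,1,1,2,3,3,5,5], [1,1,1,2,3,4,4,5], [1,1,2,2,3,3,4,5]] :: int list list"
    obtain j where j: "sort (multiples q v j) \<in> set ?C"
      using class_canonical[OF assms _ classes_7[folded \<open>q = 7\<close>]] \<open>q = 7\<close> by auto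
    obtain G' d' where "glue 8 G' d'" "fracs q (sort (multiples q v j)) \<in> G'"
      using glue_permute_list[where w = "sort (multiples q v j)", OF assms(1) _ glue_class_multiple[OF assms, of j]] assms(2)
      by (auto simp: glue_class_def multiples_def)
    then show False
      using j that is_certificateD[OF _ _ _ _ no_class_7a] is_certificateD[OF _ _ _ _ no_class_7b]
        is_certificateD[OF _ _ _ _ no_class_7c] by auto
  qed
  ultimately show False using q classes_6 classes_8 classes_9 classes_10 by auto
qed

lemma canonical_5:
  assumes "glue 8 G d" "glue_class G 5 v"
  shows "\<exists>j. 1 \<le> j \<and> j < 5 \<and> sort (multiples 5 v j) \<in> {[1,1,2,2,2,4,4,4], [1,2,3,3,4,4,4,4]}"
proof -
  let ?C = "[[1,1,2,2,2,4,4,4], [1,2,3,3,4,4,4,4], [1,1,1,1,2,3,3,3], [1,1,2,2,3,3,4,4]] :: int list list"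
  obtain j where j: "1 \<le> j" "j < 5" "sort (multiples 5 v j) \<in> set ?C"
    using class_canonical[OF assms _ classes_5] by auto
  obtain G' d' where "glue 8 G' d'" "fracs 5 (sort (multiples 5 v j)) \<in> G'"
    using glue_permute_list[where w = "sort (multiples 5 v j)", OF assms(1) _ glue_class_multiple[OF assms, of j]] assms(2)
    by (auto simp: glue_class_def multiples_def)
  then have "sort (multiples 5 v j) \<noteq> [1,1,1,1,2,3,3,3]" "sort (multiples 5 v j) \<noteq> [1,1,2,2,3,3,4,4]"
    using is_certificateD[OF _ _ _ _ no_class_5a] is_certificateD[OF _ _ _ _ no_class_5b] by auto
  then show ?thesis using j by auto
qed

lemma glue_class_unit:
  assumes "glue 8 G d" "glue_class G q v" "coprime J q"
  shows "glue_class G q (multiples q v J)"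
  unfolding glue_class_def
proof (intro conjI allI impI ballI)
  fix j assume j: "1 \<le> j" "j < q"
  then obtain x where x: "x \<in> set v" "\<not> q dvd j * x" using assms(2) by (auto simp: glue_class_def)
  have "\<not> q dvd j * (J * x mod q)"
  proof
    assume "q dvd j * (J * x mod q)"
    then have "q dvd J * (j * x)" by (simp add: dvd_eq_mod_eq_0 mod_mult_right_eq mult.left_commute)
    then show False using x(2) assms(3) by (metis coprime_commute coprime_dvd_mult_right_iff)
  qed
  then show "\<exists>x\<in>set (multiples q v J). \<not> q dvd j * x" using x(1) by (auto simp: multiples_def)
qed (use assms(2) glue_class_multiple[OF assms(1,2)] in \<open>auto simp: glue_class_def multiples_def\<close>)

text \<open>Multiplying a class of order \<open>q * r\<close> by \<open>r\<close> keeps the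
  numerators and lowers the denominator to \<open>q\<close>.\<close>

lemma glue_class_quotient:
  assumes "glue 8 G d" "glue_class G (q * r) v" "q > 0" "r > 0"
  shows "glue_class G q (map (\<lambda>x. x mod q) v)"
proof -
  interpret glue 8 G d by fact
  have v: "length v = 8" "fracs (q * r) v \<in> G" using assms(2) by (auto simp: glue_class_def)
  have "fracs q v = (\<lambda>i. of_int r * fracs (q * r) v i)"
    using assms(4) by (auto simp: fracs_def)
  then have "fracs q v \<in> G" using multiple[OF v(2), of r] by simp
  then have "fracs q (map (\<lambda>x. x mod q) v) \<in> G"
  proof (rule fracs_cong[OF _ assms(3)])
    fix i :: nat assume "i < 8"
    then show "q dvd map (\<lambda>x. x mod q) v ! i - v ! i"
      using v(1) by simp (metis mod_eq_dvd_iff mod_mod_trivial)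
  qed
  moreover have "\<exists>x\<in>set (map (\<lambda>x. x mod q) v). \<not> q dvd j * x" if "1 \<le> j" "j < q" for j
  proof -
    have "1 \<le> j * r" "j * r < q * r" using that assms(4) by auto (smt (verit) mult_le_cancel_left1)
    then obtain x where x: "x \<in> set v" "\<not> q * r dvd j * r * x" using assms(2) by (auto simp: glue_class_def)
    then have "\<not> q dvd j * x" using assms(4) by (auto simp: mult.commute[of q] mult.assoc mult.left_commute[of j])
    then have "\<not> q dvd j * (x mod q)" by (simp add: dvd_eq_mod_eq_0 mod_mult_right_eq)
    then show ?thesis using x(1) by auto
  qed
  ultimately show ?thesis using v(1) assms(3) by (auto simp: glue_class_def)
qed

lemma all_liftsD:
  "all_lifts (map lift_15 cs) b s acc P \<Longrightarrow> map (\<lambda>x. x mod 5) xs = cs \<Longrightarrow> set cs \<subseteq> {1, 2, 3, 4} \<Longrightarrow>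
    \<forall>x\<in>set xs. 0 \<le> x \<and> x < 15 \<Longrightarrow>
    length (filter (\<lambda>x. 3 dvd x) xs) \<le> (if b then 0 else 1) \<Longrightarrow>
    s + sum_list xs \<in> {45, 60, 75} \<Longrightarrow> P (rev xs @ acc)"
proof (induction xs arbitrary: cs b s acc)
  case Nil
  then show ?case by auto
next
  case (Cons x xs)
  then obtain c cs' where cs: "cs = c # cs'" "x mod 5 = c" "map (\<lambda>x. x mod 5) xs = cs'"
    "c \<in> {1, 2, 3, 4}" "set cs' \<subseteq> {1, 2, 3, 4}" by auto
  have x: "0 \<le> x" "x < 15" "\<forall>x\<in>set xs. 0 \<le> x \<and> x < 15" using Cons.prems by auto
  obtain u y z where l: "lift_15 c = (u, y, z)" by (metis prod_cases3)
  have "x \<in> {u, y, z} \<and> (3 dvd x \<longrightarrow> x = u)"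
  proof -
    have "x \<in> set [0..14]" using x by (simp only: set_upto atLeastAtMost_iff) simp
    also have "[0..14] = [0, 1, 2, 3, 4, 5, 6, 7, 8, 9, 10, 11, 12, 13, 14 :: int]" by code_simp
    finally show ?thesis using cs(2,4) l by (auto simp: lift_15_def)
  qed
  then consider "3 dvd x" "x = u" | "\<not> 3 dvd x" "x = y \<or> x = z \<or> x = u" by blast
  then show ?case
  proof cases
    case 1
    then have "\<not> b" "length (filter (\<lambda>x. 3 dvd x) xs) \<le> 0"
      using Cons.prems(5) by (auto split: if_splits)
    moreover have "all_lifts (map lift_15 cs') True (s + x) (x # acc) P"
      using Cons.prems(1) \<open>\<not> b\<close> 1 by (simp add: cs(1) l)
    ultimately show ?thesis
      using Cons.IH[OF _ cs(3,5) x(3), of True "s + x" "x # acc"] Cons.prems(6) by (simp add: add.assoc)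
  next
    case 2
    have "x \<noteq> u"
    proof
      assume "x = u"
      then have "3 dvd x" using l cs(4) by (auto simp: lift_15_def)
      then show False using 2 by simp
    qed
    then have "all_lifts (map lift_15 cs') b (s + x) (x # acc) P"
      using Cons.prems(1) 2 by (auto simp: cs(1) l)
    then show ?thesis
      using Cons.IH[OF _ cs(3,5) x(3), of b "s + x" "x # acc"] Cons.prems(5,6) 2 by (simp add: add.assoc)
  qed
qed

declare all_sorted.simps [simp del] all_lifts.simps [simp del] excluded.simps [simp del]

lemma no_order_15:
  assumes "glue 8 G d" "glue_class G 15 v"
  shows False
proof -
  define u where "u = map (\<lambda>x. x mod 5) v"
  have "glue_class G 5 u" using glue_class_quotient[OF assms(1), of 5 3 v] assms(2) by (simp add: u_def)
  then obtain j where j: "1 \<le> j" "j < 5" "sort (multiples 5 u j) \<in> {[1,1,2,2,2,4,4,4], [1,2,3,3,4,4,4,4]}"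
    using canonical_5[OF assms(1)] by blast
  \<comment> \<open>A unit modulo 15 that is congruent to \<open>j\<close> modulo 5; 3 itself is not
    coprime to 15, but 8 is.\<close>
  define J where "J = (if j = 3 then 8 else j)"
  have cop: "coprime (1 :: int) 15" "coprime (2 :: int) 15" "coprime (8 :: int) 15" "coprime (4 :: int) 15"
    by code_simp+
  have "j \<in> set [1..4]" using j by (simp only: set_upto atLeastAtMost_iff) simp
  also have "[1..4] = [1, 2, 3, 4 :: int]" by code_simp
  finally have J: "coprime J 15" "J mod 5 = j"
    using cop unfolding J_def by auto
  define w where "w = multiples 15 v J"
  define c where "c = sort (multiples 5 u j)"
  have w: "glue_class G 15 w" unfolding w_def by (rule glue_class_unit[OF assms J(1)])
  have wu: "map (\<lambda>x. x mod 5) w = multiples 5 u j"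
    by (auto simp: w_def u_def multiples_def mod_mod_cancel simp flip: J(2)) (simp add: mod_mult_eq)
  then have "mset c = mset (map (\<lambda>x. x mod 5) w)" by (simp add: c_def)
  then obtain p where p: "p permutes {..<length (map (\<lambda>x. x mod 5) w)}"
    "permute_list p (map (\<lambda>x. x mod 5) w) = c"
    by (rule mset_eq_permutation)
  define w' where "w' = permute_list p w"
  have w'c: "map (\<lambda>x. x mod 5) w' = c" using p by (simp add: w'_def permute_list_map)
  have "mset w' = mset w" using p(1) by (simp add: w'_def)
  then obtain G' d' where g: "glue 8 G' d'" "glue_class G' 15 w'"
    using glue_class_permute[OF assms(1) w] by blast
  let ?P = "\<lambda>v. excluded (nat 15 - 1) 15 v v"
  \<comment> \<open>Reduced modulo 3 the list is a class of order 3, which has at most one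
    zero.\<close>
  have "length (filter (\<lambda>x. 3 dvd x) w') \<le> 1"
  proof -
    have g3: "glue_class G' 3 (map (\<lambda>x. x mod 3) w')"
      using glue_class_quotient[OF g(1), of 3 5 w'] g(2) by simp
    have "length (filter (\<lambda>x. x = 0) (map (\<lambda>x. x mod 3) w')) \<le> 1"
      using g3 by (intro admissible_zeros_3 glue_class_admissible[OF g(1) g3]) (auto simp: glue_class_def)
    then show ?thesis by (simp add: filter_map o_def dvd_eq_mod_eq_0)
  qed
  moreover have "c \<in> {[1,1,2,2,2,4,4,4], [1,2,3,3,4,4,4,4]}" using j(3) by (simp add: c_def)
  then have "all_lifts (map lift_15 c) False 0 [] ?P" "set c \<subseteq> {1, 2, 3, 4}"
    using lifts_15 by auto
  moreover have "\<forall>x\<in>set w'. 0 \<le> x \<and> x < 15" using g(2) by (auto simp: glue_class_def)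
  moreover have "sum_list w' \<in> {45, 60, 75}" using class_heights[OF g] by simp
  ultimately have "?P (rev w' @ [])"
    using w'c by (intro all_liftsD[where P = ?P and s = 0 and b = False]) auto
  then have P: "excluded (nat 15 - 1) 15 (rev w') (rev w')" by simp
  obtain G2 d2 where g2: "glue 8 G2 d2" "glue_class G2 15 (rev w')"
    using glue_class_permute[OF g, of "rev w'"] by auto
  show False using excludedD[OF g2, of "nat 15 - 1" 1] P multiples_1[OF g2(2)] by simp
qed

text \<open>The classes that can occur at a flip: all residues but \<open>h - 1\<close> are small, where \<open>h\<close> is
  the height.\<close>

lemma flip_class:
  assumes "glue 8 G d" "glue_class G q v" "q > 1" "m \<ge> 1"
    and "int (length (filter (\<lambda>x. m * x > 5) v)) * q + q \<le> sum_list v"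
  shows "m * q < 25 \<and> q < 11"
proof -
  obtain a b c d e f g h where w: "sort v = [a, b, c, d, e, f, g, h]"
    using assms(2) by (rule_tac list_8[of "sort v"]) (auto simp: glue_class_def)
  have sorted: "a \<le> b" "b \<le> c" "c \<le> d" "d \<le> e" "e \<le> f" "f \<le> g" "g \<le> h"
    using sorted_sort[of v] unfolding w by auto
  have rng: "0 \<le> x \<and> x < q" if "x \<in> {a,b,c,d,e,f,g,h}" for x
    using assms(2) set_sort[of "\<lambda>x. x" v] that unfolding w glue_class_def by auto
  have rs: "0 \<le> a" "0 \<le> b" "0 \<le> c" "0 \<le> d" "0 \<le> e" "0 \<le> f" "0 \<le> g" "0 \<le> h"
    "a < q" "b < q" "c < q" "d < q" "e < q" "f < q" "g < q" "h < q"
    using rng by simp_all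
  have mono: "m * x \<le> m * y" if "x \<le> y" for x y using that assms(4) by simp
  define n where "n = int (length (filter (\<lambda>x. m * x > 5) (sort v)))"
  have n: "n * q + q \<le> sum_list (sort v)"
    using assms(5) by (simp add: n_def length_filter_sort sum_list_sort)
  have sum: "sum_list (sort v) \<in> {3 * q, 4 * q, 5 * q}"
    using class_heights[OF assms(1-3)] by (simp add: sum_list_sort)
  have adm: "admissible_sorted q [a, b, c, d, e, f, g, h]"
    using glue_class_admissible[OF assms(1-3)] by (simp add: admissible_def w)
  have ms: "m * a \<le> m * b" "m * b \<le> m * c" "m * c \<le> m * d" "m * d \<le> m * e" "m * e \<le> m * f"
    "m * f \<le> m * g" "m * g \<le> m * h" using sorted mono by auto
  \<comment> \<open>The list is sorted, so at most two residues with \<open>m * x > 5\<close> means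
    that they are among the last two entries; likewise for three and four.\<close>
  have small: "m * f \<le> 5" if "n \<le> 2" using that ms unfolding n_def w by (simp split: if_splits)
  have small': "m * e \<le> 5" if "n \<le> 3" using that ms unfolding n_def w by (simp split: if_splits)
  have small'': "m * d \<le> 5" if "n \<le> 4" using that ms unfolding n_def w by (simp split: if_splits)
  have le5: "x \<le> 5" if "m * x \<le> 5" "0 \<le> x" for x
    using that mult_right_mono[OF assms(4) that(2)] by simp
  have last: False if "11 \<le> q" "q < 25"
    and e: "all_sorted cs 0 s [] (\<lambda>v. excluded (nat q - 1) q v v)"
      "list_all2 (\<le>) (sort v) cs" "sum_list (sort v) = s" for cs s
  proof -
    let ?P = "\<lambda>v. excluded (nat q - 1) q v v"
    have lo: "\<forall>x\<in>set (sort v). 0 \<le> x" using rs unfolding w by simp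
    have "?P (rev (sort v) @ [])"
      by (rule all_sortedD[where P = ?P, OF e(1) _ lo e(2,3)]) simp
    moreover obtain G' d' where g: "glue 8 G' d'" "glue_class G' q (rev (sort v))"
      using glue_class_permute[OF assms(1,2), of "rev (sort v)"] by auto
    ultimately show False
      using excludedD[OF g, of "nat q - 1" 1] multiples_1[OF g(2)] that by simp
  qed
  have flips: "all_flip_classes q (\<lambda>v. excluded (nat q - 1) q v v)" if "11 \<le> q" "q < 25"
  proof -
    have "q \<in> set [11..24]" using that by (simp only: set_upto atLeastAtMost_iff) simp
    also have "[11..24] = [11, 12, 13, 14, 15, 16, 17, 18, 19, 20, 21, 22, 23, 24 :: int]" by code_simp
    finally show ?thesis
      using flip_classes_11 flip_classes_12 flip_classes_13 flip_classes_14 flip_classes_15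
        flip_classes_16 flip_classes_17 flip_classes_18 flip_classes_19 flip_classes_20
        flip_classes_21 flip_classes_22 flip_classes_23 flip_classes_24
      by auto
  qed
  consider "sum_list (sort v) = 3 * q" | "sum_list (sort v) = 4 * q" | "sum_list (sort v) = 5 * q"
    using sum by auto
  then show ?thesis
  proof cases
    case 1
    then have "n * q \<le> 2 * q" using n by simp
    then have f: "m * f \<le> 5" using small assms(3) by simp
    have "q < a + b + c + d + e" using adm 1 by (auto simp: w Let_def)
    then have "m * q < m * (a + b + c + d + e)" using assms(4) by simp
    \<comment> \<open>Five residues, each with \<open>m * x \<le> 5\<close>, have a sum exceeding
      \<open>q\<close>. At heights 4 and 5 only four or three residues are involved, and the same
      bound holds.\<close>
    then have 25: "m * q < 25" using f ms by (simp add: distrib_left)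
    moreover have "q < 11"
    proof (rule ccontr)
      assume "\<not> q < 11"
      moreover have "q \<le> m * q" using mult_right_mono[of 1 m q] assms(3,4) by simp
      ultimately have q: "11 \<le> q" "q < 25" using 25 by linarith+
      note fl = flips[OF q, unfolded all_flip_classes_def Let_def]
      have "f \<le> 5" using le5[OF f] rs by simp
      then show False
        by (intro last[OF q conjunct1[OF fl]]) (use rs sorted 1 in \<open>simp_all add: w\<close>)
    qed
    ultimately show ?thesis by simp
  next
    case 2
    then have "n * q \<le> 3 * q" using n by simp
    then have e: "m * e \<le> 5" using small' assms(3) by simp
    have "q < a + b + c + d" using adm 2 assms(3) by (auto simp: w Let_def)
    then have "m * q < m * (a + b + c + d)" using assms(4) by simp
    then have 25: "m * q < 25" using e ms by (simp add: distrib_left)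
    moreover have "q < 11"
    proof (rule ccontr)
      assume "\<not> q < 11"
      moreover have "q \<le> m * q" using mult_right_mono[of 1 m q] assms(3,4) by simp
      ultimately have q: "11 \<le> q" "q < 25" using 25 by linarith+
      note fl = flips[OF q, unfolded all_flip_classes_def Let_def]
      have "e \<le> 5" using le5[OF e] rs by simp
      then show False
        by (intro last[OF q conjunct1[OF conjunct2[OF fl]]]) (use rs sorted 2 in \<open>simp_all add: w\<close>)
    qed
    ultimately show ?thesis by simp
  next
    case 3
    then have "n * q \<le> 4 * q" using n by simp
    then have d: "m * d \<le> 5" using small'' assms(3) by simp
    have "q < a + b + c" using adm 3 assms(3) by (auto simp: w Let_def)
    then have "m * q < m * (a + b + c)" using assms(4) by simp
    then have 25: "m * q < 25" using d ms by (simp add: distrib_left)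
    moreover have "q < 11"
    proof (rule ccontr)
      assume "\<not> q < 11"
      moreover have "q \<le> m * q" using mult_right_mono[of 1 m q] assms(3,4) by simp
      ultimately have q: "11 \<le> q" "q < 25" using 25 by linarith+
      note fl = flips[OF q, unfolded all_flip_classes_def Let_def]
      have "d \<le> 5" using le5[OF d] rs by simp
      then show False
        by (intro last[OF q conjunct2[OF conjunct2[OF fl]]]) (use rs sorted 3 in \<open>simp_all add: w\<close>)
    qed
    ultimately show ?thesis by simp
  qed
qed


section \<open>Excluded indices\<close>

text \<open>The labelling \<open>e\<close> numbers the vertices by 0 to 7, so that the results on
  lists of eight residues apply to vectors over another index type. The distances are hidden behind
  an existential quantifier, which leaves a property of \<open>W\<close> alone.\<close>

definition index_class :: "(nat \<Rightarrow> 'k) \<Rightarrow> int ^ 'k::finite ^ 'k \<Rightarrow> bool" where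
  "index_class e W \<longleftrightarrow> bij_betw e {..<8} UNIV \<and>
     (\<exists>d. glue 8 {a. \<exists>b\<in>glue_group W. \<forall>i<8. a i = b $ e i} d)"

text \<open>For \<open>a\<close> of order \<open>q\<close> the vector \<open>q a\<close> is
  integral, so the floor is exact and the list consists of the numerators modulo
  \<open>q\<close>.\<close>

definition residues :: "(nat \<Rightarrow> 'k) \<Rightarrow> int \<Rightarrow> real ^ 'k \<Rightarrow> int list" where
  "residues e q a = map (\<lambda>i. \<lfloor>of_int q * a $ e i\<rfloor> mod q) [0..<8]"

lemma glue_class_residues:
  assumes "index_class e W" "a \<in> glue_group W" "has_order a q"
  shows "glue_class {a. \<exists>b\<in>glue_group W. \<forall>i<8. a i = b $ e i} q (residues e q a)"
proof -
  let ?G = "{a. \<exists>b\<in>glue_group W. \<forall>i<8. a i = b $ e i}"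
  obtain d where "glue 8 ?G d" using assms(1) by (auto simp: index_class_def)
  then interpret glue 8 ?G d .
  have q: "q > 0" using assms(3) by (simp add: has_order_def)
  have qa: "of_int q * a $ k = of_int \<lfloor>of_int q * a $ k\<rfloor>" for k
    using assms(3) by (auto simp: has_order_def integral_vec_def elim: Ints_cases)
  have "(\<lambda>i. a $ e i) \<in> ?G" using assms(2) by auto
  then have "fracs q (residues e q a) \<in> ?G"
  proof (rule shift)
    fix i :: nat assume "i < 8"
    define z where "z = \<lfloor>of_int q * a $ e i\<rfloor>"
    have "a $ e i = of_int z / of_int q" using qa[of "e i"] q by (simp add: z_def field_simps)
    then have "fracs q (residues e q a) i - a $ e i = of_int (z mod q - z) / of_int q"
      using \<open>i < 8\<close> by (simp add: fracs_def residues_def z_def diff_divide_distrib)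
    also have "z mod q - z = - (z div q) * q" by (simp add: minus_div_mult_eq_mod[symmetric])
    finally show "fracs q (residues e q a) i - a $ e i \<in> \<int>" using q by simp
  qed
  moreover have "\<exists>x\<in>set (residues e q a). \<not> q dvd j * x" if "1 \<le> j" "j < q" for j
  proof (rule ccontr)
    assume "\<not> ?thesis"
    then have "q dvd j * (\<lfloor>of_int q * a $ e i\<rfloor> mod q)" if "i < 8" for i
      using that by (auto simp: residues_def)
    then have *: "q dvd j * \<lfloor>of_int q * a $ e i\<rfloor>" if "i < 8" for i
      using that by (simp add: dvd_eq_mod_eq_0 mod_mult_right_eq)
    have "integral_vec (of_int j *\<^sub>R a)"
      unfolding integral_vec_def
    proof
      fix k
      have "e ` {..<8} = UNIV" using assms(1) by (simp add: index_class_def bij_betw_def)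
      then have "k \<in> e ` {..<8}" by simp
      then obtain i where i: "i < 8" "e i = k" by auto
      then obtain l where "j * \<lfloor>of_int q * a $ k\<rfloor> = q * l" using * by blast
      then have "of_int j * (of_int q * a $ k) = of_int q * of_int l"
        by (subst qa) (simp flip: of_int_mult)
      then have "of_int j * a $ k = of_int l" using q by simp
      then show "(of_int j *\<^sub>R a) $ k \<in> \<int>" by simp
    qed
    then have "q dvd j" using assms(3) by (simp add: has_order_def)
    then show False using that zdvd_imp_le[of q j] by auto
  qed
  ultimately show ?thesis using q by (auto simp: glue_class_def residues_def)
qed

lemma integral_residue: 
  assumes "has_order a q"
  shows "a $ k \<in> \<int> \<longleftrightarrow> \<lfloor>of_int q * a $ k\<rfloor> mod q = 0"
proof -
  have q: "q > 0" using assms(1) by (simp add: has_order_def)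
  have qa: "of_int q * a $ k = of_int \<lfloor>of_int q * a $ k\<rfloor>"
    using assms(1) by (auto simp: has_order_def integral_vec_def elim: Ints_cases)
  show ?thesis
  proof
    assume "a $ k \<in> \<int>"
    then obtain z where "a $ k = of_int z" by (elim Ints_cases)
    then have "\<lfloor>of_int q * a $ k\<rfloor> = q * z" by (simp flip: of_int_mult)
    then show "\<lfloor>of_int q * a $ k\<rfloor> mod q = 0" by simp
  next
    assume "\<lfloor>of_int q * a $ k\<rfloor> mod q = 0"
    then obtain z where "\<lfloor>of_int q * a $ k\<rfloor> = q * z" by (auto simp: mod_eq_0_iff_dvd)
    then have "a $ k = of_int z" using qa q by simp
    then show "a $ k \<in> \<int>" by simp
  qed
qed

lemma integral_coordinates:
  assumes "index_class e W" "a \<in> glue_group W" "has_order a q" "q > 1"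
  shows "card {i. i < 8 \<and> a $ e i \<in> \<int>} \<le> (if q = 3 then 1 else 2)"
proof -
  obtain d where g: "glue 8 {a. \<exists>b\<in>glue_group W. \<forall>i<8. a i = b $ e i} d"
    using assms(1) by (auto simp: index_class_def)
  note c = glue_class_residues[OF assms(1-3)]
  note adm = glue_class_admissible[OF g c assms(4)]
  have "{i. i < 8 \<and> a $ e i \<in> \<int>} = {i. i < length (residues e q a) \<and> residues e q a ! i = 0}"
    by (auto simp: residues_def integral_residue[OF assms(3)])
  then have "card {i. i < 8 \<and> a $ e i \<in> \<int>} = length (filter (\<lambda>x. x = 0) (residues e q a))"
    by (simp add: length_filter_conv_card)
  then show ?thesis
    using admissible_zeros[OF adm] admissible_zeros_3[of "residues e q a"] adm c
    by (auto simp: glue_class_def)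
qed

text \<open>Every coordinate is integral for one of the \<open>r + 1\<close> classes \<open>a\<close>, \<open>c - l a\<close>.\<close>

lemma not_elementary:
  assumes "index_class e W" "a \<in> glue_group W" "c \<in> glue_group W" "r = 2 \<or> r = 3"
    "integral_vec (of_int r *\<^sub>R a)" "integral_vec (of_int r *\<^sub>R c)" "\<not> integral_vec a"
    "\<forall>l. \<not> integral_vec (c - of_int l *\<^sub>R a)"
  shows False
proof -
  define Z where "Z b = {i. i < (8 :: nat) \<and> b $ e i \<in> \<int>}" for b :: "real ^ 'a"
  have r: "prime r" using assms(4) by auto
  have ord: "has_order a r" "has_order (c - of_int l *\<^sub>R a) r" for l
  proof -
    have "of_int r *\<^sub>R (c - of_int l *\<^sub>R a) = of_int 1 *\<^sub>R (of_int r *\<^sub>R c) - of_int l *\<^sub>R (of_int r *\<^sub>R a)"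
      by (simp add: algebra_simps)
    then have "integral_vec (of_int r *\<^sub>R (c - of_int l *\<^sub>R a))"
      using integral_vec_combination(2)[OF assms(6,5)] by (simp only:)
    then show "has_order (c - of_int l *\<^sub>R a) r" using assms(8) r by (intro has_orderI_prime) auto
  qed (use assms r in \<open>auto intro: has_orderI_prime\<close>)
  have cG: "c - of_int l *\<^sub>R a \<in> glue_group W" for l
    using assms by (intro glue_group_diff glue_group_scaleR) auto
  have card: "card (Z b) \<le> (if r = 3 then 1 else 2)" if "has_order b r" "b \<in> glue_group W" for b
    using integral_coordinates[OF assms(1) that(2,1)] assms(4) unfolding Z_def by auto
  have cover: "{..<8} \<subseteq> Z a \<union> (\<Union>l\<in>{0..<r}. Z (c - of_int l *\<^sub>R a))"
  proof
    fix i :: nat assume "i \<in> {..<8}"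
    then have i: "i < 8" by simp
    obtain x y where x: "of_int r * a $ e i = of_int x" and y: "of_int r * c $ e i = of_int y"
      using assms(5,6) by (auto simp: integral_vec_def elim!: Ints_cases)
        (metis Ints_cases)
    show "i \<in> Z a \<union> (\<Union>l\<in>{0..<r}. Z (c - of_int l *\<^sub>R a))"
    proof (cases "r dvd x")
      case True
      then obtain z where "x = r * z" by blast
      then have "a $ e i = of_int z" using x assms(4) by auto
      then show ?thesis using i by (simp add: Z_def)
    next
      case False
      then have "coprime x r" using r by (metis coprime_commute prime_imp_coprime)
      then obtain u where u: "[x * u = 1] (mod r)" using cong_solve_coprime_int by blast
      define l where "l = (u * y) mod r"
      have "[x * l = y] (mod r)"
      proof -
        have "[x * l = x * (u * y)] (mod r)" unfolding l_def by (intro cong_mult) (auto simp: cong_def)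
        also have "[x * (u * y) = (x * u) * y] (mod r)" by (simp add: mult.assoc)
        also have "[(x * u) * y = 1 * y] (mod r)" using u by (intro cong_mult) auto
        finally show ?thesis by simp
      qed
      then have "r dvd y - l * x" by (metis cong_iff_dvd_diff cong_sym mult.commute)
      then obtain z where "y - l * x = r * z" by blast
      then have "of_int r * (c $ e i - of_int l * a $ e i) = of_int r * (of_int z :: real)"
        using x y by (simp add: right_diff_distrib mult.left_commute flip: of_int_mult of_int_diff)
      then have "c $ e i - of_int l * a $ e i = of_int z" using assms(4) by auto
      moreover have "l \<in> {0..<r}" using assms(4) by (auto simp: l_def)
      moreover from calculation have "i \<in> Z (c - of_int l *\<^sub>R a)" using i by (simp add: Z_def)
      ultimately show ?thesis by blast
    qed
  qed
  \<comment> \<open>Three classes with at most two integral coordinates each, or four with at most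
    one each, cannot cover eight coordinates.\<close>
  have "8 = card {..<8 :: nat}" by simp
  also have "\<dots> \<le> card (Z a \<union> (\<Union>l\<in>{0..<r}. Z (c - of_int l *\<^sub>R a)))"
    by (intro card_mono cover) (simp add: Z_def)
  also have "\<dots> \<le> card (Z a) + card (\<Union>l\<in>{0..<r}. Z (c - of_int l *\<^sub>R a))" by (rule card_Un_le)
  also have "card (\<Union>l\<in>{0..<r}. Z (c - of_int l *\<^sub>R a)) \<le> (\<Sum>l\<in>{0..<r}. card (Z (c - of_int l *\<^sub>R a)))"
    by (rule card_UN_le) simp
  also have "\<dots> \<le> (\<Sum>l\<in>{0..<r}. (if r = 3 then 1 else 2))"
    by (intro sum_mono card ord cG)
  also have "card (Z a) \<le> (if r = 3 then 1 else 2)" using card ord assms(2) by blast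
  finally show False using assms(4) by auto
qed

lemma excluded_orders:
  assumes "index_class e W" "a \<in> glue_group W" "has_order a q"
  shows "q \<notin> {6, 7, 8, 9, 10, 15}"
proof -
  obtain d where g: "glue 8 {a. \<exists>b\<in>glue_group W. \<forall>i<8. a i = b $ e i} d"
    using assms(1) by (auto simp: index_class_def)
  note c = glue_class_residues[OF assms]
  show ?thesis using no_order_6_to_10[OF g c] no_order_15[OF g] c by auto
qed

lemma solve_linear_cong:
  assumes "coprime r n"
  shows "\<exists>j :: int. n dvd k - r * j"
proof -
  obtain u where "[r * u = 1] (mod n)" using cong_solve_coprime_int[OF assms] by blast
  then have "[k * (r * u) = k * 1] (mod n)" by (intro cong_mult) auto
  then have "n dvd k - r * (u * k)" by (metis cong_iff_dvd_diff cong_sym mult.left_commute mult.commute mult.right_neutral)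
  then show ?thesis by blast
qed

text \<open>As \<open>r\<close> is invertible modulo \<open>n\<close>, some \<open>j\<close>
  satisfies \<open>r j = k\<close> modulo \<open>n\<close>; subtracting \<open>j b\<close> splits
  off the part of \<open>c\<close> in the group generated by \<open>b\<close>.\<close>

lemma coprime_complement:
  assumes "integral_vec (of_int r *\<^sub>R c - of_int k *\<^sub>R b)" "integral_vec (of_int n *\<^sub>R b)" "coprime r n"
  shows "\<exists>j. integral_vec (of_int r *\<^sub>R (c - of_int j *\<^sub>R b))"
proof -
  obtain j z where j: "k - r * j = n * z" using solve_linear_cong[OF assms(3), of k] by blast
  have "of_int r *\<^sub>R (c - of_int j *\<^sub>R b) = of_int 1 *\<^sub>R (of_int r *\<^sub>R c - of_int k *\<^sub>R b) + of_int (k - r * j) *\<^sub>R b"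
    by (simp add: algebra_simps)
  also have "of_int (k - r * j) *\<^sub>R b = of_int z *\<^sub>R (of_int n *\<^sub>R b)"
    unfolding j by simp
  finally show ?thesis
    by (intro exI[of _ j]) (simp only: integral_vec_combination(1)[OF assms(1,2), of 1 z])
qed

lemma order_unit:
  assumes "n > 0" "integral_vec (of_int n *\<^sub>R b)" "b $ i = 1 / of_int n"
  shows "has_order b n"
  unfolding has_order_def
proof (intro conjI allI impI assms)
  fix l assume "integral_vec (of_int l *\<^sub>R b)"
  then obtain z where "of_int l / of_int n = (of_int z :: real)"
    using assms(3) by (auto simp: integral_vec_def elim!: allE[of _ i] Ints_cases)
  then have "(of_int l :: real) = of_int (z * n)" using assms(1) by (simp add: field_simps)
  then have "l = z * n" by linarith
  then show "n dvd l" by simp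
qed

text \<open>A second prime \<open>r'\<close> is found modulo the first class. If it differs from
  \<open>r\<close>, the complement of \<open>b\<close> and \<open>b\<close> itself add up to a class
  of order \<open>r' * r\<close>. If it equals \<open>r\<close>, then \<open>r dvd k\<close> would
  give two independent classes of order \<open>r\<close>; otherwise \<open>c\<close> has order
  \<open>r * r\<close>. The last hypothesis confines the second case to the primes 2 and 3, where
  independent classes are impossible.\<close>

lemma second_order:
  assumes "index_class e W" "det W \<noteq> 0" "a \<in> glue_group W" "prime r" "integral_vec (of_int r *\<^sub>R a)"
    "\<not> integral_vec a" "\<bar>det W\<bar> \<noteq> r" "r = 2 \<or> r = 3 \<or> \<not> r * r dvd det W"
  shows "\<exists>r' c. prime r' \<and> r' * r dvd det W \<and> c \<in> glue_group W \<and> has_order c (r' * r)"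
proof -
  have r0: "r > 0" using assms(4) prime_gt_0_int by blast
  obtain i u b where b: "b \<in> glue_group W" "b $ i = 1 / of_int r" "integral_vec (b - of_int u *\<^sub>R a)"
    using unit_coordinate_prime[OF assms(3-6)] by blast
  have "of_int r *\<^sub>R b = of_int r *\<^sub>R (b - of_int u *\<^sub>R a) + of_int u *\<^sub>R (of_int r *\<^sub>R a)"
    by (simp add: algebra_simps)
  then have rb: "integral_vec (of_int r *\<^sub>R b)"
    using integral_vec_combination(1)[OF b(3) assms(5)] by (simp only:)
  note ob = order_unit[OF r0 rb b(2)]
  have nb: "\<not> integral_vec b" using ob assms(4) by (auto simp: has_order_def dest!: spec[of _ 1])
  obtain r' c k where c: "prime r'" "r' * r dvd det W" "c \<in> glue_group W"
    "integral_vec (of_int r' *\<^sub>R c - of_int k *\<^sub>R b)" "\<forall>l. \<not> integral_vec (c - of_int l *\<^sub>R b)"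
    using next_order[OF assms(2) b(1) r0 rb b(2) assms(7)] by blast
  show ?thesis
  proof (cases "r' = r")
    case False
    then have cop: "coprime r' r" using c(1) assms(4) by (simp add: primes_coprime)
    then obtain j where "integral_vec (of_int r' *\<^sub>R (c - of_int j *\<^sub>R b))"
      using coprime_complement[OF c(4) rb] by blast
    then have "has_order (c - of_int j *\<^sub>R b) r'" using c(1,5) by (intro has_orderI_prime) auto
    then have "has_order (c - of_int j *\<^sub>R b + b) (r' * r)" using has_order_add ob cop by blast
    moreover have "c - of_int j *\<^sub>R b + b \<in> glue_group W"
      using b(1) c(3) by (intro glue_group_add glue_group_diff glue_group_scaleR) auto
    ultimately show ?thesis using c(1,2) by blast
  next
    case True
    have "\<not> r dvd k"
    proof
      assume "r dvd k"
      then obtain z where z: "k = r * z" by blast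
      have "of_int r *\<^sub>R c = of_int 1 *\<^sub>R (of_int r' *\<^sub>R c - of_int k *\<^sub>R b) + of_int z *\<^sub>R (of_int r *\<^sub>R b)"
        by (simp add: z True algebra_simps)
      then have rc: "integral_vec (of_int r *\<^sub>R c)"
        using integral_vec_combination(1)[OF c(4) rb] by (simp only:)
      have "r = 2 \<or> r = 3" using assms(8) c(2) True by auto
      then show False using not_elementary[OF assms(1) b(1) c(3) _ rb rc nb c(5)] by blast
    qed
    have "\<not> integral_vec (of_int (r ^ 1) *\<^sub>R c)"
    proof
      assume "integral_vec (of_int (r ^ 1) *\<^sub>R c)"
      then have rc: "integral_vec (of_int r *\<^sub>R c)" by simp
      have "integral_vec (of_int 1 *\<^sub>R (of_int r *\<^sub>R c) - of_int 1 *\<^sub>R (of_int r' *\<^sub>R c - of_int k *\<^sub>R b))"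
        by (rule integral_vec_combination(2)[OF rc c(4)])
      then have "integral_vec (of_int k *\<^sub>R b)" by (simp add: True)
      then show False using ob \<open>\<not> r dvd k\<close> by (simp add: has_order_def)
    qed
    moreover have "of_int (r ^ Suc 1) *\<^sub>R c = of_int r *\<^sub>R (of_int r' *\<^sub>R c - of_int k *\<^sub>R b) + of_int k *\<^sub>R (of_int r *\<^sub>R b)"
      by (simp add: True algebra_simps power2_eq_square)
    then have "integral_vec (of_int (r ^ Suc 1) *\<^sub>R c)"
      using integral_vec_combination(1)[OF c(4) rb] by (simp only:)
    ultimately have "has_order c (r ^ Suc 1)" using assms(4) by (intro has_orderI_prime_power)
    then show ?thesis using c True by (auto simp: power2_eq_square)
  qed
qed

text \<open>Each index under consideration, including 2 to 5, divides one of 48, 9, 15 and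
  20.\<close>

lemma prime_divisor_small:
  fixes r m :: int
  assumes "prime r" "r dvd m" "m dvd 48 \<or> m dvd 9 \<or> m dvd 15 \<or> m dvd 20"
  shows "r \<in> {2, 3, 5}"
proof -
  have "r dvd 48 \<or> r dvd 9 \<or> r dvd 15 \<or> r dvd 20" using assms(2,3) dvd_trans by blast
  then have "r dvd 2 ^ 4 * 3 \<or> r dvd 3 * 3 \<or> r dvd 3 * 5 \<or> r dvd 2 ^ 2 * 5" by simp
  then have "r dvd 2 \<or> r dvd 3 \<or> r dvd 5"
    using assms(1) by (metis prime_dvd_mult_iff prime_dvd_power)
  moreover have "prime (2 :: int)" "prime (3 :: int)" "prime (5 :: int)" by simp_all
  ultimately show ?thesis using assms(1) primes_dvd_imp_eq by blast
qed

text \<open>A class whose order is a product of two primes from 2, 3, 5 exists. Since 6, 9, 10 and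
  15 are excluded as orders and 25 divides none of the indices, the order is 4. Modulo a class of
  order 4 a further prime appears; it leads to an order 8, 6 or 10, or to two independent classes of
  order 2.\<close>

lemma excluded_index:
  assumes "index_class e W" "\<bar>det W\<bar> \<in> {6, 8, 9, 10, 12, 15, 16, 20}"
  shows False
proof -
  define m where "m = \<bar>det W\<bar>"
  have m: "m \<in> {6, 8, 9, 10, 12, 15, 16, 20}" using assms(2) by (simp add: m_def)
  have dvdm: "x dvd det W \<longleftrightarrow> x dvd m" for x by (simp add: m_def)
  have W0: "det W \<noteq> 0" using assms(2) by auto
  have small: "r \<in> {2, 3, 5}" if "prime r" "r dvd m" for r
    using prime_divisor_small[OF that] m by auto
  obtain r a where a: "prime r" "r dvd m" "a \<in> glue_group W" "integral_vec (of_int r *\<^sub>R a)" "\<not> integral_vec a"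
    using first_order[OF W0] assms(2) by (auto simp: m_def)
  have "r = 2 \<or> r = 3 \<or> \<not> r * r dvd det W" using small[OF a(1,2)] m by (auto simp: dvdm)
  moreover have "\<bar>det W\<bar> \<noteq> r" using small[OF a(1,2)] m by (auto simp: m_def)
  ultimately obtain r' c where c: "prime r'" "r' * r dvd m" "c \<in> glue_group W" "has_order c (r' * r)"
    using second_order[OF assms(1) W0 a(3,1,4,5)] by (auto simp: dvdm)
  have "r' dvd m" using c(2) dvd_mult_left by blast
  then have "r' * r = 4" "4 dvd m"
    using small[OF a(1,2)] small[OF c(1)] excluded_orders[OF assms(1) c(3,4)] c(2) m by auto
  then have c4: "has_order c 4" using c(4) by simp
  then have "\<not> integral_vec (of_int 2 *\<^sub>R c)" unfolding has_order_def by fastforce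
  then obtain i where i: "2 * c $ i \<notin> \<int>" by (auto simp: integral_vec_def)
  have int4: "integral_vec (of_int 4 *\<^sub>R c)" using c4 by (simp add: has_order_def)
  then obtain s where s: "of_int 4 * c $ i = of_int s"
    by (auto simp: integral_vec_def elim!: allE[of _ i] Ints_cases)
  have "odd s"
  proof
    assume "even s"
    then obtain t where "s = 2 * t" by blast
    then have "2 * c $ i = of_int t" using s by simp
    then show False using i by simp
  qed
  then have "coprime s (2 ^ 2)" by (subst coprime_power_right_iff) simp
  then have "coprime s 4" by simp
  then obtain u b where b: "b \<in> glue_group W" "b $ i = 1 / of_int 4" "integral_vec (b - of_int u *\<^sub>R c)"
    using unit_coordinate[OF c(3) _ int4 s] by auto
  have "of_int 4 *\<^sub>R b = of_int 4 *\<^sub>R (b - of_int u *\<^sub>R c) + of_int u *\<^sub>R (of_int 4 *\<^sub>R c)"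
    by (simp add: algebra_simps)
  then have b4: "integral_vec (of_int 4 *\<^sub>R b)"
    using integral_vec_combination(1)[OF b(3) int4] by (simp only:)
  have ob: "has_order b 4" using order_unit[OF _ b4 b(2)] by simp
  have b2: "of_int 2 *\<^sub>R b \<in> glue_group W" using b(1) by (intro glue_group_scaleR) auto
  have nb2: "\<not> integral_vec (of_int 2 *\<^sub>R b)" using ob unfolding has_order_def by fastforce
  have bb: "integral_vec (of_int 2 *\<^sub>R (of_int 2 *\<^sub>R b))" using b4 by simp
  have o2: "has_order (of_int 2 *\<^sub>R b) 2" using bb nb2 by (intro has_orderI_prime) auto
  have "\<bar>det W\<bar> \<noteq> 4" using m by (auto simp: m_def)
  then obtain r2 c2 k where c2: "prime r2" "r2 * 4 dvd m" "c2 \<in> glue_group W"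
    "integral_vec (of_int r2 *\<^sub>R c2 - of_int k *\<^sub>R b)" "\<forall>l. \<not> integral_vec (c2 - of_int l *\<^sub>R b)"
    using next_order[OF W0 b(1) _ b4 b(2)] by (auto simp: dvdm)
  have "r2 dvd m" using c2(2) dvd_mult_left by blast
  then consider "r2 = 2" "even k" | "r2 = 2" "odd k" | "r2 = 3 \<or> r2 = 5" using small[OF c2(1)] by auto
  then show False
  proof cases
    case 1
    then obtain k' where k: "k = 2 * k'" by blast
    have "of_int 2 *\<^sub>R (c2 - of_int k' *\<^sub>R b) = of_int r2 *\<^sub>R c2 - of_int k *\<^sub>R b"
      by (simp add: 1 k algebra_simps)
    then have "integral_vec (of_int 2 *\<^sub>R (c2 - of_int k' *\<^sub>R b))" using c2(4) by (simp only:)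
    moreover have "c2 - of_int k' *\<^sub>R b \<in> glue_group W"
      using b(1) c2(3) by (intro glue_group_diff glue_group_scaleR) auto
    moreover have "\<not> integral_vec (c2 - of_int k' *\<^sub>R b - of_int l *\<^sub>R (of_int 2 *\<^sub>R b))" for l
    proof -
      have "c2 - of_int k' *\<^sub>R b - of_int l *\<^sub>R (of_int 2 *\<^sub>R b) = c2 - of_int (k' + 2 * l) *\<^sub>R b"
        by (simp add: algebra_simps)
      then show ?thesis using c2(5) by (simp only: not_False_eq_True)
    qed
    ultimately show False
      using not_elementary[OF assms(1) b2 _ _ bb _ nb2, of "c2 - of_int k' *\<^sub>R b"] by blast
  next
    case 2
    have "of_int (2 ^ Suc 2) *\<^sub>R c2 = of_int 4 *\<^sub>R (of_int r2 *\<^sub>R c2 - of_int k *\<^sub>R b) + of_int k *\<^sub>R (of_int 4 *\<^sub>R b)"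
      by (simp add: 2 algebra_simps)
    then have "integral_vec (of_int (2 ^ Suc 2) *\<^sub>R c2)"
      using integral_vec_combination(1)[OF c2(4) b4] by (simp only:)
    moreover have "\<not> integral_vec (of_int (2 ^ 2) *\<^sub>R c2)"
    proof
      assume c4: "integral_vec (of_int (2 ^ 2) *\<^sub>R c2)"
      have "integral_vec (of_int 1 *\<^sub>R (of_int (2 ^ 2) *\<^sub>R c2) - of_int 2 *\<^sub>R (of_int r2 *\<^sub>R c2 - of_int k *\<^sub>R b))"
        by (rule integral_vec_combination(2)[OF c4 c2(4)])
      then have "integral_vec (of_int (2 * k) *\<^sub>R b)" by (simp add: 2 algebra_simps)
      then have "4 dvd 2 * k" using ob by (simp add: has_order_def)
      then show False using 2 by presburger
    qed
    ultimately have "has_order c2 (2 ^ Suc 2)" by (intro has_orderI_prime_power) auto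
    then show False using excluded_orders[OF assms(1) c2(3)] by auto
  next
    case 3
    then have "odd r2" by auto
    then have "coprime r2 (2 ^ 2)" by (subst coprime_power_right_iff) simp
    then have "coprime r2 4" by simp
    then obtain j where "integral_vec (of_int r2 *\<^sub>R (c2 - of_int j *\<^sub>R b))"
      using coprime_complement[OF c2(4) b4] by blast
    then have o: "has_order (c2 - of_int j *\<^sub>R b) r2" using c2(1,5) by (intro has_orderI_prime) auto
    have "has_order (c2 - of_int j *\<^sub>R b + of_int 2 *\<^sub>R b) (r2 * 2)"
      using \<open>odd r2\<close> by (intro has_order_add[OF o o2]) simp
    moreover have "c2 - of_int j *\<^sub>R b + of_int 2 *\<^sub>R b \<in> glue_group W"
      using b(1) c2(3) by (intro glue_group_add glue_group_diff glue_group_scaleR) auto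
    ultimately show False using excluded_orders[OF assms(1)] 3 by fastforce
  qed
qed

text \<open>The quotient is cyclic. For prime index any nonintegral class found by
  \<open>first_order\<close> generates it; for index 4 two independent classes of order 2 are
  impossible, so \<open>second_order\<close> gives order 4.\<close>

lemma exists_index_order:
  assumes "index_class e W" "\<bar>det W\<bar> \<in> {2, 3, 4, 5}"
  shows "\<exists>a\<in>glue_group W. has_order a \<bar>det W\<bar>"
proof -
  define m where "m = \<bar>det W\<bar>"
  have m: "m \<in> {2, 3, 4, 5}" using assms(2) by (simp add: m_def)
  have dvdm: "x dvd det W \<longleftrightarrow> x dvd m" for x by (simp add: m_def)
  have W0: "det W \<noteq> 0" using assms(2) by auto
  obtain r a where a: "prime r" "r dvd m" "a \<in> glue_group W" "integral_vec (of_int r *\<^sub>R a)" "\<not> integral_vec a"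
    using first_order[OF W0] assms(2) by (auto simp: m_def)
  have "m dvd 48 \<or> m dvd 9 \<or> m dvd 15 \<or> m dvd 20" using m by auto
  note small = prime_divisor_small[OF _ _ this]
  show ?thesis
  proof (cases "m = r")
    case True
    then show ?thesis using has_orderI_prime[OF a(1,4,5)] a(3) by (auto simp: m_def)
  next
    case False
    then have "r = 2" "m = 4" using small[OF a(1,2)] a(2) m by auto
    have "\<bar>det W\<bar> \<noteq> r" using False by (simp add: m_def)
    then obtain r' c where c: "prime r'" "r' * 2 dvd m" "c \<in> glue_group W" "has_order c (r' * 2)"
      using second_order[OF assms(1) W0 a(3,1,4,5)] \<open>r = 2\<close> unfolding dvdm by blast
    have "r' dvd m" using c(2) dvd_mult_left by blast
    then have "r' = 2" using small[OF c(1)] c(2) \<open>m = 4\<close> by auto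
    then show ?thesis using c \<open>m = 4\<close> by (auto simp: m_def)
  qed
qed

text \<open>With \<open>m = g q\<close> and the integer vector \<open>t = q a\<close>, the
  hypothesis reads \<open>g t \<le> 5\<close>. A nonnegative entry of \<open>t\<close> is its own
  residue, and a negative one is raised by at least \<open>q\<close>. As the entries of
  \<open>t\<close> sum to \<open>q\<close>, fewer entries are raised than the height, so
  \<open>flip_class\<close> applies.\<close>

lemma flip_index:
  assumes "index_class e W" "\<bar>det W\<bar> \<ge> 6" "a \<in> glue_group W" "\<not> integral_vec a"
    "(\<Sum>k\<in>UNIV. a $ k) = 1" "\<And>k. of_int \<bar>det W\<bar> * a $ k < 6"
  shows False
proof -
  define m where "m = \<bar>det W\<bar>"
  have W0: "det W \<noteq> 0" using assms(2) by auto
  obtain q where q: "has_order a q" "q dvd m" using exists_order[OF W0 assms(3)] by (auto simp: m_def)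
  have q0: "q > 0" using q(1) by (simp add: has_order_def)
  have "q \<noteq> 1" using q(1) assms(4) by (auto simp: has_order_def)
  then have q1: "q > 1" using q0 by simp
  obtain g where g: "m = g * q" using q(2) by (metis dvd_def mult.commute)
  have m6: "m \<ge> 6" using assms(2) by (simp add: m_def)
  then have g0: "g > 0" using g q0 by (metis less_le_trans not_less zero_less_mult_pos2 zero_less_numeral)
  obtain d where gl: "glue 8 {a. \<exists>b\<in>glue_group W. \<forall>i<8. a i = b $ e i} d"
    using assms(1) by (auto simp: index_class_def)
  note c = glue_class_residues[OF assms(1,3) q(1)]
  define t where "t k = \<lfloor>of_int q * a $ k\<rfloor>" for k
  have t: "of_int (t k) = of_int q * a $ k" for k
    using q(1) unfolding t_def by (auto simp: has_order_def integral_vec_def elim!: allE[of _ k] Ints_cases)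
  have gt: "g * t k \<le> 5" for k
  proof -
    have "of_int (g * t k) = of_int \<bar>det W\<bar> * a $ k"
      by (simp add: t g m_def[symmetric])
    then have "of_int (g * t k) < (6 :: real)" using assms(6)[of k] by simp
    then show ?thesis by linarith
  qed
  have bij: "bij_betw e {..<8} UNIV" using assms(1) by (simp add: index_class_def)
  have sum_t: "(\<Sum>i<8. t (e i)) = q"
  proof -
    have "(\<Sum>i<8. of_int (t (e i))) = (\<Sum>k\<in>UNIV. (of_int (t k) :: real))"
      by (rule sum.reindex_bij_betw[OF bij])
    also have "\<dots> = of_int q" using assms(5) by (simp add: t flip: sum_distrib_left)
    finally show ?thesis by (metis of_int_eq_iff of_int_sum)
  qed
  define v where "v = residues e q a"
  have v: "length v = 8" "\<And>i. i < 8 \<Longrightarrow> v ! i = t (e i) mod q"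
    by (simp_all add: v_def residues_def t_def)
  have small: "t k < q" for k
  proof -
    have "g * t k < g * q" using gt[of k] m6 g by simp
    then show ?thesis using g0 by simp
  qed
  have bound: "(if g * (t k mod q) > 5 then q else 0) \<le> t k mod q - t k" for k
  proof (cases "t k \<ge> 0")
    case True
    then have "t k mod q = t k" using small[of k] by simp
    then show ?thesis using gt[of k] by simp
  next
    case False
    have "t k mod q - t k = - (t k div q) * q" by (simp add: minus_div_mult_eq_mod[symmetric])
    moreover have "t k div q \<le> -1" using False pos_imp_zdiv_neg_iff[OF q0, of "t k"] by linarith
    then have "1 * q \<le> - (t k div q) * q" using q0 by (intro mult_right_mono) auto
    ultimately show ?thesis using q0 by auto
  qed
  have "int (length (filter (\<lambda>x. g * x > 5) v)) * q = (\<Sum>i<8. if g * (v ! i) > 5 then q else 0)"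
  proof -
    have "(\<Sum>i<8. if g * (v ! i) > 5 then q else 0) = (\<Sum>i\<in>{i. i < 8 \<and> g * (v ! i) > 5}. q)"
      by (simp add: sum.If_cases Int_def)
    then show ?thesis by (simp add: length_filter_conv_card v(1))
  qed
  also have "\<dots> \<le> (\<Sum>i<8. v ! i - t (e i))"
    using bound v(2) by (intro sum_mono) auto
  also have "\<dots> = sum_list v - q"
    using sum_t by (simp add: sum_subtractf sum_list_sum_nth v(1) atLeast0LessThan)
  finally have "int (length (filter (\<lambda>x. g * x > 5) v)) * q + q \<le> sum_list v" by simp
  then have fl: "g * q < 25" "q < 11"
    using flip_class[OF gl c q1, of g] g0 unfolding v_def by auto
  have "\<exists>k. t k > 0"
  proof (rule ccontr)
    assume "\<not> ?thesis"
    then have "(\<Sum>i<8. t (e i)) \<le> 0" by (intro sum_nonpos) (simp add: not_less)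
    then show False using sum_t q0 by simp
  qed
  then obtain k where "t k > 0" by blast
  then have "g * 1 \<le> g * t k" using g0 by (intro mult_left_mono) auto
  then have g5: "g \<le> 5" using gt[of k] by simp
  have "q \<in> set [2..5]"
  proof -
    have "q \<notin> {6, 7, 8, 9, 10}" using excluded_orders[OF assms(1,3) q(1)] by auto
    then show ?thesis using fl q1 by (simp only: set_upto atLeastAtMost_iff) auto
  qed
  also have "[2..5] = [2, 3, 4, 5 :: int]" by code_simp
  finally have q': "q \<in> {2, 3, 4, 5}" by simp
  have "g \<in> set [1..5]" using g0 g5 by (simp only: set_upto atLeastAtMost_iff) auto
  also have "[1..5] = [1, 2, 3, 4, 5 :: int]" by code_simp
  finally have "g \<in> {1, 2, 3, 4, 5}" by simp
  \<comment> \<open>The products \<open>g q\<close> with \<open>g \<le> 5\<close> and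
    \<open>2 \<le> q \<le> 5\<close> that are at least 6 and below 25.\<close>
  then have "m \<in> {6, 8, 9, 10, 12, 15, 16, 20}" using q' m6 fl(1) by (auto simp: g)
  then show False using excluded_index[OF assms(1)] by (simp add: m_def)
qed

section \<open>Barycentric coordinates and empty spheres\<close>

lemma sum_option: "(\<Sum>k\<in>(UNIV :: 'n::finite option set). f k) = f None + (\<Sum>i\<in>UNIV. f (Some i))"
  by (simp add: UNIV_option_conv sum.reindex)

text \<open>Homogeneous coordinates: the extra entry 1 at \<open>None\<close> makes affine
  conditions linear. The type \<open>'n option\<close> also indexes the vertices of a simplex, so
  the vertex matrix is square and its determinant is the index up to sign.\<close>

definition hom :: "'a::one ^ 'n \<Rightarrow> 'a ^ ('n option)" where
  "hom x = (\<chi> k. case k of None \<Rightarrow> 1 | Some i \<Rightarrow> x $ i)"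

lemma hom_nth [simp]: "hom x $ None = 1" "hom x $ Some i = x $ i"
  by (simp_all add: hom_def)

lemma real_vec_hom: "real_vec (hom x) = hom (real_vec x)"
  by (simp add: vec_eq_iff real_vec_def hom_def split: option.split)

lemma real_vec_simps: "real_vec 0 = 0" "real_vec (x + y) = real_vec x + real_vec y"
  "real_vec (x - y) = real_vec x - real_vec y" "real_vec (- x) = - real_vec x"
  "real_vec x $ i = of_int (x $ i)"
  by (simp_all add: real_vec_def vec_eq_iff)

lemma real_vec_inject: "real_vec x = real_vec y \<longleftrightarrow> x = y"
  by (simp add: real_vec_def vec_eq_iff)

definition vmat :: "('n::finite option \<Rightarrow> int ^ 'n) \<Rightarrow> int ^ ('n option) ^ ('n option)" where
  "vmat v = (\<chi> r c. hom (v c) $ r)"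

text \<open>Cramer's rule is taken as the definition; it gives the barycentric coordinates when the
  vertex matrix is nonsingular.\<close>

definition bary :: "('n::finite option \<Rightarrow> int ^ 'n) \<Rightarrow> real ^ 'n \<Rightarrow> real ^ ('n option)" where
  "bary v x = (\<chi> k. det (replace_column (real_mat (vmat v)) k (hom x)) / det (real_mat (vmat v)))"

lemma vmat_mult_eq_iff:
  "real_mat (vmat v) *v a = s *\<^sub>R hom x \<longleftrightarrow>
    (\<Sum>k\<in>UNIV. a $ k) = s \<and> (\<Sum>k\<in>UNIV. a $ k *\<^sub>R real_vec (v k)) = s *\<^sub>R x"
proof -
  have "(real_mat (vmat v) *v a) $ None = (\<Sum>k\<in>UNIV. a $ k)"
    by (simp add: matrix_vector_mult_def real_mat_def vmat_def)
  moreover have "(real_mat (vmat v) *v a) $ Some i = (\<Sum>k\<in>UNIV. a $ k *\<^sub>R real_vec (v k)) $ i" for i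
    by (simp add: matrix_vector_mult_def real_mat_def vmat_def real_vec_def mult.commute)
  ultimately show ?thesis
    by (simp add: vec_eq_iff[of "real_mat (vmat v) *v a"] vec_eq_iff[of _ "s *\<^sub>R x"] split_option_all)
qed

lemma mult_bary:
  assumes "det (vmat v) \<noteq> 0"
  shows "real_mat (vmat v) *v a = hom x \<longleftrightarrow> a = bary v x"
  unfolding bary_def replace_column_def
  using cramer[of "real_mat (vmat v)" a "hom x"] assms by (simp add: det_real_mat)

lemma bary_eq_iff:
  assumes "det (vmat v) \<noteq> 0"
  shows "a = bary v x \<longleftrightarrow> (\<Sum>k\<in>UNIV. a $ k) = 1 \<and> (\<Sum>k\<in>UNIV. a $ k *\<^sub>R real_vec (v k)) = x"
  using mult_bary[OF assms] vmat_mult_eq_iff[of v a 1 x] by simp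

lemma bary_sum:
  assumes "det (vmat v) \<noteq> 0"
  shows "(\<Sum>k\<in>UNIV. bary v x $ k) = 1" "(\<Sum>k\<in>UNIV. bary v x $ k *\<^sub>R real_vec (v k)) = x"
  using bary_eq_iff[OF assms, of "bary v x"] by auto

lemma sum_axis_mult: "(\<Sum>k\<in>UNIV. axis j (1 :: real) $ k * f k) = f j"
  by (simp add: axis_def if_distrib if_distribR cong: if_cong)

lemma sum_axis_scaleR:
  fixes f :: "_ \<Rightarrow> 'b::real_vector"
  shows "(\<Sum>k\<in>UNIV. axis j (1 :: real) $ k *\<^sub>R f k) = f j"
proof -
  have "axis j (1 :: real) $ k *\<^sub>R f k = (if k = j then f k else 0)" for k by (simp add: axis_def)
  then show ?thesis by simp
qed

lemma bary_vertex: "det (vmat v) \<noteq> 0 \<Longrightarrow> bary v (real_vec (v j)) = axis j 1"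
  using bary_eq_iff[of v "axis j 1" "real_vec (v j)"] sum_axis_mult[of j "\<lambda>_. 1"]
    sum_axis_scaleR[of j "\<lambda>k. real_vec (v k)"] by simp

lemma bary_combination:
  assumes "det (vmat v) \<noteq> 0" "finite I" "sum a I = 1"
  shows "bary v (\<Sum>i\<in>I. a i *\<^sub>R p i) = (\<Sum>i\<in>I. a i *\<^sub>R bary v (p i))"
proof -
  have "(\<Sum>k\<in>UNIV. (\<Sum>i\<in>I. a i *\<^sub>R bary v (p i)) $ k) = (\<Sum>i\<in>I. a i * (\<Sum>k\<in>UNIV. bary v (p i) $ k))"
    by (simp add: sum_distrib_left) (rule sum.swap)
  moreover have "(\<Sum>k\<in>UNIV. (\<Sum>i\<in>I. a i *\<^sub>R bary v (p i)) $ k *\<^sub>R real_vec (v k)) =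
      (\<Sum>i\<in>I. a i *\<^sub>R (\<Sum>k\<in>UNIV. bary v (p i) $ k *\<^sub>R real_vec (v k)))"
    by (simp add: scaleR_sum_right scaleR_sum_left) (rule sum.swap)
  ultimately have "(\<Sum>k\<in>UNIV. (\<Sum>i\<in>I. a i *\<^sub>R bary v (p i)) $ k) = 1 \<and>
      (\<Sum>k\<in>UNIV. (\<Sum>i\<in>I. a i *\<^sub>R bary v (p i)) $ k *\<^sub>R real_vec (v k)) = (\<Sum>i\<in>I. a i *\<^sub>R p i)"
    by (simp only: bary_sum[OF assms(1)] mult.right_neutral assms(3))
  then show ?thesis by (simp only: bary_eq_iff[OF assms(1), symmetric])
qed

lemma bary_line:
  assumes "det (vmat v) \<noteq> 0"
  shows "bary v (x + y - z) = bary v x + bary v y - bary v z"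
proof -
  have "(\<Sum>k\<in>UNIV. (bary v x + bary v y - bary v z) $ k) = 1"
    by (simp add: sum.distrib sum_subtractf bary_sum[OF assms])
  moreover have "(\<Sum>k\<in>UNIV. (bary v x + bary v y - bary v z) $ k *\<^sub>R real_vec (v k)) = x + y - z"
    by (simp add: sum.distrib sum_subtractf bary_sum[OF assms] scaleR_add_left scaleR_diff_left)
  ultimately show ?thesis using bary_eq_iff[OF assms] by metis
qed

lemma bary_glue_group: "det (vmat v) \<noteq> 0 \<Longrightarrow> bary v (real_vec x) \<in> glue_group (vmat v)"
  using mult_bary[of v "bary v (real_vec x)" "real_vec x"]
  by (simp add: glue_group_def integral_vec_real_vec flip: real_vec_hom)

text \<open>The \<open>None\<close> row of the vertex matrix computes the coordinate sum. When this
  is 1, the integral image vector is the homogenisation of a lattice point.\<close>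

lemma glue_group_bary:
  assumes "det (vmat v) \<noteq> 0" "a \<in> glue_group (vmat v)" "(\<Sum>k\<in>UNIV. a $ k) = 1"
  shows "\<exists>x. a = bary v (real_vec x)"
proof -
  obtain w where w: "real_mat (vmat v) *v a = real_vec w"
    using assms(2) by (auto simp: glue_group_def elim: integral_vecE)
  define x where "x = (\<chi> i. w $ Some i)"
  have "(real_mat (vmat v) *v a) $ None = 1"
    using assms(3) by (simp add: matrix_vector_mult_def real_mat_def vmat_def)
  then have "real_vec w = hom (real_vec x)"
    unfolding w by (simp add: vec_eq_iff x_def real_vec_def hom_def split: option.split)
  then show ?thesis using w mult_bary[OF assms(1)] by metis
qed

lemma bary_affine:
  assumes "det (vmat v) \<noteq> 0"
  shows "\<exists>b c. \<forall>x. (\<Sum>k\<in>UNIV. bary v x $ k * q k) = b \<bullet> x + c"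
proof -
  obtain B where B: "B ** real_mat (vmat v) = mat 1"
    using assms by (metis det_real_mat invertible_def invertible_det_nz of_int_eq_0_iff)
  have bary: "bary v x = B *v hom x" for x
    using mult_bary[OF assms, of "bary v x" x] B
    by (metis matrix_vector_mul_assoc matrix_vector_mul_lid)
  have "(\<Sum>k\<in>UNIV. bary v x $ k * q k) =
      (\<chi> i. \<Sum>k\<in>UNIV. B $ k $ Some i * q k) \<bullet> x + (\<Sum>k\<in>UNIV. B $ k $ None * q k)" for x
  proof -
    have "(\<Sum>k\<in>UNIV. bary v x $ k * q k) = (\<Sum>k\<in>UNIV. \<Sum>r\<in>UNIV. B $ k $ r * hom x $ r * q k)"
      by (simp add: bary matrix_vector_mult_def sum_distrib_right)
    also have "\<dots> = (\<Sum>r\<in>UNIV. \<Sum>k\<in>UNIV. B $ k $ r * hom x $ r * q k)"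
      by (rule sum.swap)
    also have "\<dots> = (\<Sum>k\<in>UNIV. B $ k $ None * hom x $ None * q k) +
        (\<Sum>i\<in>UNIV. \<Sum>k\<in>UNIV. B $ k $ Some i * hom x $ Some i * q k)"
      by (rule sum_option)
    also have "\<dots> = (\<Sum>i\<in>UNIV. (\<Sum>k\<in>UNIV. B $ k $ Some i * q k) * x $ i) + (\<Sum>k\<in>UNIV. B $ k $ None * q k)"
      by (simp add: sum_distrib_left sum_distrib_right ac_simps)
    finally show ?thesis by (simp add: inner_vec_def)
  qed
  then show ?thesis by blast
qed

text \<open>A kernel vector of the vertex matrix is an affine dependence of the vertices: its
  \<open>None\<close> row says that the coefficients sum to 0.\<close>

lemma det_nz_iff_inj_independent:
  "det (vmat v) \<noteq> 0 \<longleftrightarrow> inj v \<and> \<not> affine_dependent (real_vec ` range v)"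
proof
  assume d: "det (vmat v) \<noteq> 0"
  have inj: "inj v"
  proof
    fix i j assume "v i = v j"
    then have "axis i (1 :: real) = axis j 1" using bary_vertex[OF d] by metis
    then show "i = j" by (simp add: axis_eq_axis)
  qed
  moreover have "\<not> affine_dependent (real_vec ` range v)"
  proof
    assume "affine_dependent (real_vec ` range v)"
    then obtain U where U: "sum U (real_vec ` range v) = 0" "\<exists>p\<in>real_vec ` range v. U p \<noteq> 0"
      "(\<Sum>p\<in>real_vec ` range v. U p *\<^sub>R p) = 0"
      by (auto simp: affine_dependent_explicit_finite)
    have inj': "inj_on real_vec (range v)" by (simp add: inj_on_def real_vec_inject)
    define a where "a = (\<chi> k. U (real_vec (v k)))"
    have "(\<Sum>k\<in>UNIV. a $ k) = 0" "(\<Sum>k\<in>UNIV. a $ k *\<^sub>R real_vec (v k)) = 0"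
      using U(1,3) inj by (simp_all add: a_def sum.reindex[OF inj'] sum.reindex o_def)
    then have "real_mat (vmat v) *v a = 0 *\<^sub>R hom 0" by (subst vmat_mult_eq_iff) simp
    then have "real_mat (vmat v) *v (a + bary v 0) = hom 0"
      using mult_bary[OF d, of "bary v 0" 0] by (simp add: matrix_vector_right_distrib)
    then have "a = 0" using mult_bary[OF d] by (metis add_cancel_left_left)
    then show False using U(2) by (auto simp: a_def vec_eq_iff)
  qed
  ultimately show "inj v \<and> \<not> affine_dependent (real_vec ` range v)" by blast
next
  assume asm: "inj v \<and> \<not> affine_dependent (real_vec ` range v)"
  have inj': "inj_on real_vec (range v)" by (simp add: inj_on_def real_vec_inject)
  show "det (vmat v) \<noteq> 0"
  proof
    assume "det (vmat v) = 0"
    then have "\<not> (\<exists>B. B ** real_mat (vmat v) = mat 1)"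
      by (metis det_real_mat invertible_det_nz invertible_left_inverse of_int_0)
    then obtain a where a: "real_mat (vmat v) *v a = 0" "a \<noteq> 0"
      by (auto simp: matrix_left_invertible_ker)
    then have s: "(\<Sum>k\<in>UNIV. a $ k) = 0" "(\<Sum>k\<in>UNIV. a $ k *\<^sub>R real_vec (v k)) = 0"
      using vmat_mult_eq_iff[of v a 0 0] by auto
    define U where "U p = a $ inv v (inv real_vec p)" for p
    have U: "U (real_vec (v k)) = a $ k" for k
      using asm by (simp add: U_def inv_f_f inj_def real_vec_inject)
    obtain k where "a $ k \<noteq> 0" using a(2) by (auto simp: vec_eq_iff)
    then have "affine_dependent (real_vec ` range v)"
      using s asm U
      by (auto simp: affine_dependent_explicit_finite sum.reindex[OF inj'] sum.reindex o_def intro!: exI[of _ U])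
    then show False using asm by blast
  qed
qed

section \<open>Empty spheres of a quadratic form\<close>

definition qf :: "real ^ 'n ^ 'n \<Rightarrow> real ^ 'n \<Rightarrow> real" where
  "qf Q x = x \<bullet> (Q *v x)"

definition posdef :: "real ^ 'n ^ 'n \<Rightarrow> bool" where
  "posdef Q \<longleftrightarrow> transpose Q = Q \<and> (\<forall>x. x \<noteq> 0 \<longrightarrow> qf Q x > 0)"

text \<open>The form minus its affine interpolant at the vertices. For positive definite
  \<open>Q\<close> this is the power of the point with respect to the circumscribed sphere. Unlike
  centre and radius, it is linear in \<open>Q\<close>, which the deformation relies on.\<close>

definition interp_gap :: "real ^ 'n ^ 'n \<Rightarrow> ('n::finite option \<Rightarrow> int ^ 'n) \<Rightarrow> real ^ 'n \<Rightarrow> real" where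
  "interp_gap Q v x = qf Q x - (\<Sum>k\<in>UNIV. bary v x $ k * qf Q (real_vec (v k)))"

definition empty_sphere :: "real ^ 'n ^ 'n \<Rightarrow> ('n::finite option \<Rightarrow> int ^ 'n) \<Rightarrow> bool" where
  "empty_sphere Q v \<longleftrightarrow> det (vmat v) \<noteq> 0 \<and> (\<forall>x. x \<notin> range v \<longrightarrow> interp_gap Q v (real_vec x) > 0)"

lemma inner_symmetric: "transpose Q = Q \<Longrightarrow> x \<bullet> (Q *v y) = y \<bullet> (Q *v x)" for Q :: "real ^ 'n ^ 'n"
  by (metis dot_lmul_matrix inner_commute transpose_matrix_vector)

lemma qf_diff: "transpose Q = Q \<Longrightarrow> qf Q (x - y) = qf Q x + qf Q y - 2 * (x \<bullet> (Q *v y))"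
  using inner_symmetric[of Q y x]
  by (simp add: qf_def matrix_vector_mult_diff_distrib inner_diff_left inner_diff_right)

lemma interp_gap_vertex: "det (vmat v) \<noteq> 0 \<Longrightarrow> interp_gap Q v (real_vec (v k)) = 0"
  by (simp add: interp_gap_def bary_vertex sum_axis_mult)

text \<open>Squared distances are expanded with \<open>qf_diff\<close>, and the coordinates sum to
  1. The gap is thus \<open>- quad / 2\<close> for the distances of the vertices, so an empty sphere
  satisfies the axioms of \<open>glue\<close>.\<close>

lemma interp_gap_eq:
  assumes "transpose Q = Q" "det (vmat v) \<noteq> 0"
  shows "interp_gap Q v x = - (\<Sum>i\<in>UNIV. \<Sum>j\<in>UNIV. qf Q (real_vec (v i) - real_vec (v j)) * bary v x $ i * bary v x $ j) / 2"
proof -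
  let ?a = "\<lambda>i. bary v x $ i" and ?p = "\<lambda>i. real_vec (v i)"
  have x: "x = (\<Sum>i\<in>UNIV. ?a i *\<^sub>R ?p i)" using bary_sum[OF assms(2)] by simp
  have "qf Q x = (\<Sum>i\<in>UNIV. \<Sum>j\<in>UNIV. ?a i * ?a j * (?p i \<bullet> (Q *v ?p j)))"
  proof -
    have "Q *v x = (\<Sum>j\<in>UNIV. ?a j *\<^sub>R (Q *v ?p j))"
      by (subst x) (simp add: matrix_vector_mult_scaleR linear_sum[OF matrix_vector_mul_linear])
    then have "qf Q x = (\<Sum>i\<in>UNIV. ?a i *\<^sub>R ?p i) \<bullet> (\<Sum>j\<in>UNIV. ?a j *\<^sub>R (Q *v ?p j))"
      using x by (simp add: qf_def)
    also have "\<dots> = (\<Sum>i\<in>UNIV. \<Sum>j\<in>UNIV. (?a i *\<^sub>R ?p i) \<bullet> (?a j *\<^sub>R (Q *v ?p j)))"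
      by (simp only: inner_sum_left) (simp only: inner_sum_right)
    finally show ?thesis by (simp add: ac_simps)
  qed
  moreover have "(\<Sum>i\<in>UNIV. \<Sum>j\<in>UNIV. qf Q (?p i - ?p j) * ?a i * ?a j) =
      (\<Sum>i\<in>UNIV. \<Sum>j\<in>UNIV. ?a i * qf Q (?p i) * ?a j + ?a i * (?a j * qf Q (?p j)) - 2 * (?a i * ?a j * (?p i \<bullet> (Q *v ?p j))))"
    by (intro sum.cong refl) (simp add: qf_diff[OF assms(1)] algebra_simps)
  moreover have "\<dots> = 2 * (\<Sum>i\<in>UNIV. ?a i * qf Q (?p i)) - 2 * (\<Sum>i\<in>UNIV. \<Sum>j\<in>UNIV. ?a i * ?a j * (?p i \<bullet> (Q *v ?p j)))"
    using bary_sum(1)[OF assms(2), of x]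
    by (simp add: sum.distrib sum_subtractf flip: sum_distrib_left sum_distrib_right)
  ultimately show ?thesis by (simp add: interp_gap_def)
qed

text \<open>The affine part is determined by the values at the vertices, so the quadratic part and
  the simplex fix the whole polynomial.\<close>

lemma quadratic_eq_interp_gap:
  assumes "det (vmat v) \<noteq> 0" "\<And>k. qf Q (real_vec (v k)) + b \<bullet> real_vec (v k) + c = 0"
  shows "qf Q x + b \<bullet> x + c = interp_gap Q v x"
proof -
  have "0 = (\<Sum>k\<in>UNIV. bary v x $ k * (qf Q (real_vec (v k)) + b \<bullet> real_vec (v k) + c))"
    by (simp add: assms(2))
  also have "\<dots> = (\<Sum>k\<in>UNIV. bary v x $ k * qf Q (real_vec (v k))) +
      b \<bullet> (\<Sum>k\<in>UNIV. bary v x $ k *\<^sub>R real_vec (v k)) + (\<Sum>k\<in>UNIV. bary v x $ k) * c"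
    by (simp add: inner_sum_right sum.distrib distrib_left sum_distrib_right)
  finally show ?thesis using bary_sum[OF assms(1), of x] by (simp add: interp_gap_def)
qed

lemma delaunay_simplex_iff:
  "delaunay_simplex S \<longleftrightarrow> (\<exists>Q v. posdef Q \<and> empty_sphere Q v \<and> range v = S)" for S :: "(int ^ 'n::finite) set"
proof
  assume S: "delaunay_simplex S"
  then obtain f where f: "posdef_quadratic f" "\<And>x. f (real_vec x) \<ge> 0" "{x. f (real_vec x) = 0} = S"
    by (auto simp: delaunay_simplex_def)
  from f(1) obtain Q b c where Q: "transpose Q = Q" "\<forall>x. x \<noteq> 0 \<longrightarrow> x \<bullet> (Q *v x) > 0"
    "f = (\<lambda>x. x \<bullet> (Q *v x) + b \<bullet> x + c)"
    by (auto simp: posdef_quadratic_def)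
  have "card S = CARD('n option)" using S by (simp add: delaunay_simplex_def)
  then have "finite S" by (metis card.infinite finite_UNIV finite_option_UNIV card_0_eq UNIV_not_empty finite)
  then obtain v :: "'n option \<Rightarrow> int ^ 'n" where "bij_betw v UNIV S"
    using \<open>card S = CARD('n option)\<close> finite_same_card_bij[of "UNIV :: 'n option set" S] by auto
  then have v: "inj v" "range v = S" by (auto simp: bij_betw_def)
  then have d: "det (vmat v) \<noteq> 0"
    using S by (simp add: det_nz_iff_inj_independent delaunay_simplex_def)
  have "f (real_vec (v k)) = 0" for k using f(3) v(2) by blast
  then have "f x = interp_gap Q v x" for x
    using quadratic_eq_interp_gap[OF d, of Q b c x] by (simp add: Q(3) qf_def)
  then have "empty_sphere Q v"
    using d f(2,3) v(2) unfolding empty_sphere_def by (metis (mono_tags, lifting) less_eq_real_def mem_Collect_eq)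
  moreover have "posdef Q" using Q by (simp add: posdef_def qf_def)
  ultimately show "\<exists>Q v. posdef Q \<and> empty_sphere Q v \<and> range v = S" using v(2) by blast
next
  assume "\<exists>Q v. posdef Q \<and> empty_sphere Q v \<and> range v = S"
  then obtain Q v where Q: "posdef Q" and v: "empty_sphere Q v" "range v = S" by blast
  have d: "det (vmat v) \<noteq> 0" using v(1) by (simp add: empty_sphere_def)
  then have ind: "inj v" "\<not> affine_dependent (real_vec ` S)"
    using v(2) by (auto simp: det_nz_iff_inj_independent)
  then have "card S = CARD('n) + 1" using v(2) card_image[of v UNIV] by simp
  moreover obtain b c where bc: "\<And>x. (\<Sum>k\<in>UNIV. bary v x $ k * qf Q (real_vec (v k))) = b \<bullet> x + c"
    using bary_affine[OF d] by metis
  have "interp_gap Q v = (\<lambda>x. x \<bullet> (Q *v x) + (- b) \<bullet> x + (- c))"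
    unfolding interp_gap_def bc by (simp add: qf_def fun_eq_iff)
  then have "posdef_quadratic (interp_gap Q v)"
    using Q unfolding posdef_quadratic_def posdef_def qf_def by blast
  moreover have "interp_gap Q v (real_vec x) = 0" if "x \<in> S" for x
    using that v(2) interp_gap_vertex[OF d] by blast
  moreover have "interp_gap Q v (real_vec x) > 0" if "x \<notin> S" for x
    using that v by (auto simp: empty_sphere_def)
  ultimately show "delaunay_simplex S"
    using ind(2) unfolding delaunay_simplex_def
    by (metis (mono_tags, lifting) Collect_cong Collect_mem_eq less_eq_real_def order_less_irrefl)
qed

section \<open>Uniform estimates over the lattice and exchange of vertices\<close>

lemma posdef_lower:
  fixes Q :: "real ^ 'n::finite ^ 'n"
  assumes "posdef Q"
  obtains c where "c > 0" "\<And>x. c * (norm x)\<^sup>2 \<le> qf Q x"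
proof -
  have "continuous_on (sphere 0 1) (qf Q)"
    unfolding qf_def by (intro continuous_intros linear_continuous_on linear_matrix_vector_mul_eq matrix_vector_mul_bounded_linear)
  moreover have "sphere (0 :: real ^ 'n) 1 \<noteq> {}" by simp
  ultimately obtain u where u: "u \<in> sphere 0 1" "\<And>x. x \<in> sphere 0 1 \<Longrightarrow> qf Q u \<le> qf Q x"
    using continuous_attains_inf[of "sphere 0 1" "qf Q"] by (auto simp: compact_sphere)
  have "qf Q u > 0" using u(1) assms unfolding posdef_def by (metis norm_zero dist_0_norm mem_sphere zero_neq_one)
  moreover have "qf Q u * (norm x)\<^sup>2 \<le> qf Q x" for x
  proof (cases "x = 0")
    case False
    have "qf Q u \<le> qf Q ((1 / norm x) *\<^sub>R x)" using False by (intro u(2)) simp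
    also have "\<dots> = qf Q x / (norm x)\<^sup>2"
      by (simp add: qf_def matrix_vector_mult_scaleR power2_eq_square)
    finally show ?thesis using False by (simp add: field_simps)
  qed (simp add: qf_def)
  ultimately show ?thesis using that by blast
qed

lemma qf_upper: "\<exists>L\<ge>0. \<forall>x. \<bar>qf Q x\<bar> \<le> L * (norm x)\<^sup>2" for Q :: "real ^ 'n::finite ^ 'n"
proof -
  obtain L where L: "L > 0" "\<And>x. norm (Q *v x) \<le> norm x * L"
    using bounded_linear.pos_bounded[OF matrix_vector_mul_bounded_linear[of Q]] by blast
  have "\<bar>qf Q x\<bar> \<le> L * (norm x)\<^sup>2" for x
  proof -
    have "\<bar>qf Q x\<bar> \<le> norm x * norm (Q *v x)" unfolding qf_def by (rule Cauchy_Schwarz_ineq2)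
    also have "\<dots> \<le> norm x * (norm x * L)" using L(2) by (intro mult_left_mono) auto
    finally show ?thesis by (simp add: power2_eq_square mult.commute mult.left_commute)
  qed
  then show ?thesis using L(1) by (intro exI[of _ L]) auto
qed

lemma bary_sum_upper:
  assumes "det (vmat v) \<noteq> 0"
  shows "\<exists>A\<ge>0. \<forall>x. \<bar>\<Sum>k\<in>UNIV. bary v x $ k * q k\<bar> \<le> A * (1 + norm x)"
proof -
  obtain b c where bc: "\<And>x. (\<Sum>k\<in>UNIV. bary v x $ k * q k) = b \<bullet> x + c"
    using bary_affine[OF assms] by metis
  have "\<bar>b \<bullet> x + c\<bar> \<le> (norm b + \<bar>c\<bar>) * (1 + norm x)" for x
  proof -
    have "\<bar>b \<bullet> x + c\<bar> \<le> norm b * norm x + \<bar>c\<bar>"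
      using Cauchy_Schwarz_ineq2[of b x] by linarith
    also have "\<dots> \<le> (norm b + \<bar>c\<bar>) * (1 + norm x)" by (simp add: algebra_simps)
    finally show ?thesis .
  qed
  then show ?thesis unfolding bc by (intro exI[of _ "norm b + \<bar>c\<bar>"]) auto
qed

lemma one_plus_le: "1 + r \<le> 2 * (1 + r\<^sup>2)" for r :: real
proof -
  have "0 \<le> (r - 1)\<^sup>2" by simp
  then have "2 * r \<le> 1 + r\<^sup>2" by (simp add: power2_diff)
  moreover have "0 \<le> r\<^sup>2" by simp
  ultimately show ?thesis by argo
qed

lemma finite_bounded_int_vec: "finite {x :: int ^ 'n::finite. \<forall>i. \<bar>x $ i\<bar> \<le> K}"
proof (rule finite_subset)
  show "{x :: int ^ 'n. \<forall>i. \<bar>x $ i\<bar> \<le> K} \<subseteq> vec_lambda ` (Pi\<^sub>E UNIV (\<lambda>_. {-K..K}))"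
  proof
    fix x :: "int ^ 'n" assume "x \<in> {x. \<forall>i. \<bar>x $ i\<bar> \<le> K}"
    then have "vec_nth x \<in> Pi\<^sub>E UNIV (\<lambda>_. {-K..K})" by (auto simp: abs_le_iff) (metis minus_le_iff)
    then show "x \<in> vec_lambda ` (Pi\<^sub>E UNIV (\<lambda>_. {-K..K}))" by (metis image_eqI vec_nth_inverse)
  qed
qed (intro finite_imageI finite_PiE, auto)

lemma finite_norm_le: "finite {x :: int ^ 'n::finite. norm (real_vec x) \<le> R}"
proof (rule finite_subset)
  show "{x :: int ^ 'n. norm (real_vec x) \<le> R} \<subseteq> {x. \<forall>i. \<bar>x $ i\<bar> \<le> \<lceil>R\<rceil>}"
  proof
    fix x :: "int ^ 'n" assume "x \<in> {x. norm (real_vec x) \<le> R}"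
    then have "\<bar>real_of_int (x $ i)\<bar> \<le> R" for i
      using component_le_norm_cart[of "real_vec x" i] by (auto simp: real_vec_simps)
    then show "x \<in> {x. \<forall>i. \<bar>x $ i\<bar> \<le> \<lceil>R\<rceil>}" by (auto simp: le_ceiling_iff) (smt (verit) ceiling_mono ceiling_of_int of_int_abs)
  qed
qed (rule finite_bounded_int_vec)

text \<open>Within radius \<open>R\<close> there are finitely many lattice points, and beyond it the
  quadratic term dominates. A bound that is uniform over all lattice points is what later permits a
  positive step in the parameter.\<close>

lemma positive_lower:
  fixes h :: "real ^ 'n::finite \<Rightarrow> real"
  assumes "c > 0" "A \<ge> 0" "\<And>x. h x \<ge> c * (norm x)\<^sup>2 - A * (1 + norm x)"
  shows "\<exists>c'>0. \<forall>x. h (real_vec x) > 0 \<longrightarrow> h (real_vec x) \<ge> c' * (1 + (norm (real_vec x))\<^sup>2)"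
proof -
  \<comment> \<open>Beyond \<open>R\<close> the norm \<open>r\<close> satisfies
    \<open>c r \<ge> 4 A + c\<close>, so half of \<open>c (1 + r^2)\<close> remains after
    subtracting \<open>A (1 + r)\<close> from \<open>c r^2\<close>.\<close>
  define R where "R = 1 + (4 * A + c) / c"
  define S where "S = {x :: int ^ 'n. norm (real_vec x) \<le> R \<and> h (real_vec x) > 0}"
  have "finite S" unfolding S_def by (rule finite_subset[OF _ finite_norm_le[of R]]) auto
  define c' where "c' = Min (insert (c / 2) ((\<lambda>x. h (real_vec x) / (1 + (norm (real_vec x))\<^sup>2)) ` S))"
  have pos1: "1 + (norm x)\<^sup>2 > 0" for x :: "real ^ 'n" by (smt (verit) zero_le_power2)
  have "c' > 0" unfolding c'_def using \<open>finite S\<close> assms(1) pos1 by (auto simp: S_def)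
  moreover have "h (real_vec x) \<ge> c' * (1 + (norm (real_vec x))\<^sup>2)" if "h (real_vec x) > 0" for x
  proof (cases "norm (real_vec x) \<le> R")
    case True
    then have "c' \<le> h (real_vec x) / (1 + (norm (real_vec x))\<^sup>2)"
      unfolding c'_def using \<open>finite S\<close> that by (intro Min_le) (auto simp: S_def)
    then show ?thesis using pos1[of "real_vec x"] by (simp add: pos_le_divide_eq)
  next
    case False
    define r where "r = norm (real_vec x)"
    have r: "r > 1 + (4 * A + c) / c" using False by (simp add: r_def R_def)
    have "(4 * A + c) / c \<ge> 0" using assms by simp
    then have r1: "r > 1" using r by linarith
    have "c * r \<ge> 4 * A + c" using r assms(1) by (simp add: field_simps)
    then have "c * r * r \<ge> (4 * A + c) * r" using r1 by (intro mult_right_mono) auto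
    then have "c * r * r \<ge> 4 * (A * r) + c * r" by (simp add: algebra_simps)
    moreover have "A \<le> A * r" "c \<le> c * r"
      using r1 assms mult_left_mono[of 1 r A] mult_left_mono[of 1 r c] by auto
    moreover have "X - A - Y \<ge> c / 2 + X / 2" if "X \<ge> 4 * Y + Z" "A \<le> Y" "c \<le> Z" for X Y Z
      using that assms(2) by linarith
    ultimately have "c * r * r - A - A * r \<ge> c / 2 + c * r * r / 2" by blast
    then have "c * r\<^sup>2 - A * (1 + r) \<ge> (c / 2) * (1 + r\<^sup>2)"
      by (simp add: power2_eq_square distrib_left diff_diff_eq mult.assoc)
    moreover have "c' \<le> c / 2" unfolding c'_def using \<open>finite S\<close> by (intro Min_le) auto
    then have "c' * (1 + r\<^sup>2) \<le> (c / 2) * (1 + r\<^sup>2)"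
      using pos1[of "real_vec x"] by (intro mult_right_mono) (auto simp: r_def)
    ultimately show ?thesis using assms(3)[of "real_vec x"] by (simp add: r_def)
  qed
  ultimately show ?thesis by blast
qed

lemma vmat_update: "vmat (v(k := x)) = replace_column (vmat v) k (hom x)"
  by (simp add: vmat_def replace_column_def vec_eq_iff)

lemma det_vmat_update:
  assumes "det (vmat v) \<noteq> 0"
  shows "of_int (det (vmat (v(k := x)))) = bary v (real_vec x) $ k * of_int (det (vmat v))"
  unfolding vmat_update
  using mult_bary[OF assms, of "bary v (real_vec x)" "real_vec x"]
  by (intro det_replace_column) (simp add: real_vec_hom)

text \<open>The two affine interpolants agree at the retained vertices, so they differ by a multiple
  of coordinate \<open>k\<close>; the gap at \<open>x\<close> determines the multiple.\<close>

lemma interp_gap_update: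
  assumes "det (vmat v) \<noteq> 0" "bary v (real_vec x) $ k \<noteq> 0"
  shows "interp_gap Q (v(k := x)) y =
    interp_gap Q v y - interp_gap Q v (real_vec x) / bary v (real_vec x) $ k * bary v y $ k"
proof -
  let ?v = "v(k := x)" and ?s = "interp_gap Q v (real_vec x) / bary v (real_vec x) $ k"
  have d: "det (vmat ?v) \<noteq> 0"
    using det_vmat_update[OF assms(1), of k x] assms by auto
  define A where "A y = (\<Sum>i\<in>UNIV. bary v y $ i * qf Q (real_vec (v i))) + ?s * bary v y $ k" for y
  have vert: "A (real_vec (?v j)) = qf Q (real_vec (?v j))" for j
  proof (cases "j = k")
    case True
    then show ?thesis using assms(2) by (simp add: A_def interp_gap_def)
  next
    case False
    then show ?thesis by (simp add: A_def bary_vertex[OF assms(1)] sum_axis_mult) (simp add: axis_def)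
  qed
  have "y = (\<Sum>j\<in>UNIV. bary ?v y $ j *\<^sub>R real_vec (?v j))" using bary_sum[OF d] by simp
  then have b: "bary v y = (\<Sum>j\<in>UNIV. bary ?v y $ j *\<^sub>R bary v (real_vec (?v j)))"
    using bary_combination[OF assms(1), of UNIV "\<lambda>j. bary ?v y $ j" "\<lambda>j. real_vec (?v j)"]
      bary_sum(1)[OF d, of y] by simp
  have "A y = (\<Sum>j\<in>UNIV. bary ?v y $ j * A (real_vec (?v j)))"
  proof -
    have "(\<Sum>i\<in>UNIV. bary v y $ i * qf Q (real_vec (v i))) =
        (\<Sum>j\<in>UNIV. bary ?v y $ j * (\<Sum>i\<in>UNIV. bary v (real_vec (?v j)) $ i * qf Q (real_vec (v i))))"
      unfolding b[unfolded vec_eq_iff, rule_format] by (simp add: sum_distrib_left sum_distrib_right mult.assoc) (rule sum.swap)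
    moreover have "bary v y $ k = (\<Sum>j\<in>UNIV. bary ?v y $ j * bary v (real_vec (?v j)) $ k)"
      by (subst b) simp
    ultimately show ?thesis
      by (simp add: A_def distrib_left sum.distrib sum_distrib_left mult.left_commute)
  qed
  also have "\<dots> = (\<Sum>j\<in>UNIV. bary ?v y $ j * qf Q (real_vec (?v j)))" by (simp only: vert)
  finally show ?thesis by (simp add: A_def interp_gap_def)
qed

text \<open>In homogeneous coordinates a translation is the shear \<open>T\<close> of determinant
  1.\<close>

lemma translate_vmat:
  assumes "det (vmat v) \<noteq> 0"
  shows "det (vmat (\<lambda>k. v k - z)) = det (vmat v)" "bary (\<lambda>k. v k - z) (y - real_vec z) = bary v y"
proof -
  define T where "T = replace_column (mat 1) None (hom (- z))"
  have T: "(\<Sum>k\<in>UNIV. T $ r $ k * f k) = (case r of None \<Rightarrow> f None | Some i \<Rightarrow> f (Some i) - z $ i * f None)"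
    for r and f :: "'a option \<Rightarrow> int"
  proof -
    have "T $ r $ k * f k = (if k = None then hom (- z) $ r * f None else if k = r then f k else 0)" for k
      by (auto simp: T_def replace_column_def mat_def)
    then have "(\<Sum>k\<in>UNIV. T $ r $ k * f k) = hom (- z) $ r * f None + (\<Sum>i\<in>UNIV. if Some i = r then f (Some i) else 0)"
      by (simp add: sum_option cong: if_cong)
    then show ?thesis by (cases r) auto
  qed
  have "det T = 1"
  proof -
    have "of_int (det T) = (hom (- real_vec z) :: real ^ 'a option) $ None * of_int (det (mat 1 :: int ^ 'a option ^ 'a option))"
      unfolding T_def by (rule det_replace_column)
        (auto simp: vec_eq_iff real_vec_def hom_def real_mat_def matrix_vector_mult_def mat_def if_distrib if_distribR cong: if_cong split: option.split)
    then show ?thesis by simp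
  qed
  moreover have "vmat (\<lambda>k. v k - z) = T ** vmat v"
    by (simp add: vec_eq_iff matrix_matrix_mult_def T vmat_def hom_def split: option.split)
  ultimately show d: "det (vmat (\<lambda>k. v k - z)) = det (vmat v)" by (simp add: det_mul)
  have "(\<Sum>k\<in>UNIV. bary v y $ k *\<^sub>R real_vec (v k - z)) = y - real_vec z"
    using bary_sum[OF assms, of y]
    by (simp add: real_vec_simps scaleR_diff_right sum_subtractf flip: scaleR_left.sum)
  then have "bary v y = bary (\<lambda>k. v k - z) (y - real_vec z)"
    using bary_eq_iff[of "\<lambda>k. v k - z" "bary v y" "y - real_vec z"] bary_sum(1)[OF assms] d assms by simp
  then show "bary (\<lambda>k. v k - z) (y - real_vec z) = bary v y" by simp
qed

lemma translate_empty_sphere: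
  assumes "transpose Q = Q" "empty_sphere Q v"
  shows "empty_sphere Q (\<lambda>k. v k - z)"
  unfolding empty_sphere_def
proof (intro conjI allI impI)
  have d: "det (vmat v) \<noteq> 0" using assms(2) by (simp add: empty_sphere_def)
  then show d': "det (vmat (\<lambda>k. v k - z)) \<noteq> 0" by (simp add: translate_vmat)
  fix x assume "x \<notin> range (\<lambda>k. v k - z)"
  then have "x + z \<notin> range v" by (metis (no_types, lifting) add_diff_cancel_right' image_iff rangeI)
  then have "interp_gap Q v (real_vec (x + z)) > 0" using assms(2) by (simp add: empty_sphere_def)
  moreover have "bary (\<lambda>k. v k - z) (real_vec x) = bary v (real_vec (x + z))"
    using translate_vmat(2)[OF d, of z "real_vec (x + z)"] by (simp add: real_vec_simps)
  ultimately show "interp_gap Q (\<lambda>k. v k - z) (real_vec x) > 0"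
    unfolding interp_gap_eq[OF assms(1) d'] interp_gap_eq[OF assms(1) d] by (simp add: real_vec_simps)
qed

text \<open>The lattice points \<open>v l + u\<close> and \<open>v k - u\<close> have the same
  midpoint as \<open>v l\<close> and \<open>v k\<close>, so the affine parts cancel when their gaps
  are added. By the parallelogram law this is Voronoi's property that an edge is a shortest vector
  in its coset modulo twice the lattice.\<close>

lemma weakly_empty_norm:
  assumes "transpose Q = Q" "det (vmat v) \<noteq> 0" "\<And>x. interp_gap Q v (real_vec x) \<ge> 0"
  shows "qf Q (real_vec (v k - v l)) \<le> qf Q (real_vec u) + qf Q (real_vec (v k - v l - u))"
proof -
  let ?x = "real_vec (v l + u)" and ?y = "real_vec (v k - u)"
  have "?x + ?y - real_vec (v l) = real_vec (v k)" by (simp add: real_vec_simps)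
  then have "bary v (real_vec (v k)) = bary v ?x + bary v ?y - bary v (real_vec (v l))"
    using bary_line[OF assms(2), of ?x ?y "real_vec (v l)"] by simp
  then have b: "bary v ?x = axis k 1 + axis l 1 - bary v ?y" by (simp add: bary_vertex[OF assms(2)] algebra_simps)
  have "(\<Sum>i\<in>UNIV. bary v ?x $ i * qf Q (real_vec (v i))) + (\<Sum>i\<in>UNIV. bary v ?y $ i * qf Q (real_vec (v i)))
      = qf Q (real_vec (v k)) + qf Q (real_vec (v l))"
    unfolding b by (simp add: left_diff_distrib distrib_right sum.distrib sum_subtractf sum_axis_mult)
  then have "qf Q ?x + qf Q ?y \<ge> qf Q (real_vec (v k)) + qf Q (real_vec (v l))"
    using assms(3)[of "v l + u"] assms(3)[of "v k - u"] by (simp add: interp_gap_def)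
  moreover have "qf Q ?x + qf Q ?y - qf Q (real_vec (v k)) - qf Q (real_vec (v l)) =
      qf Q (real_vec u) + qf Q (real_vec (v k - v l - u)) - qf Q (real_vec (v k - v l))"
    using inner_symmetric[OF assms(1)]
    by (simp add: real_vec_simps qf_def matrix_vector_right_distrib matrix_vector_mult_diff_distrib
        inner_add_left inner_add_right inner_diff_left inner_diff_right)
  ultimately show ?thesis by linarith
qed

text \<open>Taking \<open>u\<close> as a unit vector or its negative bounds the entries of
  \<open>Q w\<close> by the diagonal of \<open>Q\<close>. The bound depends on \<open>Q\<close> only
  through \<open>c\<close> and the diagonal, hence is uniform along a segment of forms.\<close>

lemma weakly_empty_bounded:
  assumes "transpose Q = Q" "det (vmat v) \<noteq> 0" "\<And>x. interp_gap Q v (real_vec x) \<ge> 0"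
    "c > 0" "\<And>x. c * (norm x)\<^sup>2 \<le> qf Q x"
  shows "norm (real_vec (v k - v l)) \<le> (\<Sum>i\<in>UNIV. \<bar>Q $ i $ i\<bar>) / c"
proof -
  define w where "w = real_vec (v k - v l)"
  have qa: "qf Q (real_vec (axis i s)) = of_int s * of_int s * Q $ i $ i" for i s
  proof -
    have "real_vec (axis i s) = of_int s *\<^sub>R axis i 1" by (simp add: real_vec_def vec_eq_iff axis_def)
    then show ?thesis
      by (simp add: qf_def matrix_vector_mult_scaleR matrix_vector_mult_basis column_def inner_axis' )
  qed
  have comp: "\<bar>(Q *v w) $ i\<bar> \<le> \<bar>Q $ i $ i\<bar>" for i
  proof -
    have "2 * (of_int s * (Q *v w) $ i) \<le> 2 * Q $ i $ i" if "s = 1 \<or> s = -1" for s :: int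
    proof -
      have r: "real_vec (axis i s) = of_int s *\<^sub>R axis i 1" by (simp add: real_vec_def vec_eq_iff axis_def)
      have "qf Q w \<le> qf Q (real_vec (axis i s)) + qf Q (w - real_vec (axis i s))"
        using weakly_empty_norm[OF assms(1-3), of k l "axis i s"] by (simp add: w_def real_vec_simps)
      then have "2 * (w \<bullet> (Q *v real_vec (axis i s))) \<le> 2 * qf Q (real_vec (axis i s))"
        by (simp add: qf_diff[OF assms(1)])
      moreover have "w \<bullet> (Q *v real_vec (axis i s)) = of_int s * (Q *v w) $ i"
        unfolding inner_symmetric[OF assms(1), of w] r by (simp add: inner_axis')
      moreover have "qf Q (real_vec (axis i s)) = Q $ i $ i" using that by (auto simp: qa)
      ultimately show ?thesis by linarith
    qed
    from this[of 1] this[of "-1"] show ?thesis by auto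
  qed
  have "c * (norm w)\<^sup>2 \<le> qf Q w" by (rule assms(5))
  also have "\<dots> \<le> (\<Sum>i\<in>UNIV. norm w * \<bar>Q $ i $ i\<bar>)"
    unfolding qf_def inner_vec_def
  proof (rule sum_mono)
    fix i
    have "w $ i \<bullet> (Q *v w) $ i \<le> \<bar>w $ i\<bar> * \<bar>(Q *v w) $ i\<bar>" by (simp flip: abs_mult)
    also have "\<dots> \<le> norm w * \<bar>Q $ i $ i\<bar>"
      using comp component_le_norm_cart[of w i] by (intro mult_mono) auto
    finally show "w $ i \<bullet> (Q *v w) $ i \<le> norm w * \<bar>Q $ i $ i\<bar>" .
  qed
  finally have le: "c * (norm w)\<^sup>2 \<le> norm w * (\<Sum>i\<in>UNIV. \<bar>Q $ i $ i\<bar>)" by (simp add: sum_distrib_left)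
  show ?thesis
  proof (cases "norm w = 0")
    case True
    then show ?thesis using assms(4) by (simp add: w_def sum_nonneg)
  next
    case False
    then have "norm w > 0" by simp
    then have "c * norm w \<le> (\<Sum>i\<in>UNIV. \<bar>Q $ i $ i\<bar>)"
      using le by (simp add: power2_eq_square mult.left_commute)
    then show ?thesis using assms(4) by (simp add: w_def field_simps)
  qed
qed

section \<open>Flips\<close>

lemma interp_gap_path:
  "interp_gap ((1 - t) *\<^sub>R Q0 + t *\<^sub>R Q1) v x = (1 - t) * interp_gap Q0 v x + t * interp_gap Q1 v x"
proof -
  have q: "qf ((1 - t) *\<^sub>R Q0 + t *\<^sub>R Q1) x = (1 - t) * qf Q0 x + t * qf Q1 x" for x
    by (simp add: qf_def matrix_vector_mult_add_rdistrib scaleR_matrix_vector_assoc[symmetric] inner_add_right)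
  show ?thesis
    unfolding interp_gap_def q by (simp add: algebra_simps sum.distrib sum_distrib_left sum_subtractf)
qed

text \<open>Move the quadratic form along a segment and look at the last parameter at which a simplex
  of index at least \<open>M\<close> is Delaunay. If only one further lattice point \<open>x\<close> is then on the sphere of
  the simplex, replacing a vertex by \<open>x\<close> yields simplices that are Delaunay afterwards, hence of
  index less than \<open>M\<close>.\<close>

lemma flip:
  fixes Q0 Q1 :: "real ^ 'n::finite ^ 'n"
  defines "Qt \<equiv> \<lambda>t. (1 - t) *\<^sub>R Q0 + t *\<^sub>R Q1"
  assumes Q: "posdef Q0" "posdef Q1" and v0: "empty_sphere Q0 v0" "M \<le> \<bar>det (vmat v0)\<bar>" and M: "M > 0"
    and final: "\<And>v :: 'n option \<Rightarrow> int ^ 'n. det (vmat v) \<noteq> 0 \<Longrightarrow> (\<And>x. interp_gap Q1 v (real_vec x) \<ge> 0) \<Longrightarrow> \<bar>det (vmat v)\<bar> < M"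
    and generic: "\<And>v t x y. det (vmat v) \<noteq> 0 \<Longrightarrow> x \<notin> range v \<Longrightarrow> y \<notin> range v \<Longrightarrow> 0 < t \<Longrightarrow> t \<le> 1 \<Longrightarrow>
      interp_gap (Qt t) v (real_vec x) = 0 \<Longrightarrow> interp_gap (Qt t) v (real_vec y) = 0 \<Longrightarrow> x = y"
  shows "\<exists>Q (v :: 'n option \<Rightarrow> int ^ 'n) x. posdef Q \<and> empty_sphere Q v \<and> M \<le> \<bar>det (vmat v)\<bar> \<and> x \<notin> range v \<and>
    (\<forall>k. of_int \<bar>det (vmat v)\<bar> * bary v (real_vec x) $ k < of_int M)"
proof -
  obtain c0 where c0: "c0 > 0" "\<And>x. c0 * (norm x)\<^sup>2 \<le> qf Q0 x" using posdef_lower[OF Q(1)] by blast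
  obtain c1 where c1: "c1 > 0" "\<And>x. c1 * (norm x)\<^sup>2 \<le> qf Q1 x" using posdef_lower[OF Q(2)] by blast
  define c where "c = min c0 c1"
  have c: "c > 0" using c0 c1 by (simp add: c_def)
  have qft: "qf (Qt t) x = (1 - t) * qf Q0 x + t * qf Q1 x" for t x
    by (simp add: Qt_def qf_def matrix_vector_mult_add_rdistrib scaleR_matrix_vector_assoc[symmetric] inner_add_right)
  have low: "c * (norm x)\<^sup>2 \<le> qf (Qt t) x" if "0 \<le> t" "t \<le> 1" for t x
  proof -
    have "c * (norm x)\<^sup>2 = (1 - t) * (c * (norm x)\<^sup>2) + t * (c * (norm x)\<^sup>2)" by (simp add: algebra_simps)
    also have "\<dots> \<le> (1 - t) * qf Q0 x + t * qf Q1 x"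
    proof (intro add_mono mult_left_mono)
      have "c * (norm x)\<^sup>2 \<le> c0 * (norm x)\<^sup>2" "c * (norm x)\<^sup>2 \<le> c1 * (norm x)\<^sup>2"
        by (intro mult_right_mono; simp add: c_def)+
      then show "c * (norm x)\<^sup>2 \<le> qf Q0 x" "c * (norm x)\<^sup>2 \<le> qf Q1 x"
        using c0(2)[of x] c1(2)[of x] by linarith+
    qed (use that in auto)
    finally show ?thesis by (simp add: qft)
  qed
  have sym: "transpose (Qt t) = Qt t" for t
  proof -
    have "transpose (Qt t) = (1 - t) *\<^sub>R transpose Q0 + t *\<^sub>R transpose Q1"
      by (simp add: Qt_def vec_eq_iff transpose_def)
    then show ?thesis using Q by (simp add: posdef_def Qt_def)
  qed
  have pd: "posdef (Qt t)" if "0 \<le> t" "t \<le> 1" for t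
    unfolding posdef_def
  proof (intro conjI allI impI sym)
    fix x :: "real ^ 'n" assume "x \<noteq> 0"
    then have "0 < c * (norm x)\<^sup>2" using c by simp
    then show "0 < qf (Qt t) x" using low[OF that, of x] by linarith
  qed
  have gap: "interp_gap (Qt t) v x = (1 - t) * interp_gap Q0 v x + t * interp_gap Q1 v x" for t v x
    unfolding Qt_def by (rule interp_gap_path)
  define V where "V v = {t \<in> {0..1}. empty_sphere (Qt t) v \<and> M \<le> \<bar>det (vmat v)\<bar>}" for v
  define T where "T = (\<Union>v. V v)"
  \<comment> \<open>A common bound for the edges of all Delaunay simplices along the segment. With
    one vertex translated to the origin only finitely many simplices remain.\<close>
  define K where "K = (\<Sum>i\<in>UNIV. \<bar>Q0 $ i $ i\<bar> + \<bar>Q1 $ i $ i\<bar>) / c"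
  define N where "N = {v :: 'n option \<Rightarrow> int ^ 'n. \<forall>k. norm (real_vec (v k)) \<le> K}"
  have "finite N"
  proof -
    have "N = Pi\<^sub>E UNIV (\<lambda>_. {x. norm (real_vec x) \<le> K})" by (auto simp: N_def)
    then show ?thesis by (simp add: finite_PiE finite_norm_le)
  qed
  have TN: "T \<subseteq> (\<Union>v\<in>N. V v)"
  proof
    fix t assume "t \<in> T"
    then obtain v where v: "t \<in> V v" by (auto simp: T_def)
    then have t: "0 \<le> t" "t \<le> 1" and e: "empty_sphere (Qt t) v" "M \<le> \<bar>det (vmat v)\<bar>" by (auto simp: V_def)
    have d: "det (vmat v) \<noteq> 0" using e by (simp add: empty_sphere_def)
    have "interp_gap (Qt t) v (real_vec x) \<ge> 0" for x
    proof (cases "x \<in> range v")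
      case True
      then show ?thesis using interp_gap_vertex[OF d] by auto
    next
      case False
      then have "interp_gap (Qt t) v (real_vec x) > 0" using e(1) unfolding empty_sphere_def by blast
      then show ?thesis by simp
    qed
    then have "norm (real_vec (v k - v None)) \<le> (\<Sum>i\<in>UNIV. \<bar>Qt t $ i $ i\<bar>) / c" for k
      using weakly_empty_bounded[OF sym d _ c low[OF t]] by blast
    moreover have "(\<Sum>i\<in>UNIV. \<bar>Qt t $ i $ i\<bar>) / c \<le> K"
      unfolding K_def
    proof (intro divide_right_mono sum_mono)
      fix i
      have "\<bar>Qt t $ i $ i\<bar> \<le> \<bar>(1 - t) * Q0 $ i $ i\<bar> + \<bar>t * Q1 $ i $ i\<bar>"
        by (simp add: Qt_def)
      also have "\<dots> \<le> \<bar>Q0 $ i $ i\<bar> + \<bar>Q1 $ i $ i\<bar>"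
        using t by (intro add_mono) (auto simp: abs_mult mult_left_le_one_le)
      finally show "\<bar>Qt t $ i $ i\<bar> \<le> \<bar>Q0 $ i $ i\<bar> + \<bar>Q1 $ i $ i\<bar>" .
    qed (use c in simp)
    ultimately have "(\<lambda>k. v k - v None) \<in> N" unfolding N_def using order_trans by blast
    moreover have "t \<in> V (\<lambda>k. v k - v None)"
      using t e translate_empty_sphere[OF sym e(1)] translate_vmat(1)[OF d] by (simp add: V_def)
    ultimately show "t \<in> (\<Union>v\<in>N. V v)" by blast
  qed
  have "Qt 0 = Q0" "Qt 1 = Q1" by (simp_all add: Qt_def)
  then have "0 \<in> T" using v0 by (auto simp: T_def V_def)
  have T1: "t \<le> 1" if "t \<in> T" for t using that by (auto simp: T_def V_def)
  then have bdd: "bdd_above T" by (rule bdd_aboveI)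
  define \<tau> where "\<tau> = Sup T"
  have le: "t \<le> \<tau>" if "t \<in> T" for t unfolding \<tau>_def using that bdd by (rule cSup_upper)
  have "T \<noteq> {}" using \<open>0 \<in> T\<close> by blast
  have \<tau>: "0 \<le> \<tau>" "\<tau> \<le> 1"
    using le[OF \<open>0 \<in> T\<close>] cSup_least[OF \<open>T \<noteq> {}\<close> T1] by (simp_all add: \<tau>_def)
  have "\<tau> \<in> closure T" unfolding \<tau>_def by (rule closure_contains_Sup[OF \<open>T \<noteq> {}\<close> bdd])
  then have "\<tau> \<in> closure (\<Union>v\<in>N. V v)" using closure_mono[OF TN] by blast
  \<comment> \<open>Closure commutes with the finite union, so a single simplex \<open>v\<close>
    belongs to parameters that are equal or arbitrarily close to the supremum.\<close>
  also have "\<dots> = (\<Union>v\<in>N. closure (V v))" using \<open>finite N\<close> by (induction N) auto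
  finally obtain v where v: "\<tau> \<in> closure (V v)" by blast
  then have "V v \<noteq> {}" by auto
  then have vM: "M \<le> \<bar>det (vmat v)\<bar>" and d: "det (vmat v) \<noteq> 0" by (auto simp: V_def empty_sphere_def)
  have vx: "interp_gap (Qt t) v (real_vec (v k)) = 0" for t k by (rule interp_gap_vertex[OF d])
  have nonneg: "interp_gap (Qt \<tau>) v (real_vec x) \<ge> 0" for x
  proof -
    have "closed {t. 0 \<le> interp_gap (Qt t) v (real_vec x)}"
      unfolding gap by (intro closed_Collect_le continuous_intros)
    moreover have "V v \<subseteq> {t. 0 \<le> interp_gap (Qt t) v (real_vec x)}"
    proof
      fix t assume "t \<in> V v"
      then have e: "empty_sphere (Qt t) v" by (simp add: V_def)
      show "t \<in> {t. 0 \<le> interp_gap (Qt t) v (real_vec x)}"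
      proof (cases "x \<in> range v")
        case True
        then show ?thesis using vx by auto
      next
        case False
        then have "interp_gap (Qt t) v (real_vec x) > 0" using e unfolding empty_sphere_def by blast
        then show ?thesis by simp
      qed
    qed
    ultimately show ?thesis using v closure_minimal by blast
  qed
  have "\<tau> \<noteq> 1" using final[OF d] nonneg vM \<open>Qt 1 = Q1\<close> by fastforce
  then have "\<tau> < 1" using \<tau> by simp
  obtain t0 where t0: "t0 \<in> V v" using \<open>V v \<noteq> {}\<close> by blast
  define \<Delta> where "\<Delta> x = interp_gap Q1 v x - interp_gap Q0 v x" for x
  have shift: "interp_gap (Qt (\<tau> + s)) v x = interp_gap (Qt \<tau>) v x + s * \<Delta> x" for s x
    unfolding gap by (simp add: \<Delta>_def algebra_simps)
  obtain A where A: "A \<ge> 0" "\<And>x. \<bar>\<Sum>k\<in>UNIV. bary v x $ k * qf (Qt \<tau>) (real_vec (v k))\<bar> \<le> A * (1 + norm x)"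
    using bary_sum_upper[OF d] by metis
  have "interp_gap (Qt \<tau>) v x \<ge> c * (norm x)\<^sup>2 - A * (1 + norm x)" for x
    using low[OF \<tau>, of x] A(2)[of x] by (simp add: interp_gap_def abs_le_iff)
  then obtain c' where c': "c' > 0"
    "\<And>x. interp_gap (Qt \<tau>) v (real_vec x) > 0 \<Longrightarrow> interp_gap (Qt \<tau>) v (real_vec x) \<ge> c' * (1 + (norm (real_vec x))\<^sup>2)"
    using positive_lower[OF c A(1), of "interp_gap (Qt \<tau>) v"] by blast
  have bound: "\<exists>B>0. \<forall>x. \<bar>\<Delta> x + u * bary v x $ k\<bar> \<le> B * (1 + (norm x)\<^sup>2)" for u k
  proof -
    obtain L0 where L0: "L0 \<ge> 0" "\<And>x. \<bar>qf Q0 x\<bar> \<le> L0 * (norm x)\<^sup>2" using qf_upper by blast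
    obtain L1 where L1: "L1 \<ge> 0" "\<And>x. \<bar>qf Q1 x\<bar> \<le> L1 * (norm x)\<^sup>2" using qf_upper by blast
    define q where "q i = qf Q0 (real_vec (v i)) - qf Q1 (real_vec (v i)) + u * axis k 1 $ i" for i
    obtain C where C: "C \<ge> 0" "\<And>x. \<bar>\<Sum>k\<in>UNIV. bary v x $ k * q k\<bar> \<le> C * (1 + norm x)"
      using bary_sum_upper[OF d] by metis
    have "\<bar>\<Delta> x + u * bary v x $ k\<bar> \<le> (L0 + L1 + 2 * C + 1) * (1 + (norm x)\<^sup>2)" for x
    proof -
      have "(\<Sum>i\<in>UNIV. bary v x $ i * (u * axis k 1 $ i)) = u * (\<Sum>i\<in>UNIV. axis k 1 $ i * bary v x $ i)"
        by (simp add: sum_distrib_left ac_simps)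
      then have "\<Delta> x + u * bary v x $ k = qf Q1 x - qf Q0 x + (\<Sum>k\<in>UNIV. bary v x $ k * q k)"
        unfolding q_def \<Delta>_def interp_gap_def distrib_left sum.distrib
        by (simp add: sum_axis_mult right_diff_distrib sum_subtractf)
      then have "\<bar>\<Delta> x + u * bary v x $ k\<bar> \<le> L1 * (norm x)\<^sup>2 + L0 * (norm x)\<^sup>2 + C * (1 + norm x)"
        using L0(2)[of x] L1(2)[of x] C(2)[of x] by linarith
      also have "C * (1 + norm x) \<le> C * (2 * (1 + (norm x)\<^sup>2))"
        using C(1) one_plus_le by (rule mult_left_mono[rotated])
      finally show ?thesis using L0(1) L1(1) by (simp add: algebra_simps) (smt (verit) zero_le_power2)
    qed
    then show ?thesis using L0(1) L1(1) C(1) by (intro exI[of _ "L0 + L1 + 2 * C + 1"]) auto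
  qed
  \<comment> \<open>Positive gaps stay positive for a short time, for all lattice points at once:
    the gap at \<tau> is bounded below, and the change bounded above, by multiples of one plus the
    squared norm. The term with \<open>u\<close> anticipates the exchange of vertex
    \<open>k\<close>.\<close>
  have later: "\<exists>s>0. \<tau> + s \<le> 1 \<and> (\<forall>x. interp_gap (Qt \<tau>) v (real_vec x) > 0 \<longrightarrow>
      interp_gap (Qt (\<tau> + s)) v (real_vec x) + s * (u * bary v (real_vec x) $ k) > 0)" for u k
  proof -
    obtain B where B: "B > 0" "\<And>x. \<bar>\<Delta> x + u * bary v x $ k\<bar> \<le> B * (1 + (norm x)\<^sup>2)"
      using bound by blast
    define s where "s = min (1 - \<tau>) (c' / (2 * B))"
    have s: "s > 0" "\<tau> + s \<le> 1" "s * B < c'"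
    proof -
      show "s > 0" "\<tau> + s \<le> 1" using \<open>\<tau> < 1\<close> B(1) c'(1) by (auto simp: s_def)
      have "s * B \<le> c' / (2 * B) * B" using B(1) by (intro mult_right_mono) (auto simp: s_def)
      then show "s * B < c'" using B(1) c'(1) by simp
    qed
    have "interp_gap (Qt (\<tau> + s)) v (real_vec x) + s * (u * bary v (real_vec x) $ k) > 0"
      if "interp_gap (Qt \<tau>) v (real_vec x) > 0" for x
    proof -
      let ?n = "1 + (norm (real_vec x))\<^sup>2"
      have n: "?n > 0" by (smt (verit) zero_le_power2)
      have "s * (\<Delta> (real_vec x) + u * bary v (real_vec x) $ k) \<ge> s * (- (B * ?n))"
        using s(1) B(2)[of "real_vec x"] by (intro mult_left_mono) (auto simp: abs_le_iff)
      moreover have "s * B * ?n < c' * ?n" using s(3) n by simp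
      ultimately show ?thesis
        using c'(2)[OF that] unfolding shift by (simp add: algebra_simps)
    qed
    then show ?thesis using s by blast
  qed
  \<comment> \<open>With no further lattice point on the sphere, \<open>v\<close> would remain
    Delaunay beyond the supremum.\<close>
  obtain x where x: "x \<notin> range v" "interp_gap (Qt \<tau>) v (real_vec x) = 0"
  proof (rule ccontr)
    assume "\<not> thesis"
    then have pos: "interp_gap (Qt \<tau>) v (real_vec x) > 0" if "x \<notin> range v" for x
      using nonneg that \<open>\<not> thesis\<close> \<open>\<And>x. \<lbrakk>x \<notin> range v; interp_gap (Qt \<tau>) v (real_vec x) = 0\<rbrakk> \<Longrightarrow> thesis\<close>
      by (metis less_eq_real_def)
    obtain s where s: "s > 0" "\<tau> + s \<le> 1"
      "\<And>x. interp_gap (Qt \<tau>) v (real_vec x) > 0 \<Longrightarrow> interp_gap (Qt (\<tau> + s)) v (real_vec x) > 0"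
      using later[of 0] by auto
    then have "empty_sphere (Qt (\<tau> + s)) v" using pos d by (simp add: empty_sphere_def)
    then have "\<tau> + s \<in> T" using s(1,2) \<tau> vM by (auto simp: T_def V_def)
    then show False using le s(1) by fastforce
  qed
  have t0': "0 \<le> t0" "t0 \<le> 1" "empty_sphere (Qt t0) v" using t0 by (auto simp: V_def)
  have "interp_gap (Qt t0) v (real_vec x) > 0" using t0'(3) x(1) by (simp add: empty_sphere_def)
  then have "t0 \<noteq> \<tau>" using x(2) by auto
  moreover have "t0 \<le> \<tau>" using le t0 by (auto simp: T_def)
  ultimately have "t0 < \<tau>" by simp
  \<comment> \<open>The gap at \<open>x\<close> is affine in the parameter, positive at
    \<open>t0\<close> and zero at the later parameter \<tau>.\<close>
  have \<Delta>x: "\<Delta> (real_vec x) < 0"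
  proof -
    have "interp_gap (Qt t0) v (real_vec x) = (t0 - \<tau>) * \<Delta> (real_vec x)"
      using shift[of "t0 - \<tau>" "real_vec x"] x(2) by simp
    then have "(t0 - \<tau>) * \<Delta> (real_vec x) > 0" using \<open>interp_gap (Qt t0) v (real_vec x) > 0\<close> by simp
    then show ?thesis using \<open>t0 < \<tau>\<close> by (simp add: zero_less_mult_iff)
  qed
  have unique: "interp_gap (Qt \<tau>) v (real_vec y) > 0" if "y \<notin> range v" "y \<noteq> x" for y
    using generic[OF d that(1) x(1), of \<tau>] x(2) that(2) nonneg[of y] \<open>t0 < \<tau>\<close> t0'(1) \<tau>(2)
    by (fastforce simp: less_eq_real_def)
  have small: "of_int \<bar>det (vmat v)\<bar> * bary v (real_vec x) $ k < of_int M" for k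
  proof (rule ccontr)
    assume neg: "\<not> ?thesis"
    let ?l = "bary v (real_vec x) $ k"
    have l: "?l > 0"
    proof (rule ccontr)
      assume "\<not> ?l > 0"
      then have "of_int \<bar>det (vmat v)\<bar> * ?l \<le> 0" by (intro mult_nonneg_nonpos) auto
      moreover have "(0 :: real) < of_int M" using M by simp
      ultimately show False using neg by linarith
    qed
    \<comment> \<open>The value of \<open>u\<close> that turns the expression in
      \<open>later\<close> into the gap of the new simplex, by
      \<open>interp_gap_update\<close>.\<close>
    let ?v = "v(k := x)" and ?u = "- \<Delta> (real_vec x) / ?l"
    obtain s where s: "s > 0" "\<tau> + s \<le> 1"
      "\<And>y. interp_gap (Qt \<tau>) v (real_vec y) > 0 \<Longrightarrow>
        interp_gap (Qt (\<tau> + s)) v (real_vec y) + s * (?u * bary v (real_vec y) $ k) > 0"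
      using later by blast
    have gap': "interp_gap (Qt (\<tau> + s)) ?v (real_vec y) =
        interp_gap (Qt (\<tau> + s)) v (real_vec y) + s * (?u * bary v (real_vec y) $ k)" for y
      using interp_gap_update[OF d, of x k "Qt (\<tau> + s)" "real_vec y"] l
      by (simp add: shift[of s "real_vec x"] x(2))
    have detv: "of_int (det (vmat ?v)) = ?l * of_int (det (vmat v))" by (rule det_vmat_update[OF d])
    then have d': "det (vmat ?v) \<noteq> 0" using d l by auto
    have "empty_sphere (Qt (\<tau> + s)) ?v"
      unfolding empty_sphere_def
    proof (intro conjI d' allI impI)
      fix y assume y: "y \<notin> range ?v"
      show "interp_gap (Qt (\<tau> + s)) ?v (real_vec y) > 0"
      proof (cases "y = v k")
        case True
        then have "interp_gap (Qt (\<tau> + s)) ?v (real_vec y) = s * ?u"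
          unfolding gap' using vx by (simp add: bary_vertex[OF d])
        moreover have "s * ?u > 0" using s(1) \<Delta>x l by (intro mult_pos_pos divide_pos_pos) auto
        ultimately show ?thesis by (simp only:)
      next
        case False
        have "y \<noteq> x" using y by (metis fun_upd_same rangeI)
        moreover have "y \<notin> range v" using y False by (metis fun_upd_other image_iff rangeI)
        ultimately show ?thesis unfolding gap' using s(3) unique by blast
      qed
    qed
    moreover have "M \<le> \<bar>det (vmat ?v)\<bar>"
    proof -
      have "(of_int M :: real) \<le> of_int \<bar>det (vmat v)\<bar> * ?l" using neg by simp
      also have "\<dots> = of_int \<bar>det (vmat ?v)\<bar>" using detv l by (simp add: abs_mult)
      finally show ?thesis by linarith
    qed
    ultimately have "\<tau> + s \<in> T" using s(1,2) \<tau> by (auto simp: T_def V_def)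
    then show False using le s(1) by fastforce
  qed
  \<comment> \<open>The form at \<open>t0\<close> is returned, for which the sphere of
    \<open>v\<close> is strictly empty; the coordinates of \<open>x\<close> do not depend on the
    form.\<close>
  show ?thesis
    by (intro exI[of _ "Qt t0"] exI[of _ v] exI[of _ x] conjI allI pd[OF t0'(1,2)] t0'(3) vM x(1) small)
qed

section \<open>Forms with only unimodular Delaunay simplices\<close>

definition principal_vec :: "'n \<times> 'n \<Rightarrow> real ^ 'n" where
  "principal_vec p = (if fst p = snd p then axis (fst p) 1 else axis (fst p) 1 - axis (snd p) 1)"

definition outer :: "real ^ 'n \<Rightarrow> real ^ 'n \<Rightarrow> real ^ 'n ^ 'n" where
  "outer a b = (\<chi> r s. a $ r * b $ s)"

text \<open>For positive weights these forms lie in the interior of Voronoi's principal domain. A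
  pair of distinct indices contributes twice, once in each order.\<close>

definition principal :: "('n::finite \<times> 'n \<Rightarrow> real) \<Rightarrow> real ^ 'n ^ 'n" where
  "principal c = (\<Sum>p\<in>UNIV. c p *\<^sub>R outer (principal_vec p) (principal_vec p))"

lemma qf_outer: "qf (outer a b) x = (a \<bullet> x) * (b \<bullet> x)" for a b x :: "real ^ 'n::finite"
proof -
  have "qf (outer a b) x = (\<Sum>r\<in>UNIV. \<Sum>s\<in>UNIV. (a $ r * x $ r) * (b $ s * x $ s))"
    by (simp add: qf_def inner_vec_def matrix_vector_mult_def outer_def sum_distrib_left ac_simps)
  also have "\<dots> = (a \<bullet> x) * (b \<bullet> x)" by (simp add: inner_vec_def sum_product)
  finally show ?thesis .
qed

lemma qf_sum: "finite I \<Longrightarrow> qf (\<Sum>p\<in>I. c p *\<^sub>R M p) x = (\<Sum>p\<in>I. c p * qf (M p) x)"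
  for x :: "real ^ 'n::finite"
proof (induction I rule: finite_induct)
  case (insert p I)
  have "qf (A + B) x = qf A x + qf B x" "qf (s *\<^sub>R A) x = s * qf A x" for A B s
    by (simp_all add: qf_def matrix_vector_mult_add_rdistrib scaleR_matrix_vector_assoc[symmetric] inner_add_right)
  then show ?case using insert by simp
qed (simp add: qf_def)

lemma qf_principal: "qf (principal c) x = (\<Sum>p\<in>UNIV. c p * (principal_vec p \<bullet> x)\<^sup>2)"
  unfolding principal_def by (simp add: qf_sum qf_outer power2_eq_square)

lemma posdef_principal:
  assumes "\<And>p. c p > 0"
  shows "posdef (principal c)"
  unfolding posdef_def
proof (intro conjI allI impI)
  have "principal c $ i $ j = principal c $ j $ i" for i j
    by (simp add: principal_def outer_def mult.commute)
  then show "transpose (principal c) = principal c" by (simp add: transpose_def vec_eq_iff)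
  fix x :: "real ^ 'a" assume "x \<noteq> 0"
  then obtain i where i: "x $ i \<noteq> 0" by (auto simp: vec_eq_iff)
  have "0 < c (i, i) * (principal_vec (i, i) \<bullet> x)\<^sup>2"
    using assms[of "(i, i)"] i by (simp add: principal_vec_def inner_axis')
  also have "\<dots> \<le> qf (principal c) x"
    unfolding qf_principal
    by (intro member_le_sum mult_nonneg_nonneg) (simp_all add: less_imp_le[OF assms])
  finally show "qf (principal c) x > 0" .
qed

lemma int_product_nonneg: "\<bar>a - b\<bar> \<le> 1 \<Longrightarrow> 0 \<le> a * b" for a b :: int
  by (cases "a > 0"; cases "b > 0"; simp add: zero_le_mult_iff; presburger?)

text \<open>Halving \<open>w\<close> with rounding changes each principal linear form on the two parts by at most
  one, so each square is superadditive there.\<close>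

lemma principal_difference:
  assumes c: "\<And>p. c p > 0" and d: "det (vmat v) \<noteq> 0"
    and weak: "\<And>x. interp_gap (principal c) v (real_vec x) \<ge> 0"
  shows "\<bar>(v k - v l) $ i\<bar> \<le> 1" "\<bar>(v k - v l) $ i - (v k - v l) $ j\<bar> \<le> 1"
proof -
  define w where "w = v k - v l"
  define u where "u = (\<chi> i. w $ i div 2)"
  define L where "L p x = (if fst p = snd p then x $ fst p else x $ fst p - x $ snd p)"
    for p and x :: "int ^ 'a"
  have L: "principal_vec p \<bullet> real_vec x = of_int (L p x)" for p x
    by (simp add: principal_vec_def L_def inner_axis' inner_diff_left real_vec_simps)
  have La: "L p w = L p u + L p (w - u)" for p by (simp add: L_def)
  have near: "\<bar>L p u - L p (w - u)\<bar> \<le> 1" for p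
  proof -
    have "u $ i - (w - u) $ i = - (w $ i mod 2)" for i
      by (simp add: u_def minus_mult_div_eq_mod[symmetric])
    moreover have "w $ i mod 2 = 0 \<or> w $ i mod 2 = 1" for i by auto
    ultimately show ?thesis
      unfolding L_def by (smt (verit, ccfv_SIG))
  qed
  have "qf (principal c) (real_vec w) \<le> qf (principal c) (real_vec u) + qf (principal c) (real_vec (w - u))"
    unfolding w_def using posdef_principal[of c, OF c] by (intro weakly_empty_norm[OF _ d weak]) (simp add: posdef_def)
  also have "qf (principal c) (real_vec u) + qf (principal c) (real_vec (w - u)) =
      qf (principal c) (real_vec w) - 2 * (\<Sum>p\<in>UNIV. c p * of_int (L p u * L p (w - u)))"
    unfolding qf_principal L La
    by (simp add: power2_eq_square algebra_simps sum.distrib sum_distrib_left)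
  \<comment> \<open>Rounding makes each product nonnegative and the edge inequality makes their
    weighted sum nonpositive, so all products vanish. One part of each linear form is then 0 and the
    other at most 1 in absolute value.\<close>
  finally have "(\<Sum>p\<in>UNIV. c p * of_int (L p u * L p (w - u))) \<le> 0" by simp
  moreover have nn: "c p * of_int (L p u * L p (w - u)) \<ge> 0" for p
    using int_product_nonneg[OF near] c[of p] by (intro mult_nonneg_nonneg) (auto simp flip: of_int_mult)
  ultimately have "(\<Sum>p\<in>UNIV. c p * of_int (L p u * L p (w - u))) = 0"
    by (intro antisym sum_nonneg) auto
  then have z: "c p * of_int (L p u * L p (w - u)) = 0" for p
    using sum_nonneg_eq_0_iff[of UNIV "\<lambda>p. c p * of_int (L p u * L p (w - u))", OF finite nn] by blast
  have zero: "L p u = 0 \<or> L p (w - u) = 0" for p using z[of p] c[of p] by simp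
  have bound: "\<bar>L p w\<bar> \<le> 1" for p using zero[of p] near[of p] La[of p] by auto
  show "\<bar>(v k - v l) $ i\<bar> \<le> 1" using bound[of "(i, i)"] unfolding w_def[symmetric] by (simp add: L_def)
  show "\<bar>(v k - v l) $ i - (v k - v l) $ j\<bar> \<le> 1"
    using bound[of "(i, j)"] unfolding w_def[symmetric] by (cases "i = j") (simp_all add: L_def)
qed

text \<open>The vertices form a chain in which the coordinate sums of neighbours differ by one.\<close>

lemma chain_unimodular:
  fixes v :: "'n::finite option \<Rightarrow> int ^ 'n"
  assumes d: "det (vmat v) \<noteq> 0"
    and diff: "\<And>k l i. \<bar>(v k - v l) $ i\<bar> \<le> 1" "\<And>k l i j. \<bar>(v k - v l) $ i - (v k - v l) $ j\<bar> \<le> 1"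
  shows "\<bar>det (vmat v)\<bar> = 1"
proof -
  define s where "s k = (\<Sum>i\<in>UNIV. v k $ i)" for k
  have sdiff: "s k - s l = (\<Sum>i\<in>UNIV. (v k - v l) $ i)" for k l by (simp add: s_def sum_subtractf)
  have inj: "inj v" using d by (simp add: det_nz_iff_inj_independent)
  have sign: "(\<forall>i. (v k - v l) $ i \<in> {0, 1}) \<or> (\<forall>i. (v k - v l) $ i \<in> {0, -1})" for k l
  proof (rule ccontr)
    assume "\<not> ?thesis"
    then obtain i j where "(v k - v l) $ i \<notin> {0, 1}" "(v k - v l) $ j \<notin> {0, -1}" by blast
    moreover have "(v k - v l) $ i \<in> {-1, 0, 1}" "(v k - v l) $ j \<in> {-1, 0, 1}"
      using diff(1)[of k l i] diff(1)[of k l j] by auto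
    ultimately show False using diff(2)[of k l i j] by auto
  qed
  have nonneg: "(\<forall>i. (v k - v l) $ i \<in> {0, 1})" if "s l < s k" for k l
  proof (rule ccontr)
    assume "\<not> ?thesis"
    then have "\<forall>i. (v k - v l) $ i \<in> {0, -1}" using sign by blast
    then have "(\<Sum>i\<in>UNIV. (v k - v l) $ i) \<le> 0" by (intro sum_nonpos) (metis empty_iff insert_iff neg_le_0_iff_le order_refl zero_le_one)
    then show False using that sdiff[of k l] by simp
  qed
  have s_inj: "inj s"
  proof
    fix k l assume eq: "s k = s l"
    then have z: "(\<Sum>i\<in>UNIV. (v k - v l) $ i) = 0" using sdiff[of k l] by simp
    have "(v k - v l) $ i = 0" for i
    proof (cases "\<forall>i. (v k - v l) $ i \<in> {0, 1}")
      case True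
      then have "\<And>i. 0 \<le> (v k - v l) $ i" by (metis empty_iff insert_iff order_refl zero_le_one)
      then show ?thesis using z by (subst (asm) sum_nonneg_eq_0_iff) auto
    next
      case False
      then have "\<forall>i. (v k - v l) $ i \<in> {0, -1}" using sign by blast
      then have "\<And>i. 0 \<le> - (v k - v l) $ i" by (metis empty_iff insert_iff neg_0_le_iff_le add.inverse_inverse order_refl zero_le_one)
      moreover have "(\<Sum>i\<in>UNIV. - (v k - v l) $ i) = 0" unfolding sum_negf z by simp
      ultimately show ?thesis by (subst (asm) sum_nonneg_eq_0_iff) auto
    qed
    then have "v k = v l" by (simp add: vec_eq_iff)
    then show "k = l" using inj by (simp add: inj_eq)
  qed
  define m where "m = Min (range s)"
  have m: "m \<in> range s" "\<And>k. m \<le> s k" unfolding m_def by auto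
  then obtain kmin where kmin: "s kmin = m" by auto
  have top: "s k \<le> m + int CARD('n)" for k
  proof -
    have "(\<Sum>i\<in>UNIV. (v k - v kmin) $ i) \<le> (\<Sum>i\<in>(UNIV :: 'n set). 1)"
      using diff(1)[of k kmin] by (intro sum_mono) (metis abs_le_D1)
    then show ?thesis using sdiff[of k kmin] kmin by simp
  qed
  \<comment> \<open>The \<open>n + 1\<close> coordinate sums are distinct and lie in an interval of
    \<open>n + 1\<close> integers, so they fill it.\<close>
  have range: "range s = {m..m + int CARD('n)}"
  proof (rule card_subset_eq)
    show "range s \<subseteq> {m..m + int CARD('n)}" using m(2) top by auto
    show "card (range s) = card {m..m + int CARD('n)}" using s_inj by (simp add: card_image)
  qed simp
  have step: "\<exists>k l. v k - v l = axis i 1" for i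
  proof -
    obtain kmax where kmax: "s kmax = m + int CARD('n)" using range by (metis atLeastAtMost_iff imageE of_nat_0_le_iff le_add_same_cancel1 order_refl)
    have "(\<Sum>j\<in>UNIV. 1 - (v kmax - v kmin) $ j) = 0"
      using sdiff[of kmax kmin] kmin kmax by (simp add: sum_subtractf)
    moreover have "0 \<le> 1 - (v kmax - v kmin) $ j" for j using diff(1)[of kmax kmin j] by (simp add: abs_le_iff)
    ultimately have "1 - (v kmax - v kmin) $ i = 0" by (subst (asm) sum_nonneg_eq_0_iff) auto
    then have ne: "v kmax $ i \<noteq> v kmin $ i" by simp
    \<comment> \<open>The first vertex of the chain at which coordinate \<open>i\<close> has its
      final value. Its difference to the predecessor is a 0-1 vector of sum 1 that is nonzero at
      \<open>i\<close>, hence the unit vector.\<close>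
    define A where "A = s ` {k. v k $ i = v kmax $ i}"
    have "finite A" "A \<noteq> {}" unfolding A_def by auto
    then obtain k where k: "s k = Min A" "v k $ i = v kmax $ i" by (metis (mono_tags, lifting) A_def Min_in imageE mem_Collect_eq)
    have "s k \<noteq> m" using ne k(2) kmin s_inj by (metis injD)
    then have "s k - 1 \<in> range s" unfolding range using m(2)[of k] top[of k] by auto
    then obtain l where l: "s l = s k - 1" by auto
    have "v l $ i \<noteq> v kmax $ i"
    proof
      assume "v l $ i = v kmax $ i"
      then have "s k \<le> s l" unfolding k(1) using \<open>finite A\<close> by (intro Min_le) (auto simp: A_def)
      then show False using l by simp
    qed
    moreover have 01: "\<forall>j. (v k - v l) $ j \<in> {0, 1}" using nonneg[of l k] l by simp
    ultimately have i1: "(v k - v l) $ i = 1" using k(2) 01[rule_format, of i] by auto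
    have "(\<Sum>j\<in>UNIV - {i}. (v k - v l) $ j) = 0"
      using sdiff[of k l] l i1 by (simp add: sum.remove[of UNIV i])
    moreover have "\<And>j. 0 \<le> (v k - v l) $ j" using 01 by (metis empty_iff insert_iff order_refl zero_le_one)
    ultimately have "\<forall>j\<in>UNIV - {i}. (v k - v l) $ j = 0" by (subst (asm) sum_nonneg_eq_0_iff) auto
    then have "v k - v l = axis i 1" using i1 unfolding vec_eq_iff axis_def by auto
    then show ?thesis by blast
  qed
  then obtain f g where fg: "\<And>i. v (f i) - v (g i) = axis i 1" by metis
  have intb: "integral_vec (bary v (real_vec x))" for x
  proof -
    define a :: "real ^ 'n option" where
      "a = axis None 1 + (\<Sum>i\<in>UNIV. of_int ((x - v None) $ i) *\<^sub>R (axis (f i) 1 - axis (g i) 1))"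
    have "(\<Sum>k\<in>UNIV. a $ k) = 1"
    proof -
      have one: "(\<Sum>k\<in>UNIV. axis j (1 :: real) $ k) = 1" for j :: "'n option"
        using sum_axis_mult[of j "\<lambda>_. 1"] by simp
      have "(\<Sum>k\<in>UNIV. (\<Sum>i\<in>UNIV. of_int ((x - v None) $ i) *\<^sub>R (axis (f i) 1 - axis (g i) 1 :: real ^ 'n option)) $ k)
        = (\<Sum>i\<in>UNIV. of_int ((x - v None) $ i) * (\<Sum>k\<in>UNIV. (axis (f i) 1 - axis (g i) 1 :: real ^ 'n option) $ k))"
        by (simp add: sum_distrib_left) (rule sum.swap)
      then show ?thesis by (simp add: a_def sum.distrib one sum_subtractf)
    qed
    moreover have "(\<Sum>k\<in>UNIV. a $ k *\<^sub>R real_vec (v k)) = real_vec x"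
    proof -
      have "(\<Sum>k\<in>UNIV. (\<Sum>i\<in>UNIV. of_int ((x - v None) $ i) *\<^sub>R (axis (f i) 1 - axis (g i) 1 :: real ^ 'n option)) $ k *\<^sub>R real_vec (v k))
        = (\<Sum>i\<in>UNIV. of_int ((x - v None) $ i) *\<^sub>R (\<Sum>k\<in>UNIV. (axis (f i) 1 - axis (g i) 1 :: real ^ 'n option) $ k *\<^sub>R real_vec (v k)))"
        by (simp add: scaleR_sum_right scaleR_sum_left) (rule sum.swap)
      also have "\<dots> = (\<Sum>i\<in>UNIV. of_int ((x - v None) $ i) *\<^sub>R real_vec (v (f i) - v (g i)))"
        by (simp add: scaleR_diff_left sum_subtractf sum_axis_scaleR real_vec_simps)
      also have "\<dots> = real_vec (x - v None)"
        unfolding fg by (simp add: vec_eq_iff real_vec_def axis_def if_distrib cong: if_cong)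
      finally show ?thesis
        by (simp add: a_def scaleR_add_left sum.distrib sum_axis_scaleR real_vec_simps)
    qed
    ultimately have "a = bary v (real_vec x)" using bary_eq_iff[OF d] by metis
    moreover have "integral_vec a"
      unfolding a_def integral_vec_def by (auto simp: axis_def intro!: Ints_add Ints_sum Ints_mult)
    ultimately show ?thesis by simp
  qed
  show ?thesis
  proof (rule glue_group_trivial[OF d])
    fix a assume a: "a \<in> glue_group (vmat v)"
    define t where "t = (\<Sum>k\<in>UNIV. a $ k)"
    have "(real_mat (vmat v) *v a) $ None = t"
      by (simp add: t_def matrix_vector_mult_def real_mat_def vmat_def)
    then have t: "t \<in> \<int>" using a by (metis glue_group_def integral_vec_def mem_Collect_eq)
    define b :: "real ^ 'n option" where "b = (t - 1) *\<^sub>R axis None 1"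
    have b: "integral_vec b" unfolding b_def using t by (intro integral_vec_scaleR integral_vec_axis Ints_diff) auto
    have "(\<Sum>k\<in>UNIV. (a - b) $ k) = 1"
      using sum_axis_mult[of None "\<lambda>_ :: 'n option. 1"] by (simp add: sum_subtractf b_def t_def flip: sum_distrib_left)
    then obtain x where "a - b = bary v (real_vec x)"
      using glue_group_bary[OF d glue_group_diff[OF a glue_group_integral[OF b]]] by blast
    then have "integral_vec (a - b)" using intb by simp
    then show "integral_vec a" using integral_vec_add[OF _ b, of "a - b"] by simp
  qed
qed

section \<open>Genericity of the segment\<close>

lemma finite_zeros:
  fixes a :: "'p::finite \<Rightarrow> real" and g :: "'p \<Rightarrow> nat"
  assumes "inj g" "a p0 \<noteq> 0"
  shows "finite {\<theta>. (\<Sum>p\<in>UNIV. \<theta> ^ g p * a p) = 0}"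
proof -
  define P where "P = (\<Sum>p\<in>UNIV. monom (a p) (g p))"
  have "coeff P (g p0) = (\<Sum>p\<in>UNIV. if p = p0 then a p else 0)"
    using assms(1) by (auto simp: P_def coeff_sum coeff_monom inj_eq intro!: sum.cong)
  then have "P \<noteq> 0" using assms(2) by auto
  then have "finite {\<theta>. poly P \<theta> = 0}" by (rule poly_roots_finite)
  then show ?thesis by (simp add: P_def poly_sum poly_monom mult.commute)
qed

lemma interp_gap_sum:
  fixes M :: "_ \<Rightarrow> real ^ 'n::finite ^ 'n"
  assumes "\<And>z. qf Q z = (\<Sum>p\<in>I. c p * qf (M p) z)"
  shows "interp_gap Q v x = (\<Sum>p\<in>I. c p * interp_gap (M p) v x)"
proof -
  have "(\<Sum>k\<in>UNIV. bary v x $ k * (\<Sum>p\<in>I. c p * qf (M p) (real_vec (v k)))) =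
      (\<Sum>p\<in>I. c p * (\<Sum>k\<in>UNIV. bary v x $ k * qf (M p) (real_vec (v k))))"
    by (simp add: sum_distrib_left ac_simps) (rule sum.swap)
  then show ?thesis
    unfolding interp_gap_def assms by (simp add: right_diff_distrib sum_subtractf)
qed

lemma interp_gap_principal:
  "interp_gap (principal c) v x = (\<Sum>p\<in>UNIV. c p * interp_gap (outer (principal_vec p) (principal_vec p)) v x)"
  by (rule interp_gap_sum) (simp add: qf_principal qf_outer power2_eq_square)

text \<open>The principal forms span all quadratic forms.\<close>

lemma interp_gap_outer_span:
  fixes v :: "'n::finite option \<Rightarrow> int ^ 'n"
  assumes "\<And>p. \<alpha> * interp_gap (outer (principal_vec p) (principal_vec p)) v y =
      \<beta> * interp_gap (outer (principal_vec p) (principal_vec p)) v x"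
  shows "\<alpha> * interp_gap (outer a b) v y = \<beta> * interp_gap (outer a b) v x"
proof -
  let ?E = "\<lambda>p :: 'n \<times> 'n. outer (principal_vec p) (principal_vec p)"
  define M where "M p = (if fst p = snd p then ?E p
      else (1 / 2) *\<^sub>R (?E (fst p, fst p) + ?E (snd p, snd p) - ?E p))" for p
  have lin: "qf (A + B) z = qf A z + qf B z" "qf (A - B) z = qf A z - qf B z" "qf (s *\<^sub>R A) z = s * qf A z"
    for A B :: "real ^ 'n ^ 'n" and s z
    by (simp_all add: qf_def matrix_vector_mult_add_rdistrib matrix_vector_mult_diff_rdistrib
        scaleR_matrix_vector_assoc[symmetric] inner_add_right inner_diff_right)
  have qM: "qf (M p) z = z $ fst p * z $ snd p" for p z
    by (simp add: M_def lin qf_outer principal_vec_def inner_axis' inner_diff_left algebra_simps)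
  have "interp_gap (outer a b) v z = (\<Sum>p\<in>UNIV. (a $ fst p * b $ snd p) * interp_gap (M p) v z)" for z
  proof (rule interp_gap_sum)
    fix z
    have "qf (outer a b) z = (\<Sum>r\<in>UNIV. \<Sum>s\<in>UNIV. (a $ r * z $ r) * (b $ s * z $ s))"
      by (simp add: qf_outer inner_vec_def sum_product)
    also have "\<dots> = (\<Sum>p\<in>UNIV. (a $ fst p * z $ fst p) * (b $ snd p * z $ snd p))"
      by (simp add: sum.cartesian_product case_prod_beta)
    finally show "qf (outer a b) z = (\<Sum>p\<in>UNIV. a $ fst p * b $ snd p * qf (M p) z)"
      by (simp add: qM ac_simps)
  qed
  moreover have "\<alpha> * interp_gap (M p) v y = \<beta> * interp_gap (M p) v x" for p
  proof (cases "fst p = snd p")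
    case True
    then show ?thesis using assms[of p] by (simp add: M_def)
  next
    case False
    have half: "interp_gap (M p) v z = (interp_gap (?E (fst p, fst p)) v z + interp_gap (?E (snd p, snd p)) v z
        - interp_gap (?E p) v z) / 2" for z
      using False unfolding interp_gap_def M_def
      by (simp add: lin sum.distrib sum_subtractf algebra_simps sum_divide_distrib[symmetric])
    show ?thesis
      unfolding half using assms[of p] assms[of "(fst p, fst p)"] assms[of "(snd p, snd p)"]
      by (simp add: distrib_left right_diff_distrib)
  qed
  ultimately show ?thesis by (simp add: sum_distrib_left mult.left_commute[of \<alpha>] mult.left_commute[of \<beta>])
qed

text \<open>The product of two different coordinate functions vanishes at every vertex, so it is the
  gap of its own quadratic part. Proportional gaps for all forms therefore give proportional
  products of coordinates.\<close>

lemma interp_gap_product: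
  assumes "det (vmat v) \<noteq> 0" "k \<noteq> l"
  shows "\<exists>a b. \<forall>x. interp_gap (outer a b) v x = bary v x $ k * bary v x $ l"
proof -
  have coord: "\<exists>b c. \<forall>x. bary v x $ k = b \<bullet> x + c" for k
  proof -
    have "bary v x $ k = (\<Sum>i\<in>UNIV. bary v x $ i * axis k 1 $ i)" for x
      using sum_axis_mult[of k "\<lambda>i. bary v x $ i"] by (simp add: mult.commute)
    then show ?thesis using bary_affine[OF assms(1), of "\<lambda>i. axis k 1 $ i"] by simp
  qed
  obtain a s where a: "\<And>x. bary v x $ k = a \<bullet> x + s" using coord by metis
  obtain b t where b: "\<And>x. bary v x $ l = b \<bullet> x + t" using coord by metis
  have "interp_gap (outer a b) v x = bary v x $ k * bary v x $ l" for x
  proof -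
    have q: "qf (outer a b) z = (bary v z $ k - s) * (bary v z $ l - t)" for z
      unfolding qf_outer a b by simp
    have "bary v x $ i * qf (outer a b) (real_vec (v i)) =
        s * t * bary v x $ i - t * (axis k 1 $ i * bary v x $ i) - s * (axis l 1 $ i * bary v x $ i)" for i
      unfolding q bary_vertex[OF assms(1)] using assms(2) by (auto simp: axis_def algebra_simps)
    then have "(\<Sum>i\<in>UNIV. bary v x $ i * qf (outer a b) (real_vec (v i))) =
        s * t - t * bary v x $ k - s * bary v x $ l"
      using bary_sum(1)[OF assms(1), of x]
      by (simp add: sum_subtractf sum_axis_mult flip: sum_distrib_left)
    then show ?thesis by (simp add: interp_gap_def q algebra_simps)
  qed
  then show ?thesis by blast
qed

text \<open>A point with a single nonzero coordinate is a vertex. With exactly two, its gap is minus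
  the product of these coordinates and the squared distance of the two vertices, which is not
  zero.\<close>

lemma support_three:
  fixes v :: "'n::finite option \<Rightarrow> int ^ 'n"
  assumes "posdef Q" "det (vmat v) \<noteq> 0" "x \<notin> range v" "interp_gap Q v (real_vec x) = 0"
  shows "\<exists>c. c \<noteq> a \<and> c \<noteq> b \<and> bary v (real_vec x) $ c \<noteq> 0"
proof (rule ccontr)
  assume no: "\<not> ?thesis"
  let ?l = "\<lambda>k. bary v (real_vec x) $ k"
  have single: "?l a \<noteq> 0 \<and> ?l b \<noteq> 0 \<and> a \<noteq> b"
  proof (rule ccontr)
    assume "\<not> ?thesis"
    then obtain k where k: "\<And>c. c \<noteq> k \<Longrightarrow> ?l c = 0" using no by metis
    have "real_vec x = (\<Sum>c\<in>UNIV. ?l c *\<^sub>R real_vec (v c))" using bary_sum[OF assms(2)] by simp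
    also have "\<dots> = (\<Sum>c\<in>{k}. ?l c *\<^sub>R real_vec (v c))" using k by (intro sum.mono_neutral_right) auto
    moreover have "(\<Sum>c\<in>UNIV. ?l c) = (\<Sum>c\<in>{k}. ?l c)" using k by (intro sum.mono_neutral_right) auto
    then have "?l k = 1" using bary_sum(1)[OF assms(2), of "real_vec x"] by simp
    ultimately have "x = v k" by (simp add: real_vec_inject)
    then show False using assms(3) by blast
  qed
  have sym: "transpose Q = Q" using assms(1) by (simp add: posdef_def)
  let ?f = "\<lambda>i j. qf Q (real_vec (v i) - real_vec (v j)) * ?l i * ?l j"
  have "(\<Sum>i\<in>UNIV. \<Sum>j\<in>UNIV. ?f i j) = (\<Sum>i\<in>{a, b}. \<Sum>j\<in>UNIV. ?f i j)"
    using no by (intro sum.mono_neutral_right) auto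
  also have "\<dots> = (\<Sum>i\<in>{a, b}. \<Sum>j\<in>{a, b}. ?f i j)"
    using no by (intro sum.cong refl sum.mono_neutral_right) auto
  also have "\<dots> = 2 * (qf Q (real_vec (v a) - real_vec (v b)) * ?l a * ?l b)"
    using single by (simp add: qf_diff[OF sym] inner_symmetric[OF sym, of "real_vec (v a)" "real_vec (v b)"] qf_def[of Q "_ - _"]
        algebra_simps) (simp add: qf_def)
  finally have "qf Q (real_vec (v a) - real_vec (v b)) * ?l a * ?l b = 0"
    using assms(4) unfolding interp_gap_eq[OF sym assms(2)] by simp
  then have "qf Q (real_vec (v a) - real_vec (v b)) = 0" using single by simp
  then have "real_vec (v a) - real_vec (v b) = 0" using assms(1) unfolding posdef_def by (metis less_irrefl)
  then have "v a = v b" by (simp add: real_vec_inject)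
  then show False using single assms(2) by (simp add: det_nz_iff_inj_independent inj_eq)
qed

text \<open>Comparing the products with a third nonzero coordinate \<open>c\<close> and cancelling
  it shows that the two coordinate vectors are proportional; both have sum 1.\<close>

lemma proportional_products:
  fixes v :: "'n::finite option \<Rightarrow> int ^ 'n"
  assumes d: "det (vmat v) \<noteq> 0" and "\<alpha> \<noteq> 0"
    and three: "\<And>a b. \<exists>c. c \<noteq> a \<and> c \<noteq> b \<and> bary v (real_vec y) $ c \<noteq> 0"
    and proportional: "\<And>a b. a \<noteq> b \<Longrightarrow> \<alpha> * (bary v (real_vec y) $ a * bary v (real_vec y) $ b) =
      \<beta> * (bary v (real_vec x) $ a * bary v (real_vec x) $ b)"
  shows "x = y"
proof -
  let ?l = "\<lambda>k. bary v (real_vec x) $ k" and ?m = "\<lambda>k. bary v (real_vec y) $ k"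
  have cross: "?m a * ?l b = ?m b * ?l a" for a b
  proof -
    obtain c where c: "c \<noteq> a" "c \<noteq> b" "?m c \<noteq> 0" using three by blast
    have "\<alpha> * ?m c * (?m a * ?l b) = (\<alpha> * (?m a * ?m c)) * ?l b" by (simp add: ac_simps)
    also have "\<dots> = \<beta> * (?l a * ?l c) * ?l b" using proportional[of a c] c by simp
    also have "\<dots> = \<beta> * (?l b * ?l c) * ?l a" by (simp add: ac_simps)
    also have "\<dots> = (\<alpha> * (?m b * ?m c)) * ?l a" using proportional[of b c] c by simp
    also have "\<dots> = \<alpha> * ?m c * (?m b * ?l a)" by (simp add: ac_simps)
    finally show ?thesis using c(3) assms(2) by simp
  qed
  have "?m a = ?l a" for a
  proof -
    have "?m a = (\<Sum>b\<in>UNIV. ?m a * ?l b)" using bary_sum(1)[OF d, of "real_vec x"] by (simp flip: sum_distrib_left)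
    also have "\<dots> = (\<Sum>b\<in>UNIV. ?m b * ?l a)" by (simp add: cross)
    also have "\<dots> = ?l a" using bary_sum(1)[OF d, of "real_vec y"] by (simp flip: sum_distrib_right)
    finally show ?thesis .
  qed
  then have "bary v (real_vec x) = bary v (real_vec y)" by (simp add: vec_eq_iff)
  then show ?thesis using bary_sum(2)[OF d] by (metis real_vec_inject)
qed

text \<open>The weights are powers of one parameter \<theta> with distinct exponents, so each
  relation is a polynomial equation in \<theta>. There are countably many simplices and pairs of
  points, and each nontrivial equation has finitely many roots. The pair \<open>(1, 0)\<close>
  serves the case that both gaps for \<open>Q0\<close> vanish.\<close>

lemma generic_principal:
  fixes Q0 :: "real ^ 'n::finite ^ 'n"
  shows "\<exists>c. (\<forall>p. c p > 0) \<and> (\<forall>v x y \<alpha> \<beta>.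
    (\<alpha>, \<beta>) \<in> {(interp_gap Q0 v (real_vec x), interp_gap Q0 v (real_vec y)), (1, 0)} \<longrightarrow>
    \<alpha> * interp_gap (principal c) v (real_vec y) = \<beta> * interp_gap (principal c) v (real_vec x) \<longrightarrow>
    (\<forall>p. \<alpha> * interp_gap (outer (principal_vec p) (principal_vec p)) v (real_vec y) =
      \<beta> * interp_gap (outer (principal_vec p) (principal_vec p)) v (real_vec x)))"
proof -
  obtain g :: "'n \<times> 'n \<Rightarrow> nat" where g: "inj g"
    using finite_imp_inj_to_nat_seg[of "UNIV :: ('n \<times> 'n) set", OF finite] by blast
  define a where "a = (\<lambda>(v :: 'n option \<Rightarrow> int ^ 'n, x, y, w :: bool) p.
    (if w then interp_gap Q0 v (real_vec x) else 1) * interp_gap (outer (principal_vec p) (principal_vec p)) v (real_vec y) -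
    (if w then interp_gap Q0 v (real_vec y) else 0) * interp_gap (outer (principal_vec p) (principal_vec p)) v (real_vec x))"
  define B where "B z = (if \<exists>p. a z p \<noteq> 0 then {\<theta>. (\<Sum>p\<in>UNIV. \<theta> ^ g p * a z p) = 0} else {})" for z
  have "countable (B z)" for z
  proof (cases "\<exists>p. a z p \<noteq> 0")
    case True
    then show ?thesis using finite_zeros[OF g, of "a z"] unfolding B_def by (auto intro: countable_finite)
  qed (simp add: B_def)
  then have "countable (\<Union>z. B z)" by (intro countable_UN) auto
  moreover have "uncountable {1<..<2 :: real}" by (simp add: uncountable_open_interval)
  ultimately obtain \<theta> where \<theta>: "1 < \<theta>" "\<theta> \<notin> (\<Union>z. B z)"
    by (metis (no_types, lifting) countable_subset greaterThanLessThan_iff subsetI)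
  define c where "c p = \<theta> ^ g p" for p
  show ?thesis
  proof (intro exI[of _ c] conjI allI impI)
    show "c p > 0" for p using \<theta>(1) by (simp add: c_def)
    fix v x y \<alpha> \<beta> p
    assume ab: "(\<alpha>, \<beta>) \<in> {(interp_gap Q0 v (real_vec x), interp_gap Q0 v (real_vec y)), (1, 0)}"
      and eq: "\<alpha> * interp_gap (principal c) v (real_vec y) = \<beta> * interp_gap (principal c) v (real_vec x)"
    define z where "z = (v, x, y, (\<alpha>, \<beta>) = (interp_gap Q0 v (real_vec x), interp_gap Q0 v (real_vec y)))"
    have az: "a z p = \<alpha> * interp_gap (outer (principal_vec p) (principal_vec p)) v (real_vec y) -
      \<beta> * interp_gap (outer (principal_vec p) (principal_vec p)) v (real_vec x)" for p
      using ab by (auto simp: a_def z_def)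
    have "(\<Sum>p\<in>UNIV. \<theta> ^ g p * a z p) = 0"
      using eq unfolding interp_gap_principal az c_def
      by (simp add: right_diff_distrib sum_subtractf sum_distrib_left mult.left_commute)
    moreover have "\<theta> \<notin> B z" using \<theta>(2) by blast
    ultimately have "\<not> (\<exists>p. a z p \<noteq> 0)" unfolding B_def by (metis (mono_tags, lifting) mem_Collect_eq)
    then have "a z p = 0" by blast
    then show "\<alpha> * interp_gap (outer (principal_vec p) (principal_vec p)) v (real_vec y) =
      \<beta> * interp_gap (outer (principal_vec p) (principal_vec p)) v (real_vec x)"
      by (simp add: az)
  qed
qed

text \<open>If two points lie on one sphere at the same parameter, eliminating the parameter leaves
  a proportion between their gaps for \<open>Q0\<close> and for the endpoint. Genericity extends it
  to each principal square, hence to all rank one products and to products of coordinates, where it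
  forces the points to coincide.\<close>

theorem flip_exists:
  fixes Q0 :: "real ^ 'n::finite ^ 'n"
  assumes "posdef Q0" "empty_sphere Q0 v0" "M \<le> \<bar>det (vmat v0)\<bar>" "M > 1"
  shows "\<exists>Q (v :: 'n option \<Rightarrow> int ^ 'n) x. posdef Q \<and> empty_sphere Q v \<and> M \<le> \<bar>det (vmat v)\<bar> \<and>
    x \<notin> range v \<and> (\<forall>k. of_int \<bar>det (vmat v)\<bar> * bary v (real_vec x) $ k < of_int M)"
proof -
  obtain c where c: "\<And>p. c p > 0" and gen: "\<And>(v :: 'n option \<Rightarrow> int ^ 'n) x y \<alpha> \<beta> p.
    (\<alpha>, \<beta>) \<in> {(interp_gap Q0 v (real_vec x), interp_gap Q0 v (real_vec y)), (1, 0)} \<Longrightarrow>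
    \<alpha> * interp_gap (principal c) v (real_vec y) = \<beta> * interp_gap (principal c) v (real_vec x) \<Longrightarrow>
    \<alpha> * interp_gap (outer (principal_vec p) (principal_vec p)) v (real_vec y) =
      \<beta> * interp_gap (outer (principal_vec p) (principal_vec p)) v (real_vec x)"
    using generic_principal[of Q0] by metis
  have products: "\<alpha> * (bary v (real_vec y) $ k * bary v (real_vec y) $ l) =
      \<beta> * (bary v (real_vec x) $ k * bary v (real_vec x) $ l)"
    if "det (vmat v) \<noteq> 0" "k \<noteq> l"
      "(\<alpha>, \<beta>) \<in> {(interp_gap Q0 v (real_vec x), interp_gap Q0 v (real_vec y)), (1, 0)}"
      "\<alpha> * interp_gap (principal c) v (real_vec y) = \<beta> * interp_gap (principal c) v (real_vec x)"
    for v :: "'n option \<Rightarrow> int ^ 'n" and x y k l \<alpha> \<beta>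
  proof -
    note gen' = gen[OF that(3,4)]
    from interp_gap_product[OF that(1,2)]
    obtain a b where ab: "\<And>x. interp_gap (outer a b) v x = bary v x $ k * bary v x $ l" by blast
    show ?thesis using interp_gap_outer_span[OF gen', of a b] by (simp add: ab)
  qed
  show ?thesis
  proof (rule flip[OF assms(1) posdef_principal[of c, OF c] assms(2,3)])
    show "0 < M" using assms(4) by simp
    fix v :: "'n option \<Rightarrow> int ^ 'n"
    assume v: "det (vmat v) \<noteq> 0"
    show "\<bar>det (vmat v)\<bar> < M" if "\<And>x. 0 \<le> interp_gap (principal c) v (real_vec x)"
      using chain_unimodular[OF v principal_difference[of c, OF c v that]] assms(4) by simp
    fix t x y
    let ?Q = "(1 - t) *\<^sub>R Q0 + t *\<^sub>R principal c"
    assume xy: "x \<notin> range v" "y \<notin> range v" and t: "0 < t" "t \<le> 1"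
      and zero: "interp_gap ?Q v (real_vec x) = 0" "interp_gap ?Q v (real_vec y) = 0"
    have sum: "(1 - t) * interp_gap Q0 v (real_vec z) = - (t * interp_gap (principal c) v (real_vec z))"
      if "z = x \<or> z = y" for z
      using that zero unfolding interp_gap_path by auto
    have pd: "posdef ?Q"
      unfolding posdef_def
    proof (intro conjI allI impI)
      have "transpose ?Q = (1 - t) *\<^sub>R transpose Q0 + t *\<^sub>R transpose (principal c)"
        by (simp add: vec_eq_iff transpose_def)
      then show "transpose ?Q = ?Q"
        using assms(1) posdef_principal[of c, OF c] by (simp add: posdef_def)
      fix z :: "real ^ 'n" assume "z \<noteq> 0"
      then have "qf Q0 z > 0" "qf (principal c) z > 0"
        using assms(1) posdef_principal[of c, OF c] by (auto simp: posdef_def)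
      moreover have "qf ?Q z = (1 - t) * qf Q0 z + t * qf (principal c) z"
        by (simp add: qf_def matrix_vector_mult_add_rdistrib scaleR_matrix_vector_assoc[symmetric] inner_add_right)
      ultimately show "qf ?Q z > 0" using t by (simp add: add_nonneg_pos)
    qed
    note three = support_three[OF pd v xy(1) zero(1)] support_three[OF pd v xy(2) zero(2)]
    let ?a = "interp_gap Q0 v (real_vec x)" and ?b = "interp_gap Q0 v (real_vec y)"
    let ?a' = "interp_gap (principal c) v (real_vec x)" and ?b' = "interp_gap (principal c) v (real_vec y)"
    have "t * (?a * ?b') = t * (?b * ?a')"
    proof -
      have tb: "t * ?b' = - ((1 - t) * ?b)" "t * ?a' = - ((1 - t) * ?a)" using sum[of x] sum[of y] by simp_all
      have "t * (?a * ?b') = ?a * (t * ?b')" by simp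
      also have "\<dots> = ?b * (t * ?a')" unfolding tb by simp
      also have "\<dots> = t * (?b * ?a')" by simp
      finally show ?thesis .
    qed
    then have eq: "?a * ?b' = ?b * ?a'" using t by simp
    show "x = y"
    proof (cases "?a = 0")
      case False
      show ?thesis
        by (rule proportional_products[OF v False three(2)]) (rule products[OF v _ _ eq], simp_all)
    next
      case a0: True
      show ?thesis
      proof (cases "?b = 0")
        case False
        have "y = x"
        proof (rule proportional_products[OF v False three(1)])
          fix k l :: "'n option" assume "k \<noteq> l"
          show "?b * (bary v (real_vec x) $ k * bary v (real_vec x) $ l) = ?a * (bary v (real_vec y) $ k * bary v (real_vec y) $ l)"
            using products[OF v \<open>k \<noteq> l\<close> _ eq] by simp
        qed
        then show ?thesis by simp
      next
        case True
        \<comment> \<open>Both gaps for \<open>Q0\<close> are zero, so \<open>t > 0\<close> makes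
          the gap for the endpoint vanish too, and the relation with coefficients 1 and 0
          applies.\<close>
        then have "?b' = 0" using sum[of y] t by simp
        then have "1 * ?b' = 0 * ?a'" by simp
        from proportional_products[OF v _ three(2) products[OF v _ _ this]] show ?thesis by simp
      qed
    qed
  qed
qed

section \<open>Canonical forms\<close>

text \<open>The companion of \<open>interp_gap_eq\<close> for an arbitrary coefficient sum; at sum 0
  it shows that squared distances are of negative type.\<close>

lemma double_sum_qf:
  assumes "transpose Q = Q" "finite I"
  shows "(\<Sum>i\<in>I. \<Sum>j\<in>I. qf Q (p i - p j) * a i * a j) =
    2 * sum a I * (\<Sum>i\<in>I. a i * qf Q (p i)) - 2 * qf Q (\<Sum>i\<in>I. a i *\<^sub>R p i)"
proof -
  have "Q *v (\<Sum>j\<in>I. a j *\<^sub>R p j) = (\<Sum>j\<in>I. a j *\<^sub>R (Q *v p j))"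
    by (simp add: matrix_vector_mult_scaleR linear_sum[OF matrix_vector_mul_linear])
  then have "qf Q (\<Sum>i\<in>I. a i *\<^sub>R p i) = (\<Sum>i\<in>I. \<Sum>j\<in>I. (a i *\<^sub>R p i) \<bullet> (a j *\<^sub>R (Q *v p j)))"
    by (simp only: qf_def inner_sum_left) (simp only: inner_sum_right)
  then have q: "qf Q (\<Sum>i\<in>I. a i *\<^sub>R p i) = (\<Sum>i\<in>I. \<Sum>j\<in>I. a i * a j * (p i \<bullet> (Q *v p j)))"
    by (simp add: ac_simps)
  have "(\<Sum>i\<in>I. \<Sum>j\<in>I. qf Q (p i - p j) * a i * a j) =
      (\<Sum>i\<in>I. \<Sum>j\<in>I. a i * qf Q (p i) * a j + a i * (a j * qf Q (p j)) - 2 * (a i * a j * (p i \<bullet> (Q *v p j))))"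
    by (intro sum.cong refl) (simp add: qf_diff[OF assms(1)] algebra_simps)
  also have "\<dots> = 2 * sum a I * (\<Sum>i\<in>I. a i * qf Q (p i)) - 2 * (\<Sum>i\<in>I. \<Sum>j\<in>I. a i * a j * (p i \<bullet> (Q *v p j)))"
    by (simp add: sum.distrib sum_subtractf flip: sum_distrib_left sum_distrib_right)
  finally show ?thesis by (simp only: q)
qed

lemma sum_glue_group_Ints: "a \<in> glue_group (vmat v) \<Longrightarrow> (\<Sum>k\<in>UNIV. a $ k) \<in> \<int>"
proof -
  assume "a \<in> glue_group (vmat v)"
  then have "(real_mat (vmat v) *v a) $ None \<in> \<int>" by (simp add: glue_group_def integral_vec_def)
  then show ?thesis by (simp add: matrix_vector_mult_def real_mat_def vmat_def)
qed

text \<open>The distances are the lengths of the edges with respect to \<open>Q\<close>. A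
  nonintegral vector of sum 1 in the glue group is a lattice point that is not a vertex, and its
  positive gap is the axiom \<open>empty\<close>.\<close>

lemma index_class_empty_sphere:
  fixes v :: "7 option \<Rightarrow> int ^ 7"
  assumes Q: "posdef Q" and v: "empty_sphere Q v" and e: "bij_betw e {..<8} (UNIV :: 7 option set)"
  shows "index_class e (vmat v)"
  unfolding index_class_def
proof (intro conjI e exI)
  let ?G = "{a. \<exists>b\<in>glue_group (vmat v). \<forall>i<8. a i = b $ e i}"
  define d where "d i j = qf Q (real_vec (v (e i)) - real_vec (v (e j)))" for i j
  have det: "det (vmat v) \<noteq> 0" using v by (simp add: empty_sphere_def)
  have sym: "transpose Q = Q" using Q by (simp add: posdef_def)
  have re: "(\<Sum>i<8. f (e i)) = (\<Sum>k\<in>UNIV. f k)" for f :: "7 option \<Rightarrow> real"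
    by (rule sum.reindex_bij_betw[OF e])
  have reQ: "(\<Sum>i<8. \<Sum>j<8. d i j * b $ e i * b $ e j) =
      (\<Sum>i\<in>UNIV. \<Sum>j\<in>UNIV. qf Q (real_vec (v i) - real_vec (v j)) * b $ i * b $ j)" for b
  proof -
    have "(\<Sum>i<8. \<Sum>j<8. d i j * b $ e i * b $ e j) =
        (\<Sum>i<8. \<Sum>j\<in>UNIV. qf Q (real_vec (v (e i)) - real_vec (v j)) * b $ e i * b $ j)"
      unfolding d_def by (rule sum.cong[OF refl], rule re)
    then show ?thesis
      using re[of "\<lambda>i. \<Sum>j\<in>UNIV. qf Q (real_vec (v i) - real_vec (v j)) * b $ i * b $ j"] by simp
  qed
  have lift: "\<exists>b. \<forall>i<8. a i = b $ e i" for a :: "nat \<Rightarrow> real"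
  proof (intro exI allI impI)
    fix i :: nat assume "i < 8"
    then show "a i = (\<chi> k. a (inv_into {..<8} e k)) $ e i"
      using e by (simp add: bij_betw_def inv_into_f_f)
  qed
  show "glue 8 ?G d"
  proof
    fix a b assume "a \<in> ?G" "b \<in> ?G"
    then obtain a' b' where "a' \<in> glue_group (vmat v)" "b' \<in> glue_group (vmat v)"
      "\<forall>i<8. a i = a' $ e i" "\<forall>i<8. b i = b' $ e i" by auto
    then show "(\<lambda>i. a i + b i) \<in> ?G" using glue_group_add[of a' _ b'] by (auto intro!: bexI[of _ "a' + b'"])
  next
    fix a assume "a \<in> ?G"
    then obtain a' where a': "a' \<in> glue_group (vmat v)" "\<forall>i<8. a i = a' $ e i" by auto
    then show "(\<lambda>i. - a i) \<in> ?G"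
      using glue_group_scaleR[of "-1" a'] by (auto intro!: bexI[of _ "- a'"])
    show "(\<Sum>i<8. a i) \<in> \<int>" using sum_glue_group_Ints[OF a'(1)] a'(2) re[of "\<lambda>k. a' $ k"] by simp
  next
    fix a :: "nat \<Rightarrow> real" assume int: "\<And>i. i < 8 \<Longrightarrow> a i \<in> \<int>"
    obtain b where b: "\<forall>i<8. a i = b $ e i" using lift by blast
    have "integral_vec b" unfolding integral_vec_def
    proof
      fix k
      have "k \<in> e ` {..<8}" using e by (simp add: bij_betw_def)
      then show "b $ k \<in> \<int>" using b int by auto
    qed
    then show "a \<in> ?G" using b glue_group_integral by auto
  next
    fix i j :: nat
    have "qf Q (- x) = qf Q x" for x by (simp add: qf_def linear_neg[OF matrix_vector_mul_linear])
    from this[of "real_vec (v (e i)) - real_vec (v (e j))"] show "d i j = d j i" by (simp add: d_def)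
    show "d i i = 0" by (simp add: d_def qf_def)
    assume "i < 8" "j < 8" "i \<noteq> j"
    then have "e i \<noteq> e j" using e by (auto simp: bij_betw_def inj_on_def)
    then have "v (e i) \<noteq> v (e j)" using det by (simp add: det_nz_iff_inj_independent inj_eq)
    then show "d i j > 0" using Q by (simp add: d_def posdef_def real_vec_inject)
  next
    fix a :: "nat \<Rightarrow> real" assume s: "(\<Sum>i<8. a i) = 0"
    obtain b where b: "\<forall>i<8. a i = b $ e i" using lift by blast
    have "(\<Sum>k\<in>UNIV. b $ k) = 0" using s b re[of "\<lambda>k. b $ k"] by simp
    then have "(\<Sum>i\<in>UNIV. \<Sum>j\<in>UNIV. qf Q (real_vec (v i) - real_vec (v j)) * b $ i * b $ j) =
        - 2 * qf Q (\<Sum>k\<in>UNIV. b $ k *\<^sub>R real_vec (v k))"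
      using double_sum_qf[OF sym, of UNIV "\<lambda>i. real_vec (v i)" "\<lambda>i. b $ i"] by simp
    moreover have "qf Q z \<ge> 0" for z using Q by (cases "z = 0") (auto simp: posdef_def qf_def less_imp_le)
    ultimately show "(\<Sum>i<8. \<Sum>j<8. d i j * a i * a j) \<le> 0" using reQ[of b] b by simp
  next
    fix a i assume "a \<in> ?G" and s: "(\<Sum>i<8. a i) = 1" and i: "i < 8" "a i \<notin> \<int>"
    then obtain b where b: "b \<in> glue_group (vmat v)" "\<forall>i<8. a i = b $ e i" by auto
    have "(\<Sum>k\<in>UNIV. b $ k) = 1" using s b(2) re[of "\<lambda>k. b $ k"] by simp
    then obtain x where x: "b = bary v (real_vec x)" using glue_group_bary[OF det b(1)] by blast
    have "x \<notin> range v"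
    proof
      assume "x \<in> range v"
      then have "integral_vec b" unfolding x by (auto simp: bary_vertex[OF det] integral_vec_axis)
      then show False using b(2) i by (simp add: integral_vec_def)
    qed
    then have "interp_gap Q v (real_vec x) > 0" using v by (simp add: empty_sphere_def)
    then show "(\<Sum>i<8. \<Sum>j<8. d i j * a i * a j) < 0"
      using reQ[of b] b(2) unfolding interp_gap_eq[OF sym det] x by simp
  qed
qed

lemma exists_labelling: "\<exists>e. bij_betw e {..<8 :: nat} (UNIV :: 7 option set)"
  by (rule finite_same_card_bij) (simp_all add: card_UNIV_option)

lemma index_le_5:
  fixes v :: "7 option \<Rightarrow> int ^ 7"
  assumes "posdef Q" "empty_sphere Q v"
  shows "\<bar>det (vmat v)\<bar> \<le> 5"
proof (rule ccontr)
  assume "\<not> ?thesis"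
  then have "6 \<le> \<bar>det (vmat v)\<bar>" by simp
  then obtain Q' and w :: "7 option \<Rightarrow> int ^ 7" and x where w: "posdef Q'" "empty_sphere Q' w"
    "6 \<le> \<bar>det (vmat w)\<bar>" "x \<notin> range w" "\<And>k. of_int \<bar>det (vmat w)\<bar> * bary w (real_vec x) $ k < of_int 6"
    using flip_exists[OF assms, of 6] by auto
  have d: "det (vmat w) \<noteq> 0" using w(3) by auto
  obtain e where e: "bij_betw e {..<8 :: nat} (UNIV :: 7 option set)" using exists_labelling by blast
  let ?a = "bary w (real_vec x)"
  \<comment> \<open>An integral vector of sum 1 has an entry at least 1; the index times this entry
    would be at least 6.\<close>
  have "\<not> integral_vec ?a"
  proof
    assume int: "integral_vec ?a"
    have "?a $ k \<le> 0" for k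
    proof (rule ccontr)
      assume "\<not> ?thesis"
      then have "?a $ k \<ge> 1" using int by (auto simp: integral_vec_def elim!: allE[of _ k] Ints_cases)
      then have "of_int \<bar>det (vmat w)\<bar> * 1 \<le> of_int \<bar>det (vmat w)\<bar> * ?a $ k" by (intro mult_left_mono) auto
      moreover have "(6 :: real) \<le> of_int \<bar>det (vmat w)\<bar>" using w(3) by linarith
      ultimately show False using w(5)[of k] by simp
    qed
    then have "(\<Sum>k\<in>UNIV. ?a $ k) \<le> 0" by (intro sum_nonpos) auto
    then show False using bary_sum(1)[OF d, of "real_vec x"] by simp
  qed
  then show False
    using flip_index[OF index_class_empty_sphere[OF w(1,2) e] w(3) bary_glue_group[OF d] _ bary_sum(1)[OF d]] w(5)
    by auto
qed

section \<open>Arithmetic equivalence\<close>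

lemma real_mat_mult: "real_mat (A ** B) = real_mat A ** real_mat B"
  by (simp add: real_mat_def matrix_matrix_mult_def vec_eq_iff)

lemma real_mat_1: "real_mat (mat 1) = mat 1"
  by (simp add: real_mat_def mat_def vec_eq_iff)

lemma real_mat_inject: "real_mat A = real_mat B \<longleftrightarrow> A = B"
  by (simp add: real_mat_def vec_eq_iff)

lemma int_right_inverse:
  fixes A :: "int ^ 'k::finite ^ 'k"
  assumes "A ** B = mat 1"
  shows "invertible A"
proof -
  have "real_mat A ** real_mat B = mat 1" using assms by (simp flip: real_mat_mult add: real_mat_1)
  then have "real_mat B ** real_mat A = mat 1" by (simp add: matrix_left_right_inverse)
  then have "B ** A = mat 1" by (simp add: real_mat_inject flip: real_mat_mult real_mat_1)
  then show ?thesis using assms by (auto simp: invertible_def)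
qed

lemma arith_equivalent_refl: "arith_equivalent S S"
proof -
  have "invertible (mat 1 :: int ^ 'n ^ 'n)" by (auto simp: invertible_def)
  moreover have "(\<lambda>x. mat 1 *v x + 0) ` S = S" by simp
  ultimately show ?thesis unfolding arith_equivalent_def by blast
qed

lemma arith_equivalent_sym:
  assumes "arith_equivalent S T"
  shows "arith_equivalent T S"
proof -
  obtain A b where A: "invertible A" "(\<lambda>x. A *v x + b) ` S = T" using assms by (auto simp: arith_equivalent_def)
  obtain B where B: "A ** B = mat 1" "B ** A = mat 1" using A(1) by (auto simp: invertible_def)
  have "invertible B" using B by (auto simp: invertible_def)
  moreover have "(\<lambda>y. B *v y + - (B *v b)) ` T = S"
  proof -
    have "B *v (A *v x + b) + - (B *v b) = x" for x
      by (simp add: matrix_vector_right_distrib matrix_vector_mul_assoc B)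
    then show ?thesis unfolding A(2)[symmetric] image_image by simp
  qed
  ultimately show ?thesis unfolding arith_equivalent_def by blast
qed

lemma arith_equivalent_trans:
  assumes "arith_equivalent S T" "arith_equivalent T U"
  shows "arith_equivalent S U"
proof -
  obtain A b where A: "invertible A" "(\<lambda>x. A *v x + b) ` S = T" using assms by (auto simp: arith_equivalent_def)
  obtain B c where B: "invertible B" "(\<lambda>x. B *v x + c) ` T = U" using assms by (auto simp: arith_equivalent_def)
  obtain A' where A': "A ** A' = mat 1" using A(1) by (auto simp: invertible_def)
  obtain B' where B': "B ** B' = mat 1" using B(1) by (auto simp: invertible_def)
  have "(B ** A) ** (A' ** B') = mat 1"
    using A' B' by (metis matrix_mul_assoc matrix_mul_rid)
  then have "invertible (B ** A)" by (rule int_right_inverse)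
  moreover have "(\<lambda>x. (B ** A) *v x + (B *v b + c)) ` S = U"
    unfolding B(2)[symmetric] A(2)[symmetric] image_image
    by (simp add: matrix_vector_right_distrib matrix_vector_mul_assoc add.assoc)
  ultimately show ?thesis unfolding arith_equivalent_def by blast
qed

lemma unimodular_integral:
  assumes "\<bar>det W\<bar> = 1" "a \<in> glue_group W"
  shows "integral_vec a"
proof -
  have "det W \<noteq> 0" using assms(1) by auto
  then obtain q where "has_order a q" "q dvd det W" using exists_order assms(2) by blast
  moreover have "q dvd 1" using \<open>q dvd det W\<close> assms(1) by (metis dvd_abs_iff)
  ultimately have "q = 1" by (simp add: has_order_def)
  then show ?thesis using \<open>has_order a q\<close> by (simp add: has_order_def)
qed

text \<open>The lattice point \<open>x\<close> with barycentric coordinate \<open>1 / m\<close> at the last vertex completes the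
  first seven vertices to an affine basis of the lattice.\<close>

lemma canonical_form:
  fixes v :: "7 option \<Rightarrow> int ^ 7" and w :: "int ^ 7" and g :: "7 \<Rightarrow> 7 option"
  assumes d: "\<bar>det (vmat v)\<bar> = m" "m > 0" and w7: "w $ 7 = m"
    and bij: "inj g" "k0 \<notin> range g"
    and a: "a \<in> glue_group (vmat v)" "of_int m * a $ g 7 - 1 = of_int m * z" "z \<in> \<int>"
      "\<And>j. j \<noteq> 7 \<Longrightarrow> \<exists>z\<in>\<int>. of_int m * a $ g j + of_int (w $ j) = of_int m * z"
  shows "arith_equivalent (range v) (insert w (insert 0 ((\<lambda>j. axis j 1) ` (UNIV - {7}))))"
proof -
  have det: "det (vmat v) \<noteq> 0" using d by auto
  have gU: "UNIV = insert k0 (range g)"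
  proof -
    have "card (insert k0 (range g)) = CARD(7 option)"
      using bij by (simp add: card_image card_UNIV_option)
    then show ?thesis by (metis card_eq_UNIV_imp_eq_UNIV finite)
  qed
  have sumU: "(\<Sum>k\<in>UNIV. f k) = f k0 + (\<Sum>j\<in>UNIV. f (g j))" for f :: "7 option \<Rightarrow> 'b::comm_monoid_add"
    unfolding gU using bij by (simp add: sum.reindex)
  \<comment> \<open>The coordinates that the unit vector \<open>e_7\<close> has in the simplex with
    apex \<open>w\<close>: \<open>1 / m\<close> at the apex and \<open>- w_j / m\<close> at the unit
    vectors.\<close>
  define c where "c j = (if j = 7 then 1 else - of_int (w $ j)) / (of_int m :: real)" for j
  define b :: "real ^ 7 option" where
    "b = (\<chi> k. if k = k0 then 1 - (\<Sum>j\<in>UNIV. c j) else c (inv g k))"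
  have b0: "b $ k0 = 1 - (\<Sum>j\<in>UNIV. c j)" and bg: "b $ g j = c j" for j
    using bij by (auto simp: b_def inv_f_f)
  have bsum: "(\<Sum>k\<in>UNIV. b $ k) = 1" by (simp add: sumU b0 bg)
  have bag: "b $ g j - a $ g j \<in> \<int>" for j
  proof (cases "j = 7")
    case True
    then have "b $ g j - a $ g j = - z" using a(2) d(2) by (simp add: bg c_def field_simps)
    then show ?thesis using a(3) by simp
  next
    case False
    then obtain z' where z': "z' \<in> \<int>" "of_int m * a $ g j + of_int (w $ j) = of_int m * z'" using a(4) by blast
    then have "b $ g j - a $ g j = - z'" using d(2) False by (simp add: bg c_def field_simps)
    then show ?thesis using z'(1) by simp
  qed
  have "b $ k0 - a $ k0 = 1 - (\<Sum>k\<in>UNIV. a $ k) - (\<Sum>j\<in>UNIV. b $ g j - a $ g j)"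
    by (simp add: sumU b0 bg sum_subtractf)
  also have "\<dots> \<in> \<int>" by (rule Ints_diff[OF Ints_diff[OF Ints_1 sum_glue_group_Ints[OF a(1)]] Ints_sum]) (rule bag)
  finally have ba0: "b $ k0 - a $ k0 \<in> \<int>" .
  have "integral_vec (b - a)" unfolding integral_vec_def
  proof
    fix k
    have "k \<in> insert k0 (range g)" unfolding gU[symmetric] by simp
    then show "(b - a) $ k \<in> \<int>" using ba0 bag by auto
  qed
  then have "b \<in> glue_group (vmat v)"
    using glue_group_add[OF glue_group_integral a(1), of "b - a"] by simp
  then obtain x where x: "b = bary v (real_vec x)" using glue_group_bary[OF det _ bsum] by blast
  \<comment> \<open>The coordinate of \<open>x\<close> at the exchanged vertex is
    \<open>1 / m\<close>, so the exchange lowers the index from \<open>m\<close> to 1.\<close>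
  define u where "u = v(g 7 := x)"
  have "of_int (det (vmat u)) = (1 / of_int m) * (of_int (det (vmat v)) :: real)"
    using det_vmat_update[OF det, of "g 7" x] by (simp add: u_def x[symmetric] bg c_def)
  then have "(of_int (\<bar>det (vmat u)\<bar> * m) :: real) = of_int \<bar>det (vmat v)\<bar>"
    using d(2) by (simp add: abs_mult)
  then have "\<bar>det (vmat u)\<bar> * m = m" using d(1) by (simp only: of_int_eq_iff)
  then have u1: "\<bar>det (vmat u)\<bar> = 1" using d(2) by simp
  then have du: "det (vmat u) \<noteq> 0" by auto
  have uk0: "u k0 = v k0" using bij by (auto simp: u_def)
  define f where "f j = u (g j) - v k0" for j
  \<comment> \<open>The columns are the edges of the unimodular simplex at \<open>v k0\<close>.
    Every integer vector is an integral combination of them, which yields an integral right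
    inverse.\<close>
  define P :: "int ^ 7 ^ 7" where "P = (\<chi> r c. f c $ r)"
  have Pv: "P *v y = (\<Sum>c\<in>UNIV. y $ c *s f c)" for y
    by (simp add: P_def matrix_vector_mult_def vec_eq_iff mult.commute)
  have solve: "\<exists>y. P *v y = z" for z
  proof -
    let ?b = "bary u (real_vec (z + v k0))"
    have "integral_vec ?b" by (rule unimodular_integral[OF u1 bary_glue_group[OF du]])
    then obtain n where n: "?b = real_vec n" by (rule integral_vecE)
    have s: "(\<Sum>k\<in>UNIV. n $ k) = 1" "(\<Sum>k\<in>UNIV. n $ k *s u k) = z + v k0"
    proof -
      have "of_int (\<Sum>k\<in>UNIV. n $ k) = (1 :: real)"
        using bary_sum(1)[OF du, of "real_vec (z + v k0)"] unfolding n by (simp add: real_vec_simps)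
      then show "(\<Sum>k\<in>UNIV. n $ k) = 1" by linarith
      have "real_vec (\<Sum>k\<in>UNIV. n $ k *s u k) = (\<Sum>k\<in>UNIV. ?b $ k *\<^sub>R real_vec (u k))"
        unfolding n by (simp add: vec_eq_iff real_vec_def)
      then show "(\<Sum>k\<in>UNIV. n $ k *s u k) = z + v k0"
        using bary_sum(2)[OF du] by (simp add: real_vec_inject)
    qed
    have "P *v (\<chi> j. n $ g j) = (\<Sum>j\<in>UNIV. n $ g j *s u (g j)) - (\<Sum>j\<in>UNIV. n $ g j) *s v k0"
      unfolding Pv f_def by (simp add: vec_eq_iff sum_subtractf right_diff_distrib sum_distrib_right)
    also have "(\<Sum>j\<in>UNIV. n $ g j) = 1 - n $ k0" using s(1) unfolding sumU by simp
    also have "(\<Sum>j\<in>UNIV. n $ g j *s u (g j)) = z + v k0 - n $ k0 *s v k0"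
      using s(2) unfolding sumU uk0 by (simp add: eq_diff_eq add.commute)
    also have "z + v k0 - n $ k0 *s v k0 - (1 - n $ k0) *s v k0 = z"
      by (simp add: vec_eq_iff algebra_simps)
    finally show ?thesis by blast
  qed
  then have "\<forall>j. \<exists>y. P *v y = axis j 1" by blast
  then obtain R where R: "\<And>j. P *v R j = axis j 1" using choice[of "\<lambda>j y. P *v y = axis j 1"] by blast
  have "P ** (\<chi> r c. R c $ r) = mat 1"
  proof -
    have "(P ** (\<chi> r c. R c $ r)) $ i $ j = (P *v R j) $ i" for i j
      by (simp add: matrix_matrix_mult_def matrix_vector_mult_def)
    then show ?thesis by (simp add: R vec_eq_iff axis_def mat_def)
  qed
  then have inv: "invertible P" by (rule int_right_inverse)
  have Pax: "P *v axis j 1 = f j" for j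
    by (simp add: Pv vec_eq_iff axis_def if_distrib if_distribR cong: if_cong)
  have "of_int m *\<^sub>R real_vec x = of_int m *\<^sub>R (\<Sum>k\<in>UNIV. b $ k *\<^sub>R real_vec (v k))"
    using bary_sum(2)[OF det, of "real_vec x"] x by simp
  also have "\<dots> = (\<Sum>k\<in>UNIV. (of_int m * b $ k) *\<^sub>R real_vec (v k))" by (simp add: scaleR_sum_right)
  also have "\<dots> = (of_int m * b $ k0) *\<^sub>R real_vec (v k0) + (\<Sum>j\<in>UNIV. (of_int m * c j) *\<^sub>R real_vec (v (g j)))"
    by (simp add: sumU bg)
  finally have mx: "of_int m *\<^sub>R real_vec x = (of_int m * b $ k0) *\<^sub>R real_vec (v k0) + (\<Sum>j\<in>UNIV. (of_int m * c j) *\<^sub>R real_vec (v (g j)))" .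
  have rem: "(\<Sum>j\<in>UNIV. h j) = h 7 + (\<Sum>j\<in>UNIV - {7}. h j)" for h :: "7 \<Rightarrow> 'b::comm_monoid_add"
    by (rule sum.remove) auto
  have mc: "of_int m * c j = (if j = 7 then 1 else - of_int (w $ j))" for j using d(2) by (simp add: c_def)
  have Pw: "P *v w + v k0 = v (g 7)"
  proof -
    have mb0: "of_int m * b $ k0 = of_int m - 1 + (\<Sum>j\<in>UNIV - {7}. of_int (w $ j))"
      unfolding b0 right_diff_distrib sum_distrib_left mc by (subst rem) (simp add: sum_negf)
    have "P *v w = w $ 7 *s (x - v k0) + (\<Sum>j\<in>UNIV - {7}. w $ j *s (v (g j) - v k0))"
      unfolding Pv f_def u_def using bij by (subst rem) (auto simp: inj_eq intro!: sum.cong)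
    then have "real_vec (P *v w) = of_int m *\<^sub>R real_vec x - of_int m *\<^sub>R real_vec (v k0) +
        (\<Sum>j\<in>UNIV - {7}. of_int (w $ j) *\<^sub>R (real_vec (v (g j)) - real_vec (v k0)))"
      by (simp add: w7 vec_eq_iff real_vec_def right_diff_distrib)
    also have "\<dots> = real_vec (v (g 7)) - real_vec (v k0)"
      unfolding mx mb0 mc by (subst rem)
        (simp add: scaleR_diff_left scaleR_add_left scaleR_diff_right sum_subtractf scaleR_sum_left sum_negf)
    finally have "real_vec (P *v w + v k0) = real_vec (v (g 7))" by (simp add: real_vec_simps)
    then show ?thesis by (simp only: real_vec_inject)
  qed
  have "(\<lambda>y. P *v y + v k0) ` insert w (insert 0 ((\<lambda>j. axis j 1) ` (UNIV - {7}))) = range v"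
  proof -
    have "f j + v k0 = v (g j)" if "j \<noteq> 7" for j
      using that bij by (simp add: f_def u_def inj_eq)
    then have "(\<lambda>y. P *v y + v k0) ` (\<lambda>j. axis j 1) ` (UNIV - {7}) = (\<lambda>j. v (g j)) ` (UNIV - {7})"
      unfolding image_image Pax by (intro image_cong) auto
    moreover have "range v = insert (v (g 7)) (insert (v k0) ((\<lambda>j. v (g j)) ` (UNIV - {7})))"
      unfolding gU by (auto simp: image_iff)
    ultimately show ?thesis by (simp add: Pw)
  qed
  then have "arith_equivalent (insert w (insert 0 ((\<lambda>j. axis j 1) ` (UNIV - {7})))) (range v)"
    using inv unfolding arith_equivalent_def by blast
  then show ?thesis by (rule arith_equivalent_sym)
qed

section \<open>The eleven representatives\<close>

text \<open>A copy of \<open>apex\<close> as lists, on which the finite checks can be evaluated;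
  \<open>apex_nth\<close> relates the two.\<close>

definition rep_apex :: "nat \<Rightarrow> int list" where
  "rep_apex i = [[0, 0, 0, 0, 0, 0, 1],
     [1, 1, 1, 1, 1, 1, 2],
     [0, 0, 1, 1, 1, 1, 2],
     [1, 2, 2, 2, 2, 2, 3],
     [1, 1, 1, 2, 2, 2, 3],
     [0, 1, 1, 2, 2, 2, 3],
     [1, 1, 1, 1, 1, 3, 4],
     [1, 1, 1, 1, 2, 2, 4],
     [1, 1, 1, 2, 2, 3, 4],
     [1, 1, 3, 3, 3, 4, 5],
     [1, 1, 1, 1, 2, 3, 5]] ! (i - 1)"

text \<open>Coefficients of the form that is diagonal in barycentric coordinates, in the order of
  \<open>vertices7\<close>. Vertices with equal residues carry equal weights.\<close>

definition rep_weights :: "nat \<Rightarrow> int list" where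
  "rep_weights i = [[1, 1, 1, 1, 1, 1, 1, 1],
     [1, 1, 1, 1, 1, 1, 1, 1],
     [1, 1, 1, 1, 1, 1, 1, 1],
     [1, 1, 1, 1, 1, 1, 1, 1],
     [1, 1, 1, 1, 1, 1, 1, 1],
     [2, 1, 3, 3, 2, 2, 2, 2],
     [1, 1, 1, 1, 1, 1, 2, 2],
     [1, 1, 1, 1, 1, 1, 1, 2],
     [2, 2, 2, 2, 1, 1, 2, 2],
     [20, 20, 20, 11, 11, 11, 19, 19],
     [26, 33, 33, 33, 33, 26, 39, 54]] ! (i - 1)"

text \<open>For each nonzero class, a lattice point (barycentric coordinates times the index) minimizing
  the diagonal form with weights \<open>rep_weights i\<close>, and its Lagrange multiplier.\<close>

definition rep_minima :: "nat \<Rightarrow> (int list \<times> int) list" where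
  "rep_minima i = [[],
     [([-1, -1, -1, 1, 1, 1, 1, 1], 2)],
     [([-1, 0, 0, -1, 1, 1, 1, 1], 2)],
     [([-2, -1, 1, 1, 1, 1, 1, 1], 4), ([-1, 1, -1, -1, -1, 2, 2, 2], 2)],
     [([-1, -1, -1, 2, 1, 1, 1, 1], 2), ([1, 1, 1, 1, -1, -1, -1, 2], 2)],
     [([1, -3, -1, 2, 1, 1, 1, 1], 6), ([-1, 0, 1, 1, -1, -1, 2, 2], 4)],
     [([-1, -1, -1, -1, 3, 3, 1, 1], 2), ([-2, -2, -2, 2, 2, 2, 2, 2], 4), ([1, 1, 1, 1, 1, 1, -1, -1], 4)],
     [([-1, -1, -1, -1, 3, 2, 2, 1], 2), ([-2, -2, 2, 2, 2, 0, 0, 2], 4), ([1, 1, 1, 1, 1, -2, -2, 3], 4)],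
     [([1, -1, -1, -1, 2, 2, 1, 1], 4), ([-2, -2, 2, 2, 0, 0, 2, 2], 8), ([-1, 1, 1, 1, -2, -2, 3, 3], 4)],
     [([-1, -1, -1, 2, 2, 2, 1, 1], 40), ([-2, 3, 3, -1, -1, -1, 2, 2], 80), ([2, 2, 2, 1, 1, 1, -2, -2], 76), ([1, 1, 1, -2, 3, 3, -1, -1], 44)],
     [([3, -1, -1, -1, -1, 3, 2, 1], 66), ([1, -2, -2, 3, 3, 1, -1, 2], 132), ([-1, -3, 2, 2, 2, -1, 1, 3], 198), ([-3, 1, 1, 1, 1, 2, 3, -1], 156)]] ! (i - 1)"

text \<open>Numerators, modulo the index, of the barycentric coordinates of \<open>e_7\<close>. This
  class generates the quotient, because 0 and the other unit vectors are vertices.\<close>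

definition rep_class :: "nat \<Rightarrow> int list" where
  "rep_class i = (let w = rep_apex i in (sum_list (butlast w) - 1) # map uminus (butlast w) @ [1])"

definition rep_index :: "nat \<Rightarrow> int" where
  "rep_index i = last (rep_apex i)"

definition pos7 :: "7 \<Rightarrow> nat" where
  "pos7 j = (if j = 1 then 0 else if j = 2 then 1 else if j = 3 then 2 else if j = 4 then 3
     else if j = 5 then 4 else if j = 6 then 5 else 6)"

definition vertices7 :: "7 option list" where
  "vertices7 = [None, Some 1, Some 2, Some 3, Some 4, Some 5, Some 6, Some 7]"

lemma reps: "{1..11} = {1, 2, 3, 4, 5, 6, 7, 8, 9, 10, 11 :: nat}"
proof -
  have "{1..11} = set [1..<12 :: nat]" by auto
  also have "[1..<12] = [1, 2, 3, 4, 5, 6, 7, 8, 9, 10, 11 :: nat]" by (simp add: upt_rec)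
  finally show ?thesis by simp
qed

lemma ball_rep: "(\<forall>i\<in>{1..11}. P i) \<longleftrightarrow> list_all P [1, 2, 3, 4, 5, 6, 7, 8, 9, 10, 11 :: nat]"
  unfolding reps by simp

lemma apex_nth: "i \<in> {1..11} \<Longrightarrow> apex i $ j = rep_apex i ! pos7 j"
proof -
  have "\<forall>i\<in>{1..11}. \<forall>j. apex i $ j = rep_apex i ! pos7 j"
    unfolding forall_7 ball_rep by (simp add: apex_def rep_apex_def pos7_def)
  then show "i \<in> {1..11} \<Longrightarrow> apex i $ j = rep_apex i ! pos7 j" by blast
qed

lemma rep_apex_facts:
  "\<forall>i\<in>{1..11}. length (rep_apex i) = 8 - 1 \<and> rep_index i > 0 \<and> rep_apex i ! 6 = rep_index i"
  unfolding ball_rep by code_simp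

lemma mset_vertices7: "mset vertices7 = mset_set UNIV"
proof -
  have "distinct vertices7" by (simp add: vertices7_def)
  moreover have "set vertices7 = UNIV"
    using UNIV_7 by (auto simp: vertices7_def UNIV_option_conv)
  ultimately show ?thesis by (metis mset_set_set)
qed

lemma sum_vertices7: "(\<Sum>k\<in>UNIV. f k) = (\<Sum>j<8. f (vertices7 ! j))"
  for f :: "7 option \<Rightarrow> 'b::comm_monoid_add"
proof -
  have "(\<Sum>k\<in>UNIV. f k) = sum_list (map f vertices7)"
    by (metis mset_map mset_vertices7 sum_mset_sum_list sum_unfold_sum_mset)
  moreover have "length vertices7 = 8" by (simp add: vertices7_def)
  ultimately show ?thesis by (simp add: sum_list_sum_nth atLeast0LessThan cong: sum.cong_simp)
qed

definition rep_vertex :: "nat \<Rightarrow> 7 option \<Rightarrow> int ^ 7" where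
  "rep_vertex i k = (case k of None \<Rightarrow> 0 | Some j \<Rightarrow> if j = 7 then apex i else axis j 1)"

lemma range_rep_vertex: "range (rep_vertex i) = rep_simplex i"
proof -
  have "range (rep_vertex i) = rep_vertex i ` set vertices7"
    using mset_vertices7 by (metis finite finite_set_mset_mset_set set_mset_mset)
  then show ?thesis by (auto simp: vertices7_def rep_vertex_def rep_simplex_def)
qed

lemma UNIV_7_diff: "(UNIV :: 7 set) - {7} = {1, 2, 3, 4, 5, 6}"
  unfolding UNIV_7 by auto

lemma rep_simplex_eq: "rep_simplex i = insert (apex i) (insert 0 ((\<lambda>j. axis j 1) ` (UNIV - {7})))"
  unfolding UNIV_7_diff by (auto simp: rep_simplex_def)

text \<open>\<open>rep_coord i x\<close> is \<open>m\<close> times the vector of barycentric coordinates of \<open>x\<close>.\<close>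

definition rep_coord :: "nat \<Rightarrow> ('a::comm_ring_1) ^ 7 \<Rightarrow> 7 option \<Rightarrow> 'a" where
  "rep_coord i x k = (let m = of_int (rep_index i);
      c = (\<lambda>j. if j = 7 then x $ 7 else m * x $ j - of_int (apex i $ j) * x $ 7) in
    case k of None \<Rightarrow> m - (\<Sum>j\<in>UNIV. c j) | Some j \<Rightarrow> c j)"

lemma sum_7: "(\<Sum>j\<in>(UNIV :: 7 set). f j) = f 7 + (\<Sum>j\<in>UNIV - {7}. f j)"
  for f :: "7 \<Rightarrow> 'b::comm_monoid_add"
  by (rule sum.remove) auto

lemma det_rep_vertex:
  assumes "i \<in> {1..11}"
  shows "det (vmat (rep_vertex i)) \<noteq> 0"
proof
  assume "det (vmat (rep_vertex i)) = 0"
  then have "\<not> (\<exists>B. B ** real_mat (vmat (rep_vertex i)) = mat 1)"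
    by (metis det_real_mat invertible_det_nz invertible_left_inverse of_int_0)
  then obtain a where a: "real_mat (vmat (rep_vertex i)) *v a = 0" "a \<noteq> 0"
    by (auto simp: matrix_left_invertible_ker)
  have m: "rep_index i > 0" "apex i $ 7 = rep_index i"
    using rep_apex_facts assms apex_nth[OF assms, of 7] by (auto simp: pos7_def)
  have s: "(\<Sum>k\<in>UNIV. a $ k) = 0" "(\<Sum>k\<in>UNIV. a $ k *\<^sub>R real_vec (rep_vertex i k)) = 0"
    using vmat_mult_eq_iff[of "rep_vertex i" a 0 0] a(1) by auto
  have comp: "(if r = 7 then 0 else a $ Some r) + a $ Some 7 * of_int (apex i $ r) = 0" for r
  proof -
    have "0 = (\<Sum>k\<in>UNIV. a $ k *\<^sub>R real_vec (rep_vertex i k)) $ r" by (simp add: s(2))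
    also have "\<dots> = a $ Some 7 * of_int (apex i $ r) + (\<Sum>j\<in>UNIV - {7}. a $ Some j * of_int ((axis j 1 :: int ^ 7) $ r))"
      by (simp add: sum_option sum_7 rep_vertex_def real_vec_def)
    also have "(\<Sum>j\<in>UNIV - {7}. a $ Some j * of_int ((axis j 1 :: int ^ 7) $ r)) =
        (\<Sum>j\<in>UNIV - {7}. if j = r then a $ Some r else 0)"
      by (intro sum.cong) (auto simp: axis_def)
    also have "\<dots> = (if r = 7 then 0 else a $ Some r)" by simp
    finally show ?thesis by simp
  qed
  have a7: "a $ Some 7 = 0" using comp[of 7] m by simp
  then have aS: "a $ Some r = 0" for r using comp[of r] by (cases "r = 7") auto
  then have "a $ None = 0" using s(1) by (simp add: sum_option)
  then have "a = 0" using aS by (simp add: vec_eq_iff split_option_all)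
  then show False using a(2) by simp
qed

lemma bary_rep_vertex:
  assumes "i \<in> {1..11}"
  shows "bary (rep_vertex i) x $ k = rep_coord i x k / of_int (rep_index i)"
proof -
  have m: "rep_index i > 0" "apex i $ 7 = rep_index i"
    using rep_apex_facts assms apex_nth[OF assms, of 7] by (auto simp: pos7_def)
  define b :: "real ^ 7 option" where "b = (\<chi> k. rep_coord i x k / of_int (rep_index i))"
  have "(\<Sum>k\<in>UNIV. b $ k) = 1"
    using m by (simp add: b_def sum_option rep_coord_def Let_def flip: sum_divide_distrib)
  moreover have "(\<Sum>k\<in>UNIV. b $ k *\<^sub>R real_vec (rep_vertex i k)) = x"
  proof -
    have "(\<Sum>k\<in>UNIV. b $ k *\<^sub>R real_vec (rep_vertex i k)) $ r = x $ r" for r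
    proof -
      have "(\<Sum>k\<in>UNIV. b $ k *\<^sub>R real_vec (rep_vertex i k)) $ r =
          b $ Some 7 * of_int (apex i $ r) + (\<Sum>j\<in>UNIV - {7}. b $ Some j * of_int ((axis j 1 :: int ^ 7) $ r))"
        by (simp add: sum_option sum_7 rep_vertex_def real_vec_def)
      also have "(\<Sum>j\<in>UNIV - {7}. b $ Some j * of_int ((axis j 1 :: int ^ 7) $ r)) =
          (\<Sum>j\<in>UNIV - {7}. if j = r then b $ Some r else 0)"
        by (intro sum.cong) (auto simp: axis_def)
      also have "\<dots> = (if r = 7 then 0 else b $ Some r)" by simp
      finally have eq: "(\<Sum>k\<in>UNIV. b $ k *\<^sub>R real_vec (rep_vertex i k)) $ r =
          b $ Some 7 * of_int (apex i $ r) + (if r = 7 then 0 else b $ Some r)" .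
      have b7: "b $ Some 7 = x $ 7 / of_int (rep_index i)" by (simp add: b_def rep_coord_def)
      show ?thesis
      proof (cases "r = 7")
        case True
        then show ?thesis unfolding eq b7 using m by simp
      next
        case False
        then have "b $ Some r = x $ r - of_int (apex i $ r) * (x $ 7 / of_int (rep_index i))"
          using m(1) by (simp add: b_def rep_coord_def diff_divide_distrib)
        then show ?thesis unfolding eq b7 using False by simp
      qed
    qed
    then show ?thesis by (simp add: vec_eq_iff)
  qed
  ultimately have "b = bary (rep_vertex i) x" using iffD2[OF bary_eq_iff[OF det_rep_vertex[OF assms]]] by blast
  then show ?thesis by (metis b_def vec_lambda_beta)
qed

lemma rep_coord_real_vec: "rep_coord i (real_vec x) k = of_int (rep_coord i x k)"
  by (auto simp: rep_coord_def Let_def real_vec_simps intro!: sum.cong split: option.split)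

lemma rep_coord_sum: "(\<Sum>k\<in>UNIV. rep_coord i x k) = of_int (rep_index i)"
  by (simp add: sum_option rep_coord_def Let_def)

lemma rep_coord_class:
  fixes x :: "int ^ 7"
  assumes "i \<in> {1..11}" "j < 8"
  shows "rep_index i dvd rep_coord i x (vertices7 ! j) - x $ 7 * rep_class i ! j"
proof -
  have "length (rep_apex i) = Suc (Suc (Suc (Suc (Suc (Suc (Suc 0))))))" using rep_apex_facts assms(1) by auto
  then obtain w1 w2 w3 w4 w5 w6 w7 where w: "rep_apex i = [w1, w2, w3, w4, w5, w6, w7]"
    by (simp only: length_Suc_conv length_0_conv) blast
  have rc: "rep_class i = [w1 + w2 + w3 + w4 + w5 + w6 - 1, - w1, - w2, - w3, - w4, - w5, - w6, 1]"
    by (simp add: rep_class_def w)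
  have apex: "apex i $ 1 = w1" "apex i $ 2 = w2" "apex i $ 3 = w3" "apex i $ 4 = w4" "apex i $ 5 = w5"
    "apex i $ 6 = w6"
    unfolding apex_nth[OF assms(1)] w by (simp_all add: pos7_def)
  have "rep_coord i x None - x $ 7 * (w1 + w2 + w3 + w4 + w5 + w6 - 1) =
      rep_index i * (1 - x $ 1 - x $ 2 - x $ 3 - x $ 4 - x $ 5 - x $ 6)"
  proof -
    have "rep_coord i x None = rep_index i - (x $ 7 + (rep_index i * x $ 1 - w1 * x $ 7) + (rep_index i * x $ 2 - w2 * x $ 7) +
        (rep_index i * x $ 3 - w3 * x $ 7) + (rep_index i * x $ 4 - w4 * x $ 7) +
        (rep_index i * x $ 5 - w5 * x $ 7) + (rep_index i * x $ 6 - w6 * x $ 7))"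
      unfolding rep_coord_def Let_def option.case sum_7 UNIV_7_diff by (simp add: apex add.assoc)
    then show ?thesis by algebra
  qed
  then have "rep_index i dvd rep_coord i x None - x $ 7 * (w1 + w2 + w3 + w4 + w5 + w6 - 1)" by simp
  then have "\<forall>j<8. rep_index i dvd rep_coord i x (vertices7 ! j) - x $ 7 * rep_class i ! j"
    unfolding all_less_8 by (simp add: rc vertices7_def rep_coord_def Let_def apex)
  then show ?thesis using assms(2) by blast
qed

section \<open>Diagonal forms and the Delaunay property of the representatives\<close>

text \<open>The square of coordinate \<open>k\<close> is 1 at vertex \<open>k\<close> and 0 at the
  others, so its affine interpolant is the coordinate itself.\<close>

lemma interp_gap_square:
  assumes "det (vmat v) \<noteq> 0"
  shows "\<exists>a. (\<forall>x. interp_gap (outer a a) v x = (bary v x $ k)\<^sup>2 - bary v x $ k) \<and>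
    (\<forall>x. a \<bullet> x = bary v x $ k - bary v 0 $ k)"
proof -
  have "bary v x $ k = (\<Sum>i\<in>UNIV. bary v x $ i * axis k 1 $ i)" for x
    using sum_axis_mult[of k "\<lambda>i. bary v x $ i"] by (simp add: mult.commute)
  then obtain a s where a: "\<And>x. bary v x $ k = a \<bullet> x + s"
    using bary_affine[OF assms, of "\<lambda>i. axis k 1 $ i"] by auto
  have q: "qf (outer a a) z = (bary v z $ k - s)\<^sup>2" for z
    unfolding qf_outer a by (simp add: power2_eq_square)
  have "interp_gap (outer a a) v x = (bary v x $ k)\<^sup>2 - bary v x $ k" for x
  proof -
    have "bary v x $ i * qf (outer a a) (real_vec (v i)) =
        s * s * bary v x $ i + (1 - 2 * s) * (axis k 1 $ i * bary v x $ i)" for i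
      unfolding q bary_vertex[OF assms] by (auto simp: axis_def power2_eq_square algebra_simps)
    then have "(\<Sum>i\<in>UNIV. bary v x $ i * qf (outer a a) (real_vec (v i))) = s * s + (1 - 2 * s) * bary v x $ k"
      using bary_sum(1)[OF assms, of x] by (simp add: sum.distrib sum_axis_mult flip: sum_distrib_left)
    then show ?thesis by (simp add: interp_gap_def q power2_eq_square algebra_simps)
  qed
  then show ?thesis using a by (intro exI[of _ a]) simp
qed

lemma delaunay_diagonal:
  fixes v :: "'n::finite option \<Rightarrow> int ^ 'n"
  assumes d: "det (vmat v) \<noteq> 0" and s: "\<And>k. s k > 0"
    and pos: "\<And>x. x \<notin> range v \<Longrightarrow>
      (\<Sum>k\<in>UNIV. s k * ((bary v (real_vec x) $ k)\<^sup>2 - bary v (real_vec x) $ k)) > 0"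
  shows "delaunay_simplex (range v)"
proof -
  have "\<forall>k. \<exists>a. (\<forall>x. interp_gap (outer a a) v x = (bary v x $ k)\<^sup>2 - bary v x $ k) \<and>
    (\<forall>x. a \<bullet> x = bary v x $ k - bary v 0 $ k)"
    using interp_gap_square[OF d] by blast
  then obtain a where a: "\<And>k x. interp_gap (outer (a k) (a k)) v x = (bary v x $ k)\<^sup>2 - bary v x $ k"
    "\<And>k x. a k \<bullet> x = bary v x $ k - bary v 0 $ k" by metis
  define Q where "Q = (\<Sum>k\<in>UNIV. s k *\<^sub>R outer (a k) (a k))"
  have q: "qf Q x = (\<Sum>k\<in>UNIV. s k * qf (outer (a k) (a k)) x)" for x
    unfolding Q_def by (simp add: qf_sum)
  have "posdef Q"
    unfolding posdef_def
  proof (intro conjI allI impI)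
    have "Q $ i $ j = Q $ j $ i" for i j by (simp add: Q_def outer_def mult.commute)
    then show "transpose Q = Q" by (simp add: transpose_def vec_eq_iff)
    fix x :: "real ^ 'n" assume "x \<noteq> 0"
    then have "bary v x \<noteq> bary v 0" using bary_sum(2)[OF d] by metis
    then obtain k where "bary v x $ k \<noteq> bary v 0 $ k" by (auto simp: vec_eq_iff)
    then have "0 < s k * qf (outer (a k) (a k)) x"
      using s by (auto simp: qf_outer a(2) zero_less_mult_iff linorder_neq_iff)
    also have "\<dots> \<le> qf Q x"
      unfolding q by (intro member_le_sum mult_nonneg_nonneg) (simp_all add: less_imp_le[OF s] qf_outer)
    finally show "qf Q x > 0" .
  qed
  moreover have "interp_gap Q v x = (\<Sum>k\<in>UNIV. s k * ((bary v x $ k)\<^sup>2 - bary v x $ k))" for x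
    using interp_gap_sum[OF q] by (simp add: a(1))
  ultimately show ?thesis
    using d pos unfolding delaunay_simplex_iff empty_sphere_def by (intro exI[of _ Q] exI[of _ v]) simp
qed

text \<open>The point \<open>p\<close> minimizes the separable function in its class; \<open>\<nu>\<close> is a Lagrange multiplier for
  the constraint on the sum.\<close>

lemma class_positive:
  fixes s t p :: "'k \<Rightarrow> int"
  assumes "finite I" "m > 0" "sum p I = m" "sum t I = m" "\<And>j. j \<in> I \<Longrightarrow> m dvd t j - p j"
    and "\<And>j. j \<in> I \<Longrightarrow> \<bar>s j * (2 * p j - m) + \<nu>\<bar> \<le> s j * m"
    and "(\<Sum>j\<in>I. s j * (p j * (p j - m))) > 0"
  shows "(\<Sum>j\<in>I. s j * (t j * (t j - m))) > 0"
proof -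
  have "s j * (p j * (p j - m)) - \<nu> * (t j - p j) \<le> s j * (t j * (t j - m))" if j: "j \<in> I" for j
  proof -
    define c where "c = s j * (2 * p j - m) + \<nu>"
    obtain n where n: "t j - p j = m * n" using assms(5)[OF j] by blast
    have c: "\<bar>c\<bar> \<le> s j * m" using assms(6)[OF j] by (simp add: c_def)
    then have "0 \<le> s j * m" by linarith
    have "0 \<le> n * (s j * m * n + c)"
    proof (cases n "0 :: int" rule: linorder_cases)
      case less
      then have "s j * m * n \<le> s j * m * (-1)" using \<open>0 \<le> s j * m\<close> by (intro mult_left_mono) auto
      then have "s j * m * n + c \<le> 0" using c by linarith
      then show ?thesis using less by (simp add: mult_nonpos_nonpos)
    next
      case greater
      then have "s j * m * 1 \<le> s j * m * n" using \<open>0 \<le> s j * m\<close> by (intro mult_left_mono) auto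
      then have "0 \<le> s j * m * n + c" using c by linarith
      then show ?thesis using greater by simp
    qed simp
    then have "0 \<le> m * (n * (s j * m * n + c))" using assms(2) by simp
    also have "\<dots> = (t j - p j) * (s j * (t j - p j) + c)" unfolding n by (simp add: algebra_simps)
    also have "\<dots> = s j * (t j * (t j - m)) - s j * (p j * (p j - m)) + \<nu> * (t j - p j)"
      by (simp add: c_def algebra_simps)
    finally show ?thesis by simp
  qed
  then have "(\<Sum>j\<in>I. s j * (p j * (p j - m)) - \<nu> * (t j - p j)) \<le> (\<Sum>j\<in>I. s j * (t j * (t j - m)))"
    by (rule sum_mono)
  moreover have "(\<Sum>j\<in>I. s j * (p j * (p j - m)) - \<nu> * (t j - p j)) = (\<Sum>j\<in>I. s j * (p j * (p j - m)))"
    using assms(3,4) by (simp add: sum_subtractf flip: sum_distrib_left)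
  ultimately show ?thesis using assms(7) by linarith
qed

text \<open>Entry \<open>k\<close> of the table belongs to \<open>k\<close> times the generator. The
  bound with \<nu> is the optimality condition required by \<open>class_positive\<close>.\<close>

definition minima_ok :: "nat \<Rightarrow> bool" where
  "minima_ok i = (let m = rep_index i; s = rep_weights i; u = rep_class i in
    list_all (\<lambda>x. x > 0) s \<and>
    list_all (\<lambda>(k, p, \<nu>). sum_list (map ((!) p) [0..<8]) = m \<and>
      list_all (\<lambda>j. (k * u ! j - p ! j) mod m = 0 \<and> \<bar>s ! j * (2 * p ! j - m) + \<nu>\<bar> \<le> s ! j * m) [0..<8] \<and>
      sum_list (map (\<lambda>j. s ! j * (p ! j * (p ! j - m))) [0..<8]) > 0)
      (zip [1..m - 1] (rep_minima i)) \<and> int (length (rep_minima i)) = m - 1 \<and> length s = 8)"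

lemma minima_ok: "\<forall>i\<in>{1..11}. minima_ok i"
  unfolding ball_rep by code_simp

lemma sum_list_8: "sum_list (map f [0..<8]) = (\<Sum>j<8. f j)" for f :: "nat \<Rightarrow> int"
  by (simp add: interv_sum_list_conv_sum_set_nat atLeast0LessThan)

lemma vertices7_index: "\<exists>j<8. vertices7 ! j = k"
proof -
  have "k \<in> set vertices7" using mset_vertices7 by (metis UNIV_I finite finite_set_mset_mset_set set_mset_mset)
  moreover have "length vertices7 = 8" by (simp add: vertices7_def)
  ultimately show ?thesis by (metis in_set_conv_nth)
qed

lemma delaunay_rep:
  assumes i: "i \<in> {1..11}"
  shows "delaunay_simplex (rep_simplex i)"
proof -
  define m where "m = rep_index i"
  define s where "s = rep_weights i"
  have m: "m > 0" "apex i $ 7 = m"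
    using rep_apex_facts i apex_nth[OF i, of 7] by (auto simp: pos7_def m_def)
  note ok = minima_ok[rule_format, OF i, unfolded minima_ok_def Let_def, folded m_def s_def]
  have s: "length s = 8" "\<And>j. j < 8 \<Longrightarrow> s ! j > 0" using ok by (auto simp: list_all_length)
  define f where "f k = (SOME j. j < 8 \<and> vertices7 ! j = k)" for k
  have f: "f k < 8" "vertices7 ! f k = k" for k
    unfolding f_def using someI_ex[OF vertices7_index[unfolded Bex_def, of k]] by auto
  have dist: "distinct vertices7" by (simp add: vertices7_def)
  have fv: "f (vertices7 ! j) = j" if "j < 8" for j
    using f[of "vertices7 ! j"] that dist by (simp add: nth_eq_iff_index_eq vertices7_def)
  have main: "(\<Sum>j<8. s ! j * (t j * (t j - m))) > 0"
    if t: "t = (\<lambda>j. rep_coord i x (vertices7 ! j))" and x: "x \<notin> range (rep_vertex i)" for t and x :: "int ^ 7"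
  proof -
    have sum_t: "(\<Sum>j<8. t j) = m"
      using rep_coord_sum[of i x] unfolding sum_vertices7 t m_def by simp
    have cl: "m dvd t j - x $ 7 * rep_class i ! j" if "j < 8" for j
      using rep_coord_class[OF i that, of x] by (simp add: t m_def)
    define k where "k = x $ 7 mod m"
    have clk: "m dvd t j - k * rep_class i ! j" if "j < 8" for j
    proof -
      have "t j mod m = x $ 7 * rep_class i ! j mod m" using cl[OF that] by (simp add: mod_eq_dvd_iff)
      also have "\<dots> = k * rep_class i ! j mod m" by (simp add: k_def mod_mult_left_eq)
      finally show ?thesis by (simp add: mod_eq_dvd_iff)
    qed
    have k: "0 \<le> k" "k < m" using m by (simp_all add: k_def)
    show ?thesis
    proof (cases "k = 0")
      case False
      define p where "p = fst (rep_minima i ! nat (k - 1))"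
      define \<nu> where "\<nu> = snd (rep_minima i ! nat (k - 1))"
      have len: "int (length (rep_minima i)) = m - 1" using ok by simp
      have nk: "nat (k - 1) < length (rep_minima i)" using len k False by linarith
      have "zip [1..m - 1] (rep_minima i) ! nat (k - 1) = (k, p, \<nu>)"
        using nk k False len by (simp add: p_def \<nu>_def nth_upto)
      moreover have "nat (k - 1) < length (zip [1..m - 1] (rep_minima i))" using nk len by simp
      ultimately have "(k, p, \<nu>) \<in> set (zip [1..m - 1] (rep_minima i))" by (metis nth_mem)
      then have c: "sum_list (map ((!) p) [0..<8]) = m"
        "\<And>j. j < 8 \<Longrightarrow> (k * rep_class i ! j - p ! j) mod m = 0"
        "\<And>j. j < 8 \<Longrightarrow> \<bar>s ! j * (2 * p ! j - m) + \<nu>\<bar> \<le> s ! j * m"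
        "sum_list (map (\<lambda>j. s ! j * (p ! j * (p ! j - m))) [0..<8]) > 0"
        using ok unfolding list_all_iff by (fastforce)+
      have "m dvd t j - p ! j" if "j < 8" for j
        using dvd_add[OF clk[OF that], of "k * rep_class i ! j - p ! j"] c(2)[OF that] by (simp add: mod_eq_0_iff_dvd)
      then show ?thesis
        using c(1,3,4) m(1) sum_t unfolding sum_list_8
        by (intro class_positive[of "{..<8}" m "(!) p" t "(!) s" \<nu>]) auto
    next
      case True
      \<comment> \<open>In the trivial class the coordinates are integers \<open>n\<close>, and
        \<open>n (n - 1)\<close> is nonnegative and zero only for 0 and 1. If the weighted sum were
        zero, exactly one coordinate would be 1 and the point a vertex.\<close>
      have "\<exists>n. t j = m * n" if "j < 8" for j using clk[OF that] True by (auto simp: dvd_def)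
      then obtain n where n: "\<And>j. j < 8 \<Longrightarrow> t j = m * n j" by metis
      have nn: "0 \<le> n j * (n j - 1)" for j by (cases "n j \<le> 0") (auto simp: mult_nonpos_nonpos)
      have eq: "s ! j * (t j * (t j - m)) = m * m * (s ! j * (n j * (n j - 1)))" if "j < 8" for j
        unfolding n[OF that] by (simp add: algebra_simps)
      have ge: "0 \<le> s ! j * (t j * (t j - m))" if "j < 8" for j
        unfolding eq[OF that] using nn s(2)[OF that] m(1) by (simp add: less_imp_le)
      show ?thesis
      proof (rule ccontr)
        assume "\<not> ?thesis"
        then have "(\<Sum>j<8. s ! j * (t j * (t j - m))) = 0" using ge by (intro antisym sum_nonneg) auto
        then have "s ! j * (t j * (t j - m)) = 0" if "j < 8" for j
          using ge that by (subst (asm) sum_nonneg_eq_0_iff) auto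
        then have n01: "n j = 0 \<or> n j = 1" if "j < 8" for j
          using that eq[OF that] s(2)[OF that] m(1) by fastforce
        have "(\<Sum>j<8. m * n j) = m" using sum_t n by simp
        then have "m * (\<Sum>j<8. n j) = m * 1" by (simp add: sum_distrib_left)
        then have sn: "(\<Sum>j<8. n j) = 1" using m(1) by simp
        obtain j where j: "j < 8" "n j = 1"
        proof (rule ccontr)
          assume "\<not> thesis"
          then have "\<forall>j<8. n j = 0" using n01 that by blast
          then show False using sn by simp
        qed
        have "(\<Sum>l\<in>{..<8} - {j}. n l) = 0" using sn j by (simp add: sum.remove[of "{..<8}" j])
        then have "\<forall>l\<in>{..<8} - {j}. n l = 0" using n01 by (subst (asm) sum_nonneg_eq_0_iff) force+
        then have tl: "t l = (if l = j then m else 0)" if "l < 8" for l using n[OF that] j that by auto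
        have "bary (rep_vertex i) (real_vec x) $ k = axis (vertices7 ! j) 1 $ k" for k
        proof -
          have "rep_coord i x k = t (f k)" by (simp add: t f(2))
          also have "\<dots> = (if k = vertices7 ! j then m else 0)"
            using tl[OF f(1)[of k]] fv[OF j(1)] f(2)[of k] by auto
          finally show ?thesis
            using m(1) by (simp add: bary_rep_vertex[OF i] rep_coord_real_vec axis_def flip: m_def)
        qed
        then have "bary (rep_vertex i) (real_vec x) = bary (rep_vertex i) (real_vec (rep_vertex i (vertices7 ! j)))"
          unfolding bary_vertex[OF det_rep_vertex[OF i]] by (simp add: vec_eq_iff)
        then have "x = rep_vertex i (vertices7 ! j)"
          using bary_sum(2)[OF det_rep_vertex[OF i]] by (metis real_vec_inject)
        then show False using x by blast
      qed
    qed
  qed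
  have "delaunay_simplex (range (rep_vertex i))"
  proof (rule delaunay_diagonal[OF det_rep_vertex[OF i], of "\<lambda>k. of_int (s ! f k)"])
    show "0 < real_of_int (s ! f k)" for k using s(2) f(1) by simp
    fix x assume x: "x \<notin> range (rep_vertex i)"
    let ?t = "\<lambda>j. rep_coord i x (vertices7 ! j)"
    have "(\<Sum>k\<in>UNIV. of_int (s ! f k) * ((bary (rep_vertex i) (real_vec x) $ k)\<^sup>2 - bary (rep_vertex i) (real_vec x) $ k))
      = (\<Sum>j<8. of_int (s ! j * (?t j * (?t j - m))) / (of_int m * of_int m))"
      unfolding sum_vertices7 using m(1)
      by (intro sum.cong) (simp_all add: fv bary_rep_vertex[OF i] rep_coord_real_vec power2_eq_square field_simps flip: m_def)
    also have "\<dots> = of_int (\<Sum>j<8. s ! j * (?t j * (?t j - m))) / (of_int m * of_int m)"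
      by (simp add: sum_divide_distrib)
    also have "\<dots> > 0"
      using main[OF refl x] m(1) by (intro divide_pos_pos) (simp_all only: of_int_0_less_iff mult_pos_pos)
    finally show "0 < (\<Sum>k\<in>UNIV. of_int (s ! f k) * ((bary (rep_vertex i) (real_vec x) $ k)\<^sup>2 - bary (rep_vertex i) (real_vec x) $ k))" .
  qed
  then show ?thesis by (simp add: range_rep_vertex)
qed

section \<open>Every Delaunay simplex is equivalent to a representative\<close>

definition rep_residues :: "nat \<Rightarrow> int list" where
  "rep_residues i = map (\<lambda>x. x mod rep_index i) (rep_class i)"

text \<open>Translates the canonical lists of the enumeration into representatives; the first entry
  is the trivial class of a unimodular simplex.\<close>

lemma rep_residues_table:
  "list_all (\<lambda>(m, c). list_ex (\<lambda>i. rep_index i = m \<and> sort (rep_residues i) = c) [1, 2, 3, 4, 5, 6, 7, 8, 9, 10, 11])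
    [(1, [0,0,0,0,0,0,0,0]), (2, [1,1,1,1,1,1,1,1]), (2, [0,0,1,1,1,1,1,1]), (3, [1,1,1,1,1,1,1,2]),
     (3, [1,1,1,1,2,2,2,2]), (3, [0,1,1,1,1,1,2,2]), (4, [1,1,3,3,3,3,3,3]), (4, [1,2,2,3,3,3,3,3]),
     (4, [1,1,1,2,2,3,3,3]), (5, [1,1,2,2,2,4,4,4]), (5, [1,2,3,3,4,4,4,4])]"
  by code_simp

lemma residues_scale:
  assumes "has_order a q"
  shows "residues e q (of_int j *\<^sub>R a) = multiples q (residues e q a) j"
proof -
  have "\<lfloor>of_int q * (of_int j * a $ k)\<rfloor> = j * \<lfloor>of_int q * a $ k\<rfloor>" for k
  proof -
    obtain n where n: "of_int q * a $ k = of_int n"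
      using assms by (auto simp: has_order_def integral_vec_def elim!: allE[of _ k] Ints_cases)
    have "of_int q * (of_int j * a $ k) = of_int (j * n)" using n by (simp add: algebra_simps)
    then show ?thesis by (simp only: n floor_of_int)
  qed
  then show ?thesis by (simp add: residues_def multiples_def mod_mult_right_eq)
qed

text \<open>The enumeration normalises a generator only up to a multiple, so the class is replaced
  by that multiple.\<close>

lemma exists_rep_class:
  fixes v :: "7 option \<Rightarrow> int ^ 7"
  assumes Q: "posdef Q" and v: "empty_sphere Q v" and e: "bij_betw e {..<8} (UNIV :: 7 option set)"
  shows "\<exists>i\<in>{1..11}. \<exists>a\<in>glue_group (vmat v). \<bar>det (vmat v)\<bar> = rep_index i \<and>
    integral_vec (of_int (rep_index i) *\<^sub>R a) \<and> mset (residues e (rep_index i) a) = mset (rep_residues i)"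
proof -
  define m where "m = \<bar>det (vmat v)\<bar>"
  have "det (vmat v) \<noteq> 0" using v by (simp add: empty_sphere_def)
  then have m: "1 \<le> m" "m \<le> 5" using index_le_5[OF Q v] by (simp_all add: m_def)
  let ?T = "[(2, [1,1,1,1,1,1,1,1]), (2, [0,0,1,1,1,1,1,1]), (3, [1,1,1,1,1,1,1,2]),
     (3, [1,1,1,1,2,2,2,2]), (3, [0,1,1,1,1,1,2,2]), (4, [1,1,3,3,3,3,3,3]), (4, [1,2,2,3,3,3,3,3]),
     (4, [1,1,1,2,2,3,3,3]), (5, [1,1,2,2,2,4,4,4]), (5, [1,2,3,3,4,4,4,4])] :: (int \<times> int list) list"
  have main: "\<exists>a\<in>glue_group (vmat v). integral_vec (of_int m *\<^sub>R a) \<and>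
      (m, sort (residues e m a)) \<in> set ((1, [0,0,0,0,0,0,0,0]) # ?T)"
  proof (cases "m = 1")
    case True
    have "residues e 1 0 = [0,0,0,0,0,0,0,0]" by (simp add: residues_def upt_rec)
    then show ?thesis
      using True by (intro bexI[of _ 0]) (simp_all add: integral_vec_def glue_group_def)
  next
    case False
    then have "m \<in> {2, 3, 4, 5}" using m by auto
    note cl = index_class_empty_sphere[OF Q v e]
    obtain a where a: "a \<in> glue_group (vmat v)" "has_order a m"
      using exists_index_order[OF cl] \<open>m \<in> {2, 3, 4, 5}\<close> unfolding m_def by blast
    note g = glue_class_residues[OF cl a]
    obtain d where d: "glue 8 {a. \<exists>b\<in>glue_group (vmat v). \<forall>i<8. a i = b $ e i} d"
      using cl by (auto simp: index_class_def)
    have "\<exists>j. (m, sort (multiples m (residues e m a) j)) \<in> set ?T"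
      using \<open>m \<in> {2, 3, 4, 5}\<close> class_canonical[OF d _ _ classes_2] class_canonical[OF d _ _ classes_3]
        class_canonical[OF d _ _ classes_4] canonical_5[OF d] g
      by (elim insertE) fastforce+
    then obtain j where j: "(m, sort (residues e m (of_int j *\<^sub>R a))) \<in> set ?T"
      unfolding residues_scale[OF a(2)] by blast
    have "integral_vec (of_int m *\<^sub>R a)" using a(2) by (simp add: has_order_def)
    then have "integral_vec (of_int j *\<^sub>R (of_int m *\<^sub>R a))"
      by (rule integral_vec_scaleR[OF Ints_of_int])
    then have "integral_vec (of_int m *\<^sub>R (of_int j *\<^sub>R a))" by (simp add: mult.commute)
    moreover have "of_int j *\<^sub>R a \<in> glue_group (vmat v)" using a(1) by (intro glue_group_scaleR) simp_all
    ultimately show ?thesis using j by (intro bexI[of _ "of_int j *\<^sub>R a"]) (simp_all only: list.set insert_iff simp_thms)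
  qed
  then obtain a where a: "a \<in> glue_group (vmat v)" "integral_vec (of_int m *\<^sub>R a)"
    and r: "(m, sort (residues e m a)) \<in> set ((1, [0,0,0,0,0,0,0,0]) # ?T)" by blast
  obtain i where "i \<in> set [1, 2, 3, 4, 5, 6, 7, 8, 9, 10, 11]" and i: "rep_index i = m"
    "sort (rep_residues i) = sort (residues e m a)"
    using bspec[OF rep_residues_table[unfolded list_all_iff] r] unfolding list_ex_iff by blast
  then have "i \<in> {1..11}" unfolding reps by simp
  moreover have "mset (residues e m a) = mset (rep_residues i)" using i(2) by (metis mset_sort)
  ultimately show ?thesis
    unfolding m_def[symmetric] using a by (intro bexI[of _ i] bexI[of _ a]) (simp_all add: i(1))
qed

lemma pos7_facts: "pos7 j < 7" "pos7 j = pos7 k \<longleftrightarrow> j = k"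
proof -
  have "\<forall>j. pos7 j < 7" "\<forall>j k. pos7 j = pos7 k \<longleftrightarrow> j = k"
    unfolding forall_7 by (simp_all add: pos7_def)
  then show "pos7 j < 7" "pos7 j = pos7 k \<longleftrightarrow> j = k" by blast+
qed

lemma rep_class_nth:
  assumes "i \<in> {1..11}"
  shows "length (rep_class i) = 8" "rep_class i ! Suc (pos7 j) = (if j = 7 then 1 else - (apex i $ j))"
proof -
  have "length (rep_apex i) = Suc (Suc (Suc (Suc (Suc (Suc (Suc 0))))))" using rep_apex_facts assms by auto
  then obtain w1 w2 w3 w4 w5 w6 w7 where w: "rep_apex i = [w1, w2, w3, w4, w5, w6, w7]"
    by (simp only: length_Suc_conv length_0_conv) blast
  show "length (rep_class i) = 8" by (simp add: rep_class_def w)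
  have "\<forall>j. rep_class i ! Suc (pos7 j) = (if j = 7 then 1 else - (apex i $ j))"
    unfolding forall_7 apex_nth[OF assms] by (simp add: rep_class_def w pos7_def)
  then show "rep_class i ! Suc (pos7 j) = (if j = 7 then 1 else - (apex i $ j))" by blast
qed

lemma arith_equivalent_rep:
  fixes v :: "7 option \<Rightarrow> int ^ 7"
  assumes i: "i \<in> {1..11}" and e: "bij_betw e {..<8} (UNIV :: 7 option set)"
    and d: "\<bar>det (vmat v)\<bar> = rep_index i" and a: "a \<in> glue_group (vmat v)"
    "integral_vec (of_int (rep_index i) *\<^sub>R a)" "mset (residues e (rep_index i) a) = mset (rep_residues i)"
  shows "arith_equivalent (range v) (rep_simplex i)"
proof -
  define m where "m = rep_index i"
  have m: "m > 0" "apex i $ 7 = m"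
    using rep_apex_facts i apex_nth[OF i, of 7] by (auto simp: pos7_def m_def)
  have len: "length (residues e m a) = 8" by (simp add: residues_def)
  \<comment> \<open>Matches the vertices of \<open>v\<close> with those of the representative by
    residues; position 0 stands for the origin and position 7 for the apex.\<close>
  obtain p where p: "p permutes {..<8}" "permute_list p (residues e m a) = rep_residues i"
    using mset_eq_permutation[OF a(3)[symmetric], folded m_def] unfolding len by blast
  have p8: "p k < 8" if "k < 8" for k using permutes_in_image[OF p(1), of k] that by simp
  have res: "m dvd \<lfloor>of_int m * a $ e (p k)\<rfloor> - rep_class i ! k" if "k < 8" for k
  proof -
    have "rep_residues i ! k = residues e m a ! p k"
      using permute_list_nth[of p "residues e m a" k] p that by (simp add: len)
    then show ?thesis
      using that p8[OF that] rep_class_nth(1)[OF i]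
      by (simp add: residues_def rep_residues_def mod_eq_dvd_iff dvd_diff_commute flip: m_def)
  qed
  have ep: "e (p k) = e (p l) \<longleftrightarrow> k = l" if "k < 8" "l < 8" for k l
    using e p8[OF that(1)] p8[OF that(2)] permutes_inj[OF p(1)] by (auto simp: bij_betw_def inj_on_def)
  define g where "g j = e (p (Suc (pos7 j)))" for j
  have s8: "Suc (pos7 j) < 8" for j using pos7_facts(1)[of j] by simp
  have g: "inj g" "e (p 0) \<notin> range g"
    using ep[OF s8 s8] ep[of 0, OF _ s8] pos7_facts(2) by (auto simp: g_def inj_on_def)
  have ga: "\<exists>n\<in>\<int>. of_int m * a $ g j - of_int (rep_class i ! Suc (pos7 j)) = of_int m * n" for j
  proof -
    obtain t where t: "of_int m * a $ g j = of_int t"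
      using a(2) by (auto simp: integral_vec_def m_def elim!: allE[of _ "g j"] Ints_cases)
    obtain n where n: "t - rep_class i ! Suc (pos7 j) = m * n"
      using res[OF s8[of j]] unfolding g_def[symmetric] t by (auto simp: dvd_def)
    have "of_int m * a $ g j - of_int (rep_class i ! Suc (pos7 j)) = of_int (m * n)"
      unfolding t n[symmetric] by simp
    then show ?thesis by (intro bexI[of _ "of_int n"]) simp_all
  qed
  obtain n where n: "n \<in> \<int>" "of_int m * a $ g 7 - 1 = of_int m * n"
    using ga[of 7] rep_class_nth(2)[OF i, of 7] by auto
  show ?thesis
    unfolding rep_simplex_eq
  proof (rule canonical_form[OF d[folded m_def] m g a(1) n(2,1)])
    show "\<exists>z\<in>\<int>. of_int m * a $ g j + of_int (apex i $ j) = of_int m * z" if "j \<noteq> 7" for j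
      using ga[of j] rep_class_nth(2)[OF i, of j] that by auto
  qed
qed

lemma delaunay_simplex_classification:
  assumes "delaunay_simplex (S :: (int ^ 7) set)"
  shows "\<exists>i\<in>{1..11}. arith_equivalent S (rep_simplex i)"
proof -
  obtain Q v where v: "posdef Q" "empty_sphere Q v" "range v = S"
    using assms unfolding delaunay_simplex_iff by blast
  obtain e where e: "bij_betw e {..<8 :: nat} (UNIV :: 7 option set)" using exists_labelling by blast
  show ?thesis using exists_rep_class[OF v(1,2) e] arith_equivalent_rep[OF _ e] v(3) by blast
qed

section \<open>Inequivalence of the representatives\<close>

definition rep_multiples :: "nat \<Rightarrow> int \<Rightarrow> int list" where
  "rep_multiples i k = sort (map (\<lambda>c. 60 div rep_index i * (k * c mod rep_index i)) (rep_class i))"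

text \<open>Both directions are needed, because the generator of a smaller quotient can be a
  multiple of that of a larger one: the class of \<open>w_2\<close> has the residues of twice the
  class of \<open>w_7\<close>, and the trivial class is a multiple of every class.\<close>

lemma rep_multiples_distinct:
  "list_all (\<lambda>i. list_all (\<lambda>j. i = j \<or>
      \<not> (list_ex (\<lambda>k. rep_multiples i 1 = rep_multiples j k) [0..rep_index j - 1] \<and>
         list_ex (\<lambda>k. rep_multiples j 1 = rep_multiples i k) [0..rep_index i - 1]))
    [1, 2, 3, 4, 5, 6, 7, 8, 9, 10, 11]) [1, 2, 3, 4, 5, 6, 7, 8, 9, 10, 11]"
  by code_simp

lemma rep_index_dvd: "\<forall>i\<in>{1..11}. 60 mod rep_index i = 0"
  unfolding ball_rep by code_simp

lemma sort_rep_coord: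
  fixes x :: "int ^ 7"
  assumes "i \<in> {1..11}"
  shows "mset (rep_multiples i (x $ 7 mod rep_index i)) =
    image_mset (\<lambda>k. 60 div rep_index i * (rep_coord i x k mod rep_index i)) (mset_set UNIV)"
proof -
  let ?m = "rep_index i" and ?h = "\<lambda>k. 60 div rep_index i * (rep_coord i x k mod rep_index i)"
  have "map ?h vertices7 = map (\<lambda>c. 60 div ?m * (x $ 7 mod ?m * c mod ?m)) (rep_class i)"
  proof (rule nth_equalityI)
    show "length (map ?h vertices7) = length (map (\<lambda>c. 60 div ?m * (x $ 7 mod ?m * c mod ?m)) (rep_class i))"
      using rep_class_nth(1)[OF assms] by (simp add: vertices7_def)
    fix j assume "j < length (map ?h vertices7)"
    then have "j < 8" by (simp add: vertices7_def)
    have "rep_coord i x (vertices7 ! j) mod ?m = x $ 7 mod ?m * rep_class i ! j mod ?m"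
      using rep_coord_class[OF assms \<open>j < 8\<close>, of x] by (simp add: mod_eq_dvd_iff[symmetric] mod_mult_left_eq)
    then show "map ?h vertices7 ! j = map (\<lambda>c. 60 div ?m * (x $ 7 mod ?m * c mod ?m)) (rep_class i) ! j"
      using \<open>j < 8\<close> rep_class_nth(1)[OF assms] \<open>j < length (map ?h vertices7)\<close> by simp
  qed
  then show ?thesis unfolding rep_multiples_def mset_sort by (metis mset_map mset_vertices7)
qed

text \<open>Barycentric coordinates are affine invariants; multiplying by \<open>60\<close>, a multiple of every index, and
  reducing modulo \<open>60\<close> turns their fractional parts into integers.\<close>

lemma rep_multiples_equivalent:
  assumes i: "i \<in> {1..11}" and j: "j \<in> {1..11}"
    and eq: "arith_equivalent (rep_simplex i) (rep_simplex j)"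
  shows "\<exists>k\<in>set [0..rep_index j - 1]. rep_multiples i 1 = rep_multiples j k"
proof -
  let ?u = "rep_vertex i" and ?v = "rep_vertex j"
  have m: "rep_index i > 0" "rep_index j > 0" "60 mod rep_index i = 0" "60 mod rep_index j = 0"
    using rep_apex_facts rep_index_dvd i j by auto
  have d: "det (vmat ?v) \<noteq> 0" by (rule det_rep_vertex[OF j])
  obtain A b where A: "(\<lambda>x. A *v x + b) ` range ?u = range ?v"
    using eq unfolding arith_equivalent_def range_rep_vertex by blast
  have "\<exists>k. ?v l = A *v ?u k + b" for l
  proof -
    have "?v l \<in> (\<lambda>x. A *v x + b) ` range ?u" unfolding A by simp
    then show ?thesis by blast
  qed
  then obtain \<rho> where \<rho>: "\<And>l. ?v l = A *v ?u (\<rho> l) + b" by metis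
  have "inj \<rho>"
  proof (rule injI)
    fix k l assume "\<rho> k = \<rho> l"
    then have "?v k = ?v l" by (simp add: \<rho>)
    then have "axis k (1 :: real) = axis l 1" by (metis bary_vertex[OF d])
    then show "k = l" by (simp add: axis_eq_axis)
  qed
  then have bij: "bij \<rho>" by (simp add: bij_def finite_UNIV_inj_surj)
  \<comment> \<open>This lattice point represents the generator; its image lies in some multiple of
    the generator of the other quotient.\<close>
  define x :: "int ^ 7" where "x = axis 7 1"
  define y where "y = A *v x + b"
  have real_A: "real_vec (A *v z + b) = real_mat' *v real_vec z + real_vec b"
    if "real_mat' = (\<chi> r c. of_int (A $ r $ c))" for real_mat' :: "real ^ 7 ^ 7" and z
    by (simp add: that vec_eq_iff real_vec_def matrix_vector_mult_def)
  define M :: "real ^ 7 ^ 7" where "M = (\<chi> r c. of_int (A $ r $ c))"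
  define \<beta> :: "real ^ 7 option" where "\<beta> = (\<chi> l. bary ?u (real_vec x) $ \<rho> l)"
  have "(\<Sum>l\<in>UNIV. \<beta> $ l) = 1"
    using bary_sum(1)[OF det_rep_vertex[OF i], of "real_vec x"]
    by (simp add: \<beta>_def sum.reindex_bij_betw[OF bij, of "\<lambda>k. bary ?u (real_vec x) $ k"])
  moreover have "(\<Sum>l\<in>UNIV. \<beta> $ l *\<^sub>R real_vec (?v l)) = real_vec y"
  proof -
    have "(\<Sum>l\<in>UNIV. \<beta> $ l *\<^sub>R real_vec (?v l)) =
        (\<Sum>l\<in>UNIV. bary ?u (real_vec x) $ \<rho> l *\<^sub>R (M *v real_vec (?u (\<rho> l)) + real_vec b))"
      unfolding \<rho> real_A[OF M_def] by (simp add: \<beta>_def)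
    also have "\<dots> = (\<Sum>k\<in>UNIV. bary ?u (real_vec x) $ k *\<^sub>R (M *v real_vec (?u k) + real_vec b))"
      by (rule sum.reindex_bij_betw[OF bij])
    also have "\<dots> = M *v (\<Sum>k\<in>UNIV. bary ?u (real_vec x) $ k *\<^sub>R real_vec (?u k)) +
        (\<Sum>k\<in>UNIV. bary ?u (real_vec x) $ k) *\<^sub>R real_vec b"
      by (simp add: scaleR_right_distrib sum.distrib scaleR_sum_left matrix_vector_mult_scaleR
          linear_sum[OF matrix_vector_mul_linear])
    also have "\<dots> = real_vec y"
      by (simp add: bary_sum[OF det_rep_vertex[OF i]] y_def real_A[OF M_def])
    finally show ?thesis .
  qed
  ultimately have "\<beta> = bary ?v (real_vec y)" using iffD2[OF bary_eq_iff[OF d]] by blast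
  then have "rep_coord i x (\<rho> l) * rep_index j = rep_coord j y l * rep_index i" for l
  proof -
    have "bary ?u (real_vec x) $ \<rho> l = bary ?v (real_vec y) $ l"
      using \<open>\<beta> = bary ?v (real_vec y)\<close> by (metis \<beta>_def vec_lambda_beta)
    then have "of_int (rep_coord i x (\<rho> l) * rep_index j) = (of_int (rep_coord j y l * rep_index i) :: real)"
      using m by (simp add: bary_rep_vertex[OF i] bary_rep_vertex[OF j] rep_coord_real_vec field_simps)
    then show ?thesis by (simp only: of_int_eq_iff)
  qed
  then have eq: "rep_coord i x (\<rho> l) * rep_index j = rep_coord j y l * rep_index i" for l .
  obtain p q where pq: "60 = rep_index i * p" "60 = rep_index j * q"
    using m(3,4) by (metis dvdE mod_eq_0_iff_dvd)
  have "rep_index i * rep_index j * (p * rep_coord i x (\<rho> l)) =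
      rep_index i * rep_index j * (q * rep_coord j y l)" for l
  proof -
    have "rep_index i * rep_index j * (p * rep_coord i x (\<rho> l)) =
        (rep_index i * p) * (rep_coord i x (\<rho> l) * rep_index j)" by (simp only: ac_simps)
    also have "\<dots> = (rep_index j * q) * (rep_coord j y l * rep_index i)"
      by (simp only: eq pq[symmetric])
    finally show ?thesis by (simp only: ac_simps)
  qed
  then have "p * rep_coord i x (\<rho> l) = q * rep_coord j y l" for l using m by simp
  moreover have "60 div rep_index i = p" "60 div rep_index j = q"
    using pq m by (metis less_irrefl nonzero_mult_div_cancel_left)+
  moreover have "p * (c mod rep_index i) = p * c mod 60" "q * (c mod rep_index j) = q * c mod 60" for c
    unfolding mult_mod_right using pq by (simp_all add: mult.commute)
  ultimately have h: "60 div rep_index i * (rep_coord i x (\<rho> l) mod rep_index i) =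
      60 div rep_index j * (rep_coord j y l mod rep_index j)" for l
    by simp
  have "image_mset (\<lambda>k. 60 div rep_index i * (rep_coord i x k mod rep_index i)) (image_mset \<rho> (mset_set UNIV)) =
      image_mset (\<lambda>l. 60 div rep_index j * (rep_coord j y l mod rep_index j)) (mset_set UNIV)"
    by (simp add: multiset.map_comp o_def h)
  moreover have "image_mset \<rho> (mset_set UNIV) = mset_set UNIV"
    using bij by (simp add: image_mset_mset_set bij_def)
  ultimately have "mset (rep_multiples i (x $ 7 mod rep_index i)) = mset (rep_multiples j (y $ 7 mod rep_index j))"
    unfolding sort_rep_coord[OF i] sort_rep_coord[OF j] by simp
  then have "rep_multiples i (x $ 7 mod rep_index i) = rep_multiples j (y $ 7 mod rep_index j)"
    unfolding rep_multiples_def mset_sort by (intro properties_for_sort) simp_all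
  moreover have "rep_multiples i (x $ 7 mod rep_index i) = rep_multiples i 1"
    by (simp add: rep_multiples_def x_def mod_mult_left_eq[of 1, simplified])
  ultimately show ?thesis using m by (intro bexI[of _ "y $ 7 mod rep_index j"]) simp_all
qed

lemma rep_simplex_inequivalent:
  assumes "i \<in> {1..11}" "j \<in> {1..11}" "i \<noteq> j"
  shows "\<not> arith_equivalent (rep_simplex i) (rep_simplex j)"
proof
  assume "arith_equivalent (rep_simplex i) (rep_simplex j)"
  then have "\<exists>k\<in>set [0..rep_index j - 1]. rep_multiples i 1 = rep_multiples j k"
    "\<exists>k\<in>set [0..rep_index i - 1]. rep_multiples j 1 = rep_multiples i k"
    using rep_multiples_equivalent assms arith_equivalent_sym by blast+
  moreover have "i \<in> set [1, 2, 3, 4, 5, 6, 7, 8, 9, 10, 11]" "j \<in> set [1, 2, 3, 4, 5, 6, 7, 8, 9, 10, 11]"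
    using assms unfolding reps by simp_all
  ultimately show False using rep_multiples_distinct assms(3) unfolding list_all_iff list_ex_iff by blast
qed

theorem theorem3:
  shows "card (Collect delaunay_simplex // {(S, T :: (int ^ 7) set). arith_equivalent S T}) = 11
    \<and> (\<forall>i\<in>{1..11}. delaunay_simplex (rep_simplex i))
    \<and> (\<forall>i\<in>{1..11}. \<forall>j\<in>{1..11}. i \<noteq> j \<longrightarrow> \<not> arith_equivalent (rep_simplex i) (rep_simplex j))
    \<and> (\<forall>S :: (int ^ 7) set. delaunay_simplex S \<longrightarrow>
          (\<exists>i\<in>{1..11}. arith_equivalent S (rep_simplex i)))"
proof (intro conjI ballI impI allI)
  let ?R = "{(S, T :: (int ^ 7) set). arith_equivalent S T}"
  have R: "equiv UNIV ?R"
    by (intro equivI refl_onI symI transI)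
      (auto intro: arith_equivalent_refl arith_equivalent_sym arith_equivalent_trans)
  have "inj_on (\<lambda>i. ?R `` {rep_simplex i}) {1..11}"
  proof (rule inj_onI)
    fix i j :: nat assume ij: "i \<in> {1..11}" "j \<in> {1..11}" "?R `` {rep_simplex i} = ?R `` {rep_simplex j}"
    then have "(rep_simplex i, rep_simplex j) \<in> ?R" using eq_equiv_class[OF _ R] by blast
    then show "i = j" using rep_simplex_inequivalent ij by auto
  qed
  moreover have "Collect delaunay_simplex // ?R = (\<lambda>i. ?R `` {rep_simplex i}) ` {1..11}"
  proof (intro equalityI subsetI)
    fix X assume "X \<in> Collect delaunay_simplex // ?R"
    then obtain S where S: "delaunay_simplex S" "X = ?R `` {S}" by (auto elim: quotientE)
    then obtain i where i: "i \<in> {1..11}" "arith_equivalent S (rep_simplex i)"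
      using delaunay_simplex_classification by blast
    then have "?R `` {S} = ?R `` {rep_simplex i}" by (intro equiv_class_eq[OF R]) simp
    then show "X \<in> (\<lambda>i. ?R `` {rep_simplex i}) ` {1..11}" using i(1) S(2) by blast
  next
    fix X assume "X \<in> (\<lambda>i. ?R `` {rep_simplex i}) ` {1..11}"
    then obtain i where i: "i \<in> {1..11}" "X = ?R `` {rep_simplex i}" by blast
    show "X \<in> Collect delaunay_simplex // ?R"
      unfolding i(2) by (intro quotientI CollectI delaunay_rep i(1))
  qed
  ultimately show "card (Collect delaunay_simplex // ?R) = 11" by (simp add: card_image)
qed (use delaunay_rep rep_simplex_inequivalent delaunay_simplex_classification in blast)+

end
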